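(* Let $1<p<\infty$, let $q$ be the conjugate index of $p$ (so $1/p+1/q=1$), and let $\alpha,\beta$ be real numbers. Then $$(F_{\alpha p}^p)^*=F_{\beta q}^q$$ with equivalent norms under the pairing $\langle\ ,\ \rangle_{\alpha+\beta}$. That is, for each $g\in F_{\beta q}^q$ the functional $f\mapsto\langle f,g\rangle_{\alpha+\beta}$ is well defined and bounded on $F_{\alpha p}^p$; every bounded linear functional on $F_{\alpha p}^p$ is of this form for a unique $g\in F_{\beta q}^q$; and the functional norm is equivalent to $\|g\|_{F_{\beta q}^q}$.
   Context: Fix an integer $n\ge1$. $dV$ is Lebesgue volume measure on $\mathbb{C}^n$ normalized so that $\int_{\mathbb{C}^n}e^{-|z|^2}dV(z)=1$. For $\alpha$ real and $0<p<\infty$, $F_\alpha^p$ is the space of entire functions $f$ on $\mathbb{C}^n$ with $\|f\|_{F_\alpha^p}=\left\{\int_{\mathbb{C}^n}|f(z)e^{-|z|^2/2}|^p(1+|z|)^{-\alpha}dV(z)\right\}^{1/p}<\infty$. For an entire $f$ with homogeneous expansion $f=\sum_{k\ge0}f_k$ ($f_k$ a homogeneous polynomial of degree $k$) and $s$ real, $f_s^-=\sum_{k\le|s|}f_k$ and $f_s^+=\sum_{k>|s|}f_k$. For $\sigma$ real put $(f,g)_\sigma=\int_{\mathbb{C}^n}f(z)\overline{g(z)}e^{-|z|^2}|z|^{-\sigma}dV(z)$, and define the pairing $\langle f,g\rangle_\sigma=(f,g)_\sigma$ if $\sigma<2n$, and $\langle f,g\rangle_\sigma=(f_{\sigma/2}^-,g_{\sigma/2}^-)_0+(f_{\sigma/2}^+,g_{\sigma/2}^+)_\sigma$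 if $\sigma\ge2n$. *)

theory Defs
  imports "HOL-Probability.Probability" "HOL-Complex_Analysis.Complex_Analysis"
begin

text \<open>Complex n-space is \<open>complex ^ 'n\<close> with n = \<open>CARD('n)\<close>, which is positive for every finite type.
  Its norm is the Euclidean one and \<open>lborel\<close> is Lebesgue measure on the underlying real 2n-space.\<close>

definition dV :: "(complex ^ 'n::finite) measure" where
  "dV = density lborel (\<lambda>_. ennreal (1 / pi ^ CARD('n)))"

lemma sets_dV [simp, measurable_cong]: "sets dV = sets borel"
  and space_dV [simp]: "space dV = UNIV"
  by (simp_all add: dV_def)

lemma nn_integral_gaussian_real: "(\<integral>\<^sup>+x. ennreal (exp (- x\<^sup>2)) \<partial>lborel) = ennreal (sqrt pi)"
proof -
  have "has_bochner_integral lborel (\<lambda>x::real. exp (- x\<^sup>2)) (2 * (sqrt pi / 2))"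
    using has_bochner_integral_even_function[OF gaussian_moment_0] by simp
  then show ?thesis
    by (simp add: has_bochner_integral_iff nn_integral_eq_integral)
qed

text \<open>The factor in the definition of \<open>dV\<close> is the one for which the Gaussian has total mass one.\<close>

lemma dV_normalized:
  "has_bochner_integral dV (\<lambda>z :: complex ^ 'n::finite. exp (- (norm z)\<^sup>2)) 1"
proof (rule has_bochner_integral_nn_integral)
  have prod: "ennreal (exp (- (norm z)\<^sup>2)) = (\<Prod>b\<in>Basis. ennreal (exp (- (z \<bullet> b)\<^sup>2)))"
    for z :: "complex ^ 'n"
  proof -
    have "(norm z)\<^sup>2 = (\<Sum>b\<in>Basis. (z \<bullet> b)\<^sup>2)"
      by (subst power2_norm_eq_inner, subst euclidean_inner) (simp add: power2_eq_square)
    then show ?thesis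
      by (simp add: prod_ennreal exp_sum sum_negf [symmetric])
  qed
  have "(\<integral>\<^sup>+z. ennreal (exp (- (norm (z :: complex ^ 'n))\<^sup>2)) \<partial>lborel)
      = (\<Prod>b\<in>(Basis :: (complex ^ 'n) set). ennreal (sqrt pi))"
    by (simp only: prod) (subst nn_integral_lborel_prod; simp add: nn_integral_gaussian_real)
  also have "\<dots> = ennreal (pi ^ CARD('n))"
  proof -
    have "ennreal (sqrt pi) ^ (2 * CARD('n)) = ennreal (sqrt pi ^ (2 * CARD('n)))"
      by (rule ennreal_power) simp
    then show ?thesis
      by (simp add: power_mult mult.commute[of "CARD('n)"])
  qed
  finally have "(\<integral>\<^sup>+z. ennreal (exp (- (norm (z :: complex ^ 'n))\<^sup>2)) \<partial>lborel)
      = ennreal (pi ^ CARD('n))" .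
  then show "(\<integral>\<^sup>+z. ennreal (exp (- (norm (z :: complex ^ 'n))\<^sup>2)) \<partial>dV) = ennreal 1"
    unfolding dV_def
    by (subst nn_integral_density; simp?)
      (subst nn_integral_cmult; simp add: ennreal_mult'[symmetric])
qed (auto simp: dV_def)

definition entire :: "(complex ^ 'n::finite \<Rightarrow> complex) \<Rightarrow> bool" where
  "entire f \<longleftrightarrow> (\<forall>z. \<exists>L. (f has_derivative L) (at z) \<and> (\<forall>c v. L (c *s v) = c * L v))"

definition fock_integrand :: "real \<Rightarrow> real \<Rightarrow> (complex ^ 'n::finite \<Rightarrow> complex) \<Rightarrow> complex ^ 'n \<Rightarrow> real" where
  "fock_integrand a p f z =
     cmod (f z * of_real (exp (- (norm z)\<^sup>2 / 2))) powr p * (1 + norm z) powr (- a)"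

definition fock_space :: "real \<Rightarrow> real \<Rightarrow> (complex ^ 'n::finite \<Rightarrow> complex) set" where
  "fock_space a p = {f. entire f \<and> integrable dV (fock_integrand a p f)}"

definition fock_norm :: "real \<Rightarrow> real \<Rightarrow> (complex ^ 'n::finite \<Rightarrow> complex) \<Rightarrow> real" where
  "fock_norm a p f = (LINT z|dV. fock_integrand a p f z) powr (1 / p)"

definition homogeneous_polynomial :: "nat \<Rightarrow> (complex ^ 'n::finite \<Rightarrow> complex) \<Rightarrow> bool" where
  "homogeneous_polynomial k P \<longleftrightarrow> (\<exists>c :: ('n \<Rightarrow> nat) \<Rightarrow> complex.
     \<forall>z. P z = (\<Sum>m | (\<Sum>i\<in>UNIV. m i) = k. c m * (\<Prod>i\<in>UNIV. (z $ i) ^ m i)))"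

lemma finite_multi_indices: "finite {m :: 'n::finite \<Rightarrow> nat. (\<Sum>i\<in>UNIV. m i) = k}"
proof (rule finite_subset)
  show "{m :: 'n \<Rightarrow> nat. (\<Sum>i\<in>UNIV. m i) = k} \<subseteq> PiE UNIV (\<lambda>_. {..k})"
    using member_le_sum[of _ "UNIV :: 'n set"] by (auto simp: PiE_UNIV_domain)
qed (simp add: finite_PiE)

definition homogeneous_expansion ::
    "(complex ^ 'n::finite \<Rightarrow> complex) \<Rightarrow> (nat \<Rightarrow> complex ^ 'n \<Rightarrow> complex) \<Rightarrow> bool" where
  "homogeneous_expansion f F \<longleftrightarrow>
     (\<forall>k. homogeneous_polynomial k (F k)) \<and> (\<forall>z. (\<lambda>k. F k z) sums f z)"

definition homogeneous_part ::
    "(complex ^ 'n::finite \<Rightarrow> complex) \<Rightarrow> nat \<Rightarrow> complex ^ 'n \<Rightarrow> complex" where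
  "homogeneous_part f = (THE F. homogeneous_expansion f F)"

lemma homogeneous_polynomial_scale:
  assumes "homogeneous_polynomial k P"
  shows "P (t *s z) = t ^ k * P z"
proof -
  obtain c where c: "P z = (\<Sum>m | (\<Sum>i\<in>UNIV. m i) = k. c m * (\<Prod>i\<in>UNIV. (z $ i) ^ m i))" for z
    using assms unfolding homogeneous_polynomial_def by blast
  show ?thesis
    unfolding c sum_distrib_left
    by (rule sum.cong) (auto simp: power_mult_distrib prod.distrib simp flip: power_sum)
qed

lemma homogeneous_expansion_unique:
  assumes "homogeneous_expansion f F" "homogeneous_expansion f G"
  shows "F = G"
proof (intro ext)
  fix k z
  have sums: "(\<lambda>k. (F k z - G k z) * t ^ k) sums 0" for t
  proof -
    have "(\<lambda>k. F k (t *s z) - G k (t *s z)) sums (f (t *s z) - f (t *s z))"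
      using assms unfolding homogeneous_expansion_def by (intro sums_diff) auto
    moreover have "F k (t *s z) - G k (t *s z) = (F k z - G k z) * t ^ k" for k
      using assms homogeneous_polynomial_scale[of k "F k" t z] homogeneous_polynomial_scale[of k "G k" t z]
      by (simp add: homogeneous_expansion_def left_diff_distrib mult.commute[of "t ^ k"])
    ultimately show ?thesis by simp
  qed
  have "Abs_fps (\<lambda>k. F k z - G k z) = 0"
  proof (rule eval_fps_eqD)
    show "fps_conv_radius (Abs_fps (\<lambda>k. F k z - G k z)) > 0"
      using conv_radius_geI[of "\<lambda>k. F k z - G k z" 1] sums[of 1]
        less_le_trans[of 0 "ereal 1" "conv_radius (\<lambda>k. F k z - G k z)"]
      by (simp add: fps_conv_radius_def sums_iff)
    show "eventually (\<lambda>t. eval_fps (Abs_fps (\<lambda>k. F k z - G k z)) t = eval_fps 0 t) (nhds 0)"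
      using sums by (simp add: eval_fps_def sums_iff)
  qed auto
  then show "F k z = G k z"
    by (simp add: fps_eq_iff)
qed

lemma homogeneous_part_eqI: "homogeneous_expansion f F \<Longrightarrow> homogeneous_part f = F"
  unfolding homogeneous_part_def using homogeneous_expansion_unique by blast

definition low_part :: "real \<Rightarrow> (complex ^ 'n::finite \<Rightarrow> complex) \<Rightarrow> complex ^ 'n \<Rightarrow> complex" where
  "low_part s f z = (\<Sum>k | real k \<le> \<bar>s\<bar>. homogeneous_part f k z)"

definition high_part :: "real \<Rightarrow> (complex ^ 'n::finite \<Rightarrow> complex) \<Rightarrow> complex ^ 'n \<Rightarrow> complex" where
  "high_part s f z = (\<Sum>k. if real k > \<bar>s\<bar> then homogeneous_part f k z else 0)"

text \<open>Here \<open>0 powr x = 0\<close> even for \<open>x = 0\<close>; this only affects the integrand at the origin,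
  which is a null set.\<close>

definition weighted_integrand :: "real \<Rightarrow> (complex ^ 'n::finite \<Rightarrow> complex) \<Rightarrow>
    (complex ^ 'n \<Rightarrow> complex) \<Rightarrow> complex ^ 'n \<Rightarrow> complex" where
  "weighted_integrand \<sigma> f g z =
     f z * cnj (g z) * of_real (exp (- (norm z)\<^sup>2) * norm z powr (- \<sigma>))"

definition weighted_inner :: "real \<Rightarrow> (complex ^ 'n::finite \<Rightarrow> complex) \<Rightarrow>
    (complex ^ 'n \<Rightarrow> complex) \<Rightarrow> complex" where
  "weighted_inner \<sigma> f g = (LINT z|dV. weighted_integrand \<sigma> f g z)"

definition pairing :: "real \<Rightarrow> (complex ^ 'n::finite \<Rightarrow> complex) \<Rightarrow>
    (complex ^ 'n \<Rightarrow> complex) \<Rightarrow> complex" where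
  "pairing \<sigma> f g =
     (if \<sigma> < 2 * real CARD('n) then weighted_inner \<sigma> f g
      else weighted_inner 0 (low_part (\<sigma> / 2) f) (low_part (\<sigma> / 2) g)
         + weighted_inner \<sigma> (high_part (\<sigma> / 2) f) (high_part (\<sigma> / 2) g))"

text \<open>Absolute convergence of the integrals in \<open>pairing\<close>; without it the Bochner integral
  would silently be 0.\<close>

definition pairing_well_defined :: "real \<Rightarrow> (complex ^ 'n::finite \<Rightarrow> complex) \<Rightarrow>
    (complex ^ 'n \<Rightarrow> complex) \<Rightarrow> bool" where
  "pairing_well_defined \<sigma> f g \<longleftrightarrow>
     (if \<sigma> < 2 * real CARD('n) then integrable dV (weighted_integrand \<sigma> f g)
      else integrable dV (weighted_integrand 0 (low_part (\<sigma> / 2) f) (low_part (\<sigma> / 2) g))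
         \<and> integrable dV (weighted_integrand \<sigma> (high_part (\<sigma> / 2) f) (high_part (\<sigma> / 2) g)))"

text \<open>Functionals are represented by total functions of which only the values on the Fock
  space matter.\<close>

definition bounded_functional ::
    "real \<Rightarrow> real \<Rightarrow> ((complex ^ 'n::finite \<Rightarrow> complex) \<Rightarrow> complex) \<Rightarrow> bool" where
  "bounded_functional a p \<Lambda> \<longleftrightarrow>
     (\<forall>f\<in>fock_space a p. \<forall>h\<in>fock_space a p. \<Lambda> (\<lambda>z. f z + h z) = \<Lambda> f + \<Lambda> h) \<and>
     (\<forall>c. \<forall>f\<in>fock_space a p. \<Lambda> (\<lambda>z. c * f z) = c * \<Lambda> f) \<and>
     (\<exists>C. \<forall>f\<in>fock_space a p. cmod (\<Lambda> f) \<le> C * fock_norm a p f)"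

definition functional_norm ::
    "real \<Rightarrow> real \<Rightarrow> ((complex ^ 'n::finite \<Rightarrow> complex) \<Rightarrow> complex) \<Rightarrow> real" where
  "functional_norm a p \<Lambda> = (SUP f \<in> {f \<in> fock_space a p. fock_norm a p f \<le> 1}. cmod (\<Lambda> f))"

end

theory Submission
  imports Defs
begin

text \<open>
  On homogeneous polynomials of degree \<open>k\<close> the pairing with parameter \<open>\<sigma> = 2s\<close> is the Gaussian inner
  product multiplied by \<open>\<Gamma>(n + k - s) / \<Gamma>(n + k)\<close> (by \<open>1\<close> for the finitely many low degrees if
  \<open>\<sigma> \<ge> 2n\<close>), so its reproducing kernel is \<open>K(z, w) = \<Sum>\<^sub>k a\<^sub>k \<langle>z, w\<rangle>\<^sup>k / k!\<close> with the inverse factors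
  \<open>a\<^sub>k\<close>. Writing \<open>a\<^sub>k\<close> as a polynomial in \<open>k\<close> times a Beta integral gives
  \<open>|K(z, w)| \<le> C (1 + |z|)\<^sup>s (1 + |w|)\<^sup>s exp (|z|\<^sup>2/2 + |w|\<^sup>2/2 - |z - w|\<^sup>2/8)\<close>. Hence integration against
  \<open>K\<close> is dominated by convolution with a Gaussian and is bounded between the weighted Lebesgue spaces.
  A bounded functional \<open>\<Lambda>\<close> is represented by \<open>g(w) = cnj (\<Lambda> K(-, w))\<close>: the boundedness of the integral
  operator, tested on \<open>|g|\<^bsup>q-2\<^esup>g\<close> cut off to balls, gives the norm estimate without appeal to the
  Hahn-Banach theorem, and with \<open>\<sigma> = 0\<close> it gives the density needed to identify \<open>\<Lambda>\<close> with the pairing.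
\<close>

section \<open>Invariance of Lebesgue measure\<close>

text \<open>The delicate point of the pairing is the origin: |z|^(-\<sigma>) is not integrable there
  once \<sigma> \<ge> 2n, although the norms involve only the harmless weight (1 + |z|)^(-\<alpha>).
  A product of two functions vanishing to order N at 0 repairs this as soon as s < n + N, which is
  therefore the standing hypothesis, with N a free parameter. The degrees below N change the kernel
  by a polynomial in <z,w>, which the Gaussian factors absorb. The rate 1/8 comes from exp (Re
  <z,w>) = exp (|z|^2/2 + |w|^2/2 - |z - w|^2/2). Half of this decay is given up to cover Re <z,w> <
  0, and half of the rest pays for powers of 1 + |z - w|. Keeping the real part in the exponent is
  essential: exp |<z,w>| does not decay when w is a unit scalar times z. The test functions are cut
  off to balls for two reasons: the integral of |g|^q is then known to be finite before it is
  estimated, and \<Lambda> can be moved under the integral sign degree by degree, by linearity and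
  one limit.\<close>

lemma norm_vector_smult: "norm (c *s (z :: complex ^ 'n::finite)) = cmod c * norm z"
  by (simp add: norm_vec_def L2_set_def norm_mult power_mult_distrib
      flip: sum_distrib_left) (simp add: real_sqrt_mult)

lemma scaleR_eq_vector_smult: "r *\<^sub>R (z :: complex ^ 'n::finite) = of_real r *s z"
  unfolding vec_eq_iff vector_scaleR_component vector_smult_component
  by (simp add: scaleR_conv_of_real)

lemma nn_integral_lborel_translate:
  fixes F :: "'a::euclidean_space \<Rightarrow> ennreal"
  assumes [measurable]: "F \<in> borel_measurable borel"
  shows "(\<integral>\<^sup>+x. F (x + c) \<partial>lborel) = (\<integral>\<^sup>+x. F x \<partial>lborel)"
proof -
  have "(\<integral>\<^sup>+x. F x \<partial>lborel) = (\<integral>\<^sup>+x. F x \<partial>distr lborel borel ((+) c))"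
    by (simp add: lborel_distr_plus)
  also have "\<dots> = (\<integral>\<^sup>+x. F (x + c) \<partial>lborel)"
    by (subst nn_integral_distr) (auto simp: add.commute)
  finally show ?thesis by simp
qed

text \<open>Averaging over translates by the unit ball, which a linear isometry fixes, reduces the
  invariance under isometries to that under translations.\<close>

lemma nn_integral_lborel_isometry:
  fixes F :: "'a::euclidean_space \<Rightarrow> ennreal" and U :: "'a \<Rightarrow> 'a"
  assumes [measurable]: "F \<in> borel_measurable borel"
    and U: "linear U" "\<And>x. norm (U x) = norm x"
  shows "(\<integral>\<^sup>+x. F (U x) \<partial>lborel) = (\<integral>\<^sup>+x. F x \<partial>lborel)"
proof -
  have inj: "inj U"
    using U by (metis linear_injective_0 norm_eq_zero)
  then obtain V where linV: "linear V" and VU: "\<And>x. V (U x) = x" and UV: "\<And>x. U (V x) = x"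
    using linear_injective_isomorphism[OF U(1)] by auto
  have contU: "continuous_on UNIV U" and contV: "continuous_on UNIV V"
    using U(1) linV by (auto intro: linear_continuous_on linear_conv_bounded_linear[THEN iffD1])
  have [measurable]: "U \<in> borel_measurable borel" "V \<in> borel_measurable borel"
    using contU contV by (auto intro: borel_measurable_continuous_onI)
  define I :: "'a \<Rightarrow> ennreal" where "I = indicator (ball 0 1)"
  have [measurable]: "I \<in> borel_measurable borel"
    unfolding I_def by (rule borel_measurable_indicator) simp
  define b where "b = (\<integral>\<^sup>+y. I y \<partial>lborel)"
  \<comment> \<open>The volume of the unit ball is neither 0 nor infinite, so it can be cancelled at
    the end.\<close>
  have b: "b \<noteq> 0" "b \<noteq> \<infinity>"
    using emeasure_lborel_ball_finite[of "0::'a" 1]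
    by (auto simp: b_def I_def emeasure_ball ennreal_eq_0_iff not_le)
  have ballV: "I (y - U x) = (I (x + - V y))" for x y
  proof -
    have "norm (y - U x) = norm (U (V y - x))"
      using U(1) by (simp add: linear_diff UV)
    then show ?thesis
      using U(2) by (auto simp: I_def indicator_def norm_minus_commute)
  qed
  \<comment> \<open>Translating the argument of \<open>F (U x)\<close> by \<open>V y\<close> shifts
    the argument of \<open>F\<close> by \<open>y\<close>; the integral is thus constant in
    \<open>y\<close> and may be averaged over the ball.\<close>
  have transl: "(\<integral>\<^sup>+x. F (U x) \<partial>lborel) = (\<integral>\<^sup>+x. F (U x + y) \<partial>lborel)" for y
    using nn_integral_lborel_translate[of "\<lambda>x. F (U x)" "V y"] U(1) by (simp add: linear_add UV)
  have "(\<integral>\<^sup>+x. F (U x) \<partial>lborel) * b = (\<integral>\<^sup>+y. I y * (\<integral>\<^sup>+x. F (U x) \<partial>lborel) \<partial>lborel)"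
    unfolding b_def by (subst nn_integral_multc) (auto simp: mult.commute)
  also have "\<dots> = (\<integral>\<^sup>+y. I y * (\<integral>\<^sup>+x. F (U x + y) \<partial>lborel) \<partial>lborel)"
    by (rule nn_integral_cong, rule arg_cong2[where f="(*)"], rule refl, rule transl)
  also have "\<dots> = (\<integral>\<^sup>+y. (\<integral>\<^sup>+x. I y * F (U x + y) \<partial>lborel) \<partial>lborel)"
    by (subst nn_integral_cmult) auto
  also have "\<dots> = (\<integral>\<^sup>+x. (\<integral>\<^sup>+y. I y * F (U x + y) \<partial>lborel) \<partial>lborel)"
    by (rule lborel_pair.Fubini') measurable
  also have "\<dots> = (\<integral>\<^sup>+x. (\<integral>\<^sup>+y. I (y - U x) * F y \<partial>lborel) \<partial>lborel)"
  proof (rule nn_integral_cong)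
    fix x
    show "(\<integral>\<^sup>+y. I y * F (U x + y) \<partial>lborel) = (\<integral>\<^sup>+y. I (y - U x) * F y \<partial>lborel)"
      using nn_integral_lborel_translate[of "\<lambda>y. I (y - U x) * F y" "U x"]
      by (simp add: add.commute)
  qed
  also have "\<dots> = (\<integral>\<^sup>+x. (\<integral>\<^sup>+y. F y * I (x + - V y) \<partial>lborel) \<partial>lborel)"
    by (simp only: ballV mult.commute)
  also have "\<dots> = (\<integral>\<^sup>+y. (\<integral>\<^sup>+x. F y * I (x + - V y) \<partial>lborel) \<partial>lborel)"
    by (rule lborel_pair.Fubini') measurable
  also have "\<dots> = (\<integral>\<^sup>+y. F y * (\<integral>\<^sup>+x. I (x + - V y) \<partial>lborel) \<partial>lborel)"
    by (subst nn_integral_cmult) auto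
  also have "\<dots> = (\<integral>\<^sup>+y. F y * b \<partial>lborel)"
    unfolding b_def by (subst nn_integral_lborel_translate) auto
  also have "\<dots> = (\<integral>\<^sup>+y. F y \<partial>lborel) * b"
    by (subst nn_integral_multc) auto
  finally show ?thesis
    using b by (simp add: mult.commute[of _ b] ennreal_mult_cancel_left)
qed

lemma lborel_distr_isometry:
  assumes U: "linear (U :: 'a::euclidean_space \<Rightarrow> 'a)" "\<And>x. norm (U x) = norm x"
  shows "distr lborel borel U = lborel"
proof (rule measure_eqI)
  have [measurable]: "U \<in> borel_measurable borel"
    using U(1) by (intro borel_measurable_continuous_onI linear_continuous_on)
      (simp add: linear_conv_bounded_linear)
  fix A assume "A \<in> sets (distr lborel borel U)"
  then have [measurable]: "A \<in> sets borel" by simp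
  show "emeasure (distr lborel borel U) A = emeasure lborel A"
    using nn_integral_lborel_isometry[of "indicator A" U] U
    by (simp flip: nn_integral_indicator add: nn_integral_distr)
qed simp

lemma linear_vector_smult: "linear ((*s) (c::complex) :: complex ^ 'n::finite \<Rightarrow> _)"
  by (rule linearI) (auto simp: vec_eq_iff algebra_simps scaleR_conv_of_real)

section \<open>The measure \<open>dV\<close>: finiteness on bounded sets, rotations, translations,
  dilations\<close>

lemma emeasure_dV: "A \<in> sets borel \<Longrightarrow> emeasure (dV :: (complex ^ 'n::finite) measure) A
    = ennreal (1 / pi ^ CARD('n)) * emeasure lborel A"
  by (simp add: dV_def emeasure_density_const)

lemma nn_integral_dV: "F \<in> borel_measurable borel \<Longrightarrow> (\<integral>\<^sup>+z. F z \<partial>(dV :: (complex ^ 'n::finite) measure))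
    = ennreal (1 / pi ^ CARD('n)) * (\<integral>\<^sup>+z. F z \<partial>lborel)"
  unfolding dV_def by (subst nn_integral_density) (auto simp: nn_integral_cmult)

lemma sigma_finite_dV: "sigma_finite_measure (dV :: (complex ^ 'n::finite) measure)"
  unfolding dV_def by (subst sigma_finite_measure.sigma_finite_iff_density_finite) (auto intro: sigma_finite_lborel)

interpretation dV: sigma_finite_measure "dV :: (complex ^ 'n::finite) measure"
  by (rule sigma_finite_dV)

interpretation dV_pair: pair_sigma_finite "dV :: (complex ^ 'n::finite) measure" "dV :: (complex ^ 'n::finite) measure" ..

lemma finite_dV_bounded:
  assumes "bounded A" "A \<in> sets borel"
  shows "emeasure (dV :: (complex ^ 'n::finite) measure) A < \<infinity>"
  using emeasure_bounded_finite[OF assms(1)] assms(2)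
  by (simp add: emeasure_dV ennreal_mult_less_top)

lemma distr_dV_rotation:
  assumes "cmod c = 1"
  shows "distr dV borel ((*s) c) = (dV :: (complex ^ 'n::finite) measure)"
proof (rule measure_eqI)
  have [measurable]: "((*s) c :: complex ^ 'n \<Rightarrow> _) \<in> borel_measurable borel"
    using linear_vector_smult[of c] by (intro borel_measurable_continuous_onI linear_continuous_on)
      (simp add: linear_conv_bounded_linear)
  fix A assume "A \<in> sets (distr dV borel ((*s) c :: complex ^ 'n \<Rightarrow> _))"
  then have A[measurable]: "A \<in> sets borel" by simp
  have "((*s) c) -` A \<in> sets borel"
    using measurable_sets[of "(*s) c" borel borel A] by simp
  then have "emeasure (distr dV borel ((*s) c)) A = ennreal (1 / pi ^ CARD('n)) * emeasure (distr lborel borel ((*s) c)) A"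
    by (simp add: emeasure_distr emeasure_dV)
  then show "emeasure (distr dV borel ((*s) c)) A = emeasure dV A"
    using assms by (simp add: lborel_distr_isometry linear_vector_smult norm_vector_smult emeasure_dV)
qed simp

lemma distr_dV_translation: "distr dV borel ((+) c) = (dV :: (complex ^ 'n::finite) measure)"
proof (rule measure_eqI)
  fix A assume "A \<in> sets (distr dV borel ((+) c :: complex ^ 'n \<Rightarrow> _))"
  then have A[measurable]: "A \<in> sets borel" by simp
  have "((+) c) -` A \<in> sets borel"
    using measurable_sets[of "(+) c" borel borel A] by simp
  then have "emeasure (distr dV borel ((+) c)) A = ennreal (1 / pi ^ CARD('n)) * emeasure (distr lborel borel ((+) c)) A"
    by (simp add: emeasure_distr emeasure_dV)
  then show "emeasure (distr dV borel ((+) c)) A = emeasure dV A"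
    by (simp add: lborel_distr_plus emeasure_dV)
qed simp

lemma vector_smult_measurable [measurable]:
  "((*s) (c::complex) :: complex ^ 'n::finite \<Rightarrow> _) \<in> borel_measurable borel"
  using linear_vector_smult[of c] by (intro borel_measurable_continuous_onI linear_continuous_on)
    (simp add: linear_conv_bounded_linear)

lemma integral_dV_rotation:
  fixes F :: "complex ^ 'n::finite \<Rightarrow> complex"
  assumes [measurable]: "F \<in> borel_measurable borel" and c: "cmod c = 1"
  shows "(LINT z|dV. F (c *s z)) = (LINT z|dV. F z)"
  using integral_distr[of "(*s) c" dV borel F] by (simp add: distr_dV_rotation[OF c])

lemma
  fixes F :: "complex ^ 'n::finite \<Rightarrow> complex"
  assumes [measurable]: "F \<in> borel_measurable borel"
  shows integral_dV_translation: "(LINT z|dV. F (c + z)) = (LINT z|dV. F z)"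
    and integrable_dV_translation: "integrable dV (\<lambda>z. F (c + z)) \<longleftrightarrow> integrable dV F"
  using integral_distr[of "(+) c" dV borel F] integrable_distr_eq[of "(+) c" dV borel F]
  by (simp_all add: distr_dV_translation)

lemma nn_integral_dV_translation:
  fixes F :: "complex ^ 'n::finite \<Rightarrow> ennreal"
  assumes [measurable]: "F \<in> borel_measurable borel"
  shows "(\<integral>\<^sup>+z. F (z + c) \<partial>dV) = (\<integral>\<^sup>+z. F z \<partial>dV)"
  by (simp add: nn_integral_dV nn_integral_lborel_translate)

lemma nn_integral_dV_scale:
  fixes F :: "complex ^ 'n::finite \<Rightarrow> ennreal"
  assumes [measurable]: "F \<in> borel_measurable borel" and r: "r > 0"
  shows "(\<integral>\<^sup>+z. F z \<partial>dV) = ennreal (r ^ (2 * CARD('n))) * (\<integral>\<^sup>+z. F (r *\<^sub>R z) \<partial>dV)"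
proof -
  have "(\<integral>\<^sup>+z. F z \<partial>lborel) = ennreal (r ^ (2 * CARD('n))) * (\<integral>\<^sup>+z. F (r *\<^sub>R z) \<partial>lborel)"
    using r by (subst lborel_affine[of r 0]) (simp_all add: nn_integral_density nn_integral_distr nn_integral_cmult mult.commute[of _ 2])
  then show ?thesis
    by (simp add: nn_integral_dV mult_ac)
qed

section \<open>Radial integration of homogeneous functions\<close>

text \<open>Dilation by sqrt t contributes t^n from the real dimension 2n and t^k from the
  homogeneity of degree 2k. Balls are indexed by the square of the radius so that the Gamma integral
  later appears without a substitution.\<close>

lemma nn_integral_homogeneous_ball:
  fixes h :: "complex ^ 'n::finite \<Rightarrow> real"
  assumes [measurable]: "h \<in> borel_measurable borel" and nonneg: "\<And>z. h z \<ge> 0"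
    and hom: "\<And>r z. r > 0 \<Longrightarrow> h (r *\<^sub>R z) = r ^ (2 * k) * h z"
    and t: "t > 0"
  shows "(\<integral>\<^sup>+z. ennreal (h z) * indicator {z. (norm z)\<^sup>2 \<le> t} z \<partial>dV)
    = ennreal (t ^ (CARD('n) + k)) * (\<integral>\<^sup>+z. ennreal (h z) * indicator {z. (norm z)\<^sup>2 \<le> 1} z \<partial>dV)"
proof -
  have [simp]: "indicator {z :: complex ^ 'n. (norm z)\<^sup>2 \<le> t} (sqrt t *\<^sub>R z) = (indicator {z. (norm z)\<^sup>2 \<le> 1} z :: ennreal)" for z
    using t by (auto simp: indicator_def power_mult_distrib)
  have "(\<integral>\<^sup>+z. ennreal (h z) * indicator {z. (norm z)\<^sup>2 \<le> t} z \<partial>dV)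
    = ennreal (sqrt t ^ (2 * CARD('n))) * (\<integral>\<^sup>+z. ennreal (h (sqrt t *\<^sub>R z)) * indicator {z. (norm z)\<^sup>2 \<le> 1} z \<partial>dV)"
    using t by (subst nn_integral_dV_scale[of _ "sqrt t"]) auto
  also have "(\<integral>\<^sup>+z. ennreal (h (sqrt t *\<^sub>R z)) * indicator {z. (norm z)\<^sup>2 \<le> 1} z \<partial>(dV :: (complex ^ 'n) measure))
    = (\<integral>\<^sup>+z. ennreal (sqrt t ^ (2 * k)) * (ennreal (h z) * indicator {z. (norm z)\<^sup>2 \<le> 1} z) \<partial>dV)"
    using t nonneg by (intro nn_integral_cong) (simp add: hom ennreal_mult mult.assoc)
  also have "\<dots> = ennreal (sqrt t ^ (2 * k)) * (\<integral>\<^sup>+z. ennreal (h z) * indicator {z. (norm z)\<^sup>2 \<le> 1} z \<partial>dV)"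
    by (rule nn_integral_cmult) measurable
  finally show ?thesis
    using t by (simp add: power_mult power_add ennreal_mult mult.assoc)
qed

text \<open>This takes the place of polar coordinates. The image of h dV under z -> |z|^2 has a
  distribution function proportional to t^(n + k), hence a density proportional to t^(n + k - 1).
  The constant is quantified before \<rho>, so that integrals of the same h against two radial
  weights can be compared.\<close>

lemma nn_integral_radial:
  fixes h :: "complex ^ 'n::finite \<Rightarrow> real" and \<rho> :: "real \<Rightarrow> ennreal"
  assumes [measurable]: "h \<in> borel_measurable borel" and nonneg: "\<And>z. h z \<ge> 0"
    and hom: "\<And>r z. r > 0 \<Longrightarrow> h (r *\<^sub>R z) = r ^ (2 * k) * h z"
    and bnd: "\<And>z. norm z \<le> 1 \<Longrightarrow> h z \<le> B"
  shows "\<exists>c\<ge>0. \<forall>\<rho>\<in>borel_measurable borel. (\<integral>\<^sup>+z. ennreal (h z) * \<rho> ((norm z)\<^sup>2) \<partial>dV)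
    = ennreal c * (\<integral>\<^sup>+t\<in>{0<..}. ennreal (t ^ (CARD('n) + k - 1)) * \<rho> t \<partial>lborel)"
proof -
  define D where "D = CARD('n) + k"
  have D: "D > 0" by (simp add: D_def)
  define M where "M = distr (density (dV :: (complex ^ 'n) measure) (\<lambda>z. ennreal (h z))) borel (\<lambda>z. (norm z)\<^sup>2)"
  define I where "I = (\<integral>\<^sup>+z. ennreal (h z) * indicator {z. (norm z)\<^sup>2 \<le> 1} z \<partial>(dV :: (complex ^ 'n) measure))"
  have "I \<le> (\<integral>\<^sup>+z. ennreal B * indicator (cball 0 1) z \<partial>(dV :: (complex ^ 'n) measure))"
    unfolding I_def
    using bnd by (intro nn_integral_mono) (auto simp: indicator_def power_le_one_iff ennreal_leI split: if_splits)
  also have "\<dots> < \<infinity>"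
    using finite_dV_bounded[of "cball (0 :: complex ^ 'n) 1"]
    by (subst nn_integral_cmult_indicator) (auto simp: ennreal_mult_less_top)
  finally have Ifin: "I < \<infinity>" .
  define c where "c = enn2real I"
  have Ic: "I = ennreal c" "c \<ge> 0"
    using Ifin by (auto simp: c_def)
  define N where "N = density lborel (\<lambda>t. indicator {0<..} t * ennreal (c * D * t ^ (D - 1)))"
  have M_at: "emeasure M {..t} = ennreal (c * t ^ D)" if "t > 0" for t
  proof -
    have "emeasure M {..t} = (\<integral>\<^sup>+z. ennreal (h z) * indicator {z. (norm z)\<^sup>2 \<le> t} z \<partial>dV)"
      unfolding M_def by (subst emeasure_distr) (auto simp: emeasure_density vimage_def)
    also have "\<dots> = ennreal (t ^ D) * I"
      unfolding I_def D_def by (rule nn_integral_homogeneous_ball) (use that hom nonneg in auto)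
    finally show ?thesis
      using Ic that by (simp add: ennreal_mult mult.commute)
  qed
  have N_at: "emeasure N {..t} = ennreal (c * t ^ D)" if "t > 0" for t
  proof -
    have "emeasure N {..t} = (\<integral>\<^sup>+x. (indicator {0<..} x * ennreal (c * D * x ^ (D - 1))) * indicator {..t} x \<partial>lborel)"
      unfolding N_def by (subst emeasure_density) auto
    also have "\<dots> = (\<integral>\<^sup>+x. ennreal (c * D * x ^ (D - 1)) * indicator {0..t} x \<partial>lborel)"
      by (intro nn_integral_cong_AE) (use AE_lborel_singleton[of "0::real"] in \<open>eventually_elim, auto simp: indicator_def\<close>)
    also have "\<dots> = ennreal (c * t ^ D - c * 0 ^ D)"
      using Ic that D by (intro nn_integral_FTC_Icc)
        (auto intro!: derivative_eq_intros simp: has_real_derivative_iff_has_vector_derivative[symmetric])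
    finally show ?thesis using D by (simp add: zero_power)
  qed
  \<comment> \<open>There is no mass at 0 or below: it is bounded by c e^D for every e > 0, and D >
    0.\<close>
  have M_neg: "emeasure M {..t} = 0" if "t \<le> 0" for t
  proof -
    have "emeasure M {..t} \<le> ennreal (c * e ^ D)" if "e > 0" for e
      using M_at[OF that] \<open>t \<le> 0\<close> that by (metis M_def atMost_subset_iff borel_closed closed_atMost emeasure_mono order_less_imp_le order_trans sets_distr)
    moreover have "((\<lambda>e. ennreal (c * e ^ D)) \<longlongrightarrow> ennreal (c * 0 ^ D)) (at_right 0)"
      by (intro tendsto_intros)
    ultimately have "emeasure M {..t} \<le> ennreal (c * 0 ^ D)"
      by (intro tendsto_lowerbound) (auto simp: eventually_at_filter)
    then show ?thesis using D by (simp add: zero_power)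
  qed
  have N_neg: "emeasure N {..t} = 0" if "t \<le> 0" for t
    using that unfolding N_def
    by (subst emeasure_density) (auto intro!: nn_integral_zero' AE_I2 simp: indicator_def)
  have MN: "M = N"
  proof (rule measure_eqI_generator_eq[where E="range atMost" and \<Omega>=UNIV and A="\<lambda>i. {..real i}"])
    show "Int_stable (range (atMost :: real \<Rightarrow> _))"
      by (auto simp: Int_stable_def intro: range_eqI[of _ _ "min _ _"])
    show "emeasure M X = emeasure N X" if "X \<in> range atMost" for X
    proof -
      obtain t where "X = {..t}" using \<open>X \<in> range atMost\<close> by (elim rangeE)
      then show ?thesis
        using M_at[of t] N_at[of t] M_neg[of t] N_neg[of t] by (cases "t > 0") auto
    qed
    show "sets M = sigma_sets UNIV (range atMost)" "sets N = sigma_sets UNIV (range atMost)"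
      by (simp_all add: M_def N_def borel_eq_atMost)
    show "(\<Union>i. {..real i}) = UNIV"
      using real_arch_simple by auto
    show "emeasure M {..real i} \<noteq> \<infinity>" for i
      using M_at[of "real i"] M_neg[of "real i"] by (cases "i = 0") auto
  qed auto
  show ?thesis
  proof (intro exI[of _ "c * D"] conjI ballI)
    show "0 \<le> c * real D" using Ic by simp
    fix \<rho> :: "real \<Rightarrow> ennreal" assume [measurable]: "\<rho> \<in> borel_measurable borel"
    have "(\<integral>\<^sup>+z. ennreal (h z) * \<rho> ((norm z)\<^sup>2) \<partial>dV) = (\<integral>\<^sup>+t. \<rho> t \<partial>M)"
      unfolding M_def by (subst nn_integral_distr) (auto simp: nn_integral_density)
    also have "\<dots> = (\<integral>\<^sup>+t. indicator {0<..} t * ennreal (c * D * t ^ (D - 1)) * \<rho> t \<partial>lborel)"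
      unfolding MN N_def by (subst nn_integral_density) auto
    also have "\<dots> = (\<integral>\<^sup>+t. ennreal (c * D) * (ennreal (t ^ (D - 1)) * \<rho> t * indicator {0<..} t) \<partial>lborel)"
      using Ic by (intro nn_integral_cong) (auto simp: indicator_def ennreal_mult mult_ac)
    also have "\<dots> = ennreal (c * D) * (\<integral>\<^sup>+t\<in>{0<..}. ennreal (t ^ (D - 1)) * \<rho> t \<partial>lborel)"
      by (rule nn_integral_cmult) measurable
    finally show "(\<integral>\<^sup>+z. ennreal (h z) * \<rho> ((norm z)\<^sup>2) \<partial>dV) = ennreal (c * D) * (\<integral>\<^sup>+t\<in>{0<..}. ennreal (t ^ (CARD('n) + k - 1)) * \<rho> t \<partial>lborel)"
      by (simp add: D_def)
  qed
qed


lemma nn_integral_Gamma: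
  fixes s :: real
  assumes "s < real D" "D > 0"
  shows "(\<integral>\<^sup>+t\<in>{0<..}. ennreal (t ^ (D - 1)) * ennreal (exp (- t) * t powr - s) \<partial>lborel) = ennreal (Gamma (real D - s))"
proof -
  have "ennreal (Gamma (real D - s)) = (\<integral>\<^sup>+t. ennreal (indicator {0..} t * t powr (real D - s - 1) / exp t) \<partial>lborel)"
    using assms by (intro Gamma_conv_nn_integral_real) simp
  also have "\<dots> = (\<integral>\<^sup>+t\<in>{0<..}. ennreal (t ^ (D - 1)) * ennreal (exp (- t) * t powr - s) \<partial>lborel)"
  proof (intro nn_integral_cong)
    fix t :: real
    have "t powr (real D - s - 1) = t ^ (D - 1) * t powr - s" if "t > 0"
    proof -
      have "t ^ (D - 1) = t powr (real (D - 1))"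
        using that by (simp add: powr_realpow)
      moreover have "real (D - 1) = real D - 1" using assms by (simp add: of_nat_diff)
      ultimately show ?thesis by (simp add: powr_add[symmetric] algebra_simps)
    qed
    then show "ennreal (indicator {0..} t * t powr (real D - s - 1) / exp t)
      = ennreal (t ^ (D - 1)) * ennreal (exp (- t) * t powr - s) * indicator {0<..} t"
      by (cases "t > 0") (auto simp: indicator_def exp_minus divide_inverse ennreal_mult[symmetric] mult_ac)
  qed
  finally show ?thesis by simp
qed

text \<open>The radial weight exp (-t) t^(-s) turns the radial integral into Gamma (n + k - s); s <
  n + k is convergence at the origin. Since c does not depend on s, passing from the Gaussian to the
  singular weight multiplies every such integral by Gamma (n + k - s) / Gamma (n + k).\<close>

lemma homogeneous_Gamma_nonneg:
  fixes h :: "complex ^ 'n::finite \<Rightarrow> real"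
  assumes [measurable]: "h \<in> borel_measurable borel" and nonneg: "\<And>z. h z \<ge> 0"
    and hom: "\<And>r z. r > 0 \<Longrightarrow> h (r *\<^sub>R z) = r ^ (2 * k) * h z"
    and bnd: "\<And>z. norm z \<le> 1 \<Longrightarrow> h z \<le> B"
  shows "\<exists>c. \<forall>s < real (CARD('n) + k). has_bochner_integral dV
    (\<lambda>z. h z * (exp (- (norm z)\<^sup>2) * norm z powr (- (2 * s)))) (c * Gamma (real (CARD('n) + k) - s))"
proof -
  obtain c where c: "c \<ge> 0" "\<And>\<rho>. \<rho> \<in> borel_measurable borel \<Longrightarrow> (\<integral>\<^sup>+z. ennreal (h z) * \<rho> ((norm z)\<^sup>2) \<partial>dV)
    = ennreal c * (\<integral>\<^sup>+t\<in>{0<..}. ennreal (t ^ (CARD('n) + k - 1)) * \<rho> t \<partial>lborel)"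
    using nn_integral_radial[of h k B] assms by blast
  show ?thesis
  proof (intro exI[of _ c] allI impI has_bochner_integral_nn_integral)
    fix s assume s: "s < real (CARD('n) + k)"
    have "norm z powr (- (2 * s)) = (norm z)\<^sup>2 powr - s" for z :: "complex ^ 'n"
      by (cases "z = 0") (simp_all add: powr_powr flip: powr_numeral)
    then have "(\<integral>\<^sup>+z. ennreal (h z * (exp (- (norm z)\<^sup>2) * norm z powr (- (2 * s)))) \<partial>(dV :: (complex ^ 'n) measure))
      = (\<integral>\<^sup>+z. ennreal (h z) * ennreal (exp (- (norm z)\<^sup>2) * (norm z)\<^sup>2 powr - s) \<partial>dV)"
      using nonneg by (intro nn_integral_cong) (simp add: ennreal_mult)
    also have "\<dots> = ennreal c * ennreal (Gamma (real (CARD('n) + k) - s))"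
      using s nn_integral_Gamma[of s "CARD('n) + k"]
      by (subst c(2)[of "\<lambda>t. ennreal (exp (- t) * t powr - s)"]) simp_all
    finally show "(\<integral>\<^sup>+z. ennreal (h z * (exp (- (norm z)\<^sup>2) * norm z powr (- (2 * s)))) \<partial>(dV :: (complex ^ 'n) measure))
      = ennreal (c * Gamma (real (CARD('n) + k) - s))"
      using c s by (simp add: ennreal_mult Gamma_real_pos less_imp_le)
    show "0 \<le> c * Gamma (real (CARD('n) + k) - s)"
      using c s by (simp add: Gamma_real_pos less_imp_le)
  qed (auto simp: nonneg)
qed

lemma homogeneous_Gamma_real:
  fixes h :: "complex ^ 'n::finite \<Rightarrow> real"
  assumes [measurable]: "h \<in> borel_measurable borel"
    and hom: "\<And>r z. r > 0 \<Longrightarrow> h (r *\<^sub>R z) = r ^ (2 * k) * h z"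
    and bnd: "\<And>z. norm z \<le> 1 \<Longrightarrow> \<bar>h z\<bar> \<le> B"
  shows "\<exists>c. \<forall>s < real (CARD('n) + k). has_bochner_integral dV
    (\<lambda>z. h z * (exp (- (norm z)\<^sup>2) * norm z powr (- (2 * s)))) (c * Gamma (real (CARD('n) + k) - s))"
proof -
  have *: "\<exists>c. \<forall>s < real (CARD('n) + k). has_bochner_integral dV
    (\<lambda>z. max (g z) 0 * (exp (- (norm z)\<^sup>2) * norm z powr (- (2 * s)))) (c * Gamma (real (CARD('n) + k) - s))"
    if "g \<in> borel_measurable borel" "\<And>r z. r > 0 \<Longrightarrow> g (r *\<^sub>R z) = r ^ (2 * k) * g z"
      "\<And>z. norm z \<le> 1 \<Longrightarrow> \<bar>g z\<bar> \<le> B" for g :: "complex ^ 'n \<Rightarrow> real"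
  proof (rule homogeneous_Gamma_nonneg)
    show "(\<lambda>z. max (g z) 0) \<in> borel_measurable borel" using that by measurable
    show "max (g (r *\<^sub>R z)) 0 = r ^ (2 * k) * max (g z) 0" if "r > 0" for r z
      using that \<open>\<And>r z. r > 0 \<Longrightarrow> g (r *\<^sub>R z) = r ^ (2 * k) * g z\<close>
      by (simp add: max_mult_distrib_left)
    show "max (g z) 0 \<le> max B 0" if "norm z \<le> 1" for z
      using that \<open>\<And>z. norm z \<le> 1 \<Longrightarrow> \<bar>g z\<bar> \<le> B\<close>[of z] by linarith
  qed simp
  obtain c1 where c1: "\<And>s. s < real (CARD('n) + k) \<Longrightarrow> has_bochner_integral dV
    (\<lambda>z. max (h z) 0 * (exp (- (norm z)\<^sup>2) * norm z powr (- (2 * s)))) (c1 * Gamma (real (CARD('n) + k) - s))"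
    using *[of h] assms by blast
  obtain c2 where c2: "\<And>s. s < real (CARD('n) + k) \<Longrightarrow> has_bochner_integral dV
    (\<lambda>z. max (- h z) 0 * (exp (- (norm z)\<^sup>2) * norm z powr (- (2 * s)))) (c2 * Gamma (real (CARD('n) + k) - s))"
    using *[of "\<lambda>z. - h z"] assms by (auto simp: borel_measurable_uminus)
  have split: "h z * w = max (h z) 0 * w - max (- h z) 0 * w" for z w
    by (simp add: left_diff_distrib[symmetric] max_def)
  show ?thesis
    by (intro exI[of _ "c1 - c2"] allI impI, subst split, subst left_diff_distrib)
      (intro has_bochner_integral_diff c1 c2)
qed

lemma homogeneous_Gamma:
  fixes G :: "complex ^ 'n::finite \<Rightarrow> complex"
  assumes [measurable]: "G \<in> borel_measurable borel"
    and hom: "\<And>r z. r > 0 \<Longrightarrow> G (r *\<^sub>R z) = of_real r ^ (2 * k) * G z"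
    and bnd: "\<And>z. norm z \<le> 1 \<Longrightarrow> cmod (G z) \<le> B"
  shows "\<exists>c. \<forall>s < real (CARD('n) + k). has_bochner_integral dV
    (\<lambda>z. G z * of_real (exp (- (norm z)\<^sup>2) * norm z powr (- (2 * s)))) (c * of_real (Gamma (real (CARD('n) + k) - s)))"
proof -
  have bnd': "\<bar>Re (G z)\<bar> \<le> B" "\<bar>Im (G z)\<bar> \<le> B" if "norm z \<le> 1" for z
    using bnd[OF that] abs_Re_le_cmod[of "G z"] abs_Im_le_cmod[of "G z"] by linarith+
  have hom': "Re (G (r *\<^sub>R z)) = r ^ (2 * k) * Re (G z)" "Im (G (r *\<^sub>R z)) = r ^ (2 * k) * Im (G z)" if "r > 0" for r z
    using hom[OF that] by (simp_all flip: of_real_power)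
  obtain c1 where c1: "\<And>s. s < real (CARD('n) + k) \<Longrightarrow> has_bochner_integral dV
    (\<lambda>z. Re (G z) * (exp (- (norm z)\<^sup>2) * norm z powr (- (2 * s)))) (c1 * Gamma (real (CARD('n) + k) - s))"
    using homogeneous_Gamma_real[of "\<lambda>z. Re (G z)" k B] bnd' hom' by auto
  obtain c2 where c2: "\<And>s. s < real (CARD('n) + k) \<Longrightarrow> has_bochner_integral dV
    (\<lambda>z. Im (G z) * (exp (- (norm z)\<^sup>2) * norm z powr (- (2 * s)))) (c2 * Gamma (real (CARD('n) + k) - s))"
    using homogeneous_Gamma_real[of "\<lambda>z. Im (G z)" k B] bnd' hom' by auto
  have split: "G z * of_real w = complex_of_real (Re (G z) * w) + \<i> * complex_of_real (Im (G z) * w)" for z w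
    by (simp add: complex_eq_iff)
  show ?thesis
  proof (intro exI[of _ "of_real c1 + \<i> * of_real c2"] allI impI)
    fix s assume s: "s < real (CARD('n) + k)"
    have "has_bochner_integral dV (\<lambda>z. complex_of_real (Re (G z) * (exp (- (norm z)\<^sup>2) * norm z powr (- (2 * s))))
        + \<i> * complex_of_real (Im (G z) * (exp (- (norm z)\<^sup>2) * norm z powr (- (2 * s)))))
      (of_real (c1 * Gamma (real (CARD('n) + k) - s)) + \<i> * of_real (c2 * Gamma (real (CARD('n) + k) - s)))"
      by (intro has_bochner_integral_add has_bochner_integral_mult_right has_bochner_integral_of_real c1 c2 s)
    then show "has_bochner_integral dV (\<lambda>z. G z * of_real (exp (- (norm z)\<^sup>2) * norm z powr (- (2 * s))))
      ((of_real c1 + \<i> * of_real c2) * of_real (Gamma (real (CARD('n) + k) - s)))"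
      by (subst split) (simp add: algebra_simps)
  qed
qed

section \<open>Gaussian integrability\<close>

lemma integrable_gaussian:
  assumes "\<epsilon> > 0"
  shows "integrable dV (\<lambda>z :: complex ^ 'n::finite. exp (- \<epsilon> * (norm z)\<^sup>2))"
proof (rule integrableI_bounded)
  have "(\<integral>\<^sup>+z. ennreal (exp (- \<epsilon> * (norm (z :: complex ^ 'n))\<^sup>2)) \<partial>dV)
    = ennreal ((1 / sqrt \<epsilon>) ^ (2 * CARD('n))) * (\<integral>\<^sup>+z. ennreal (exp (- (norm (z :: complex ^ 'n))\<^sup>2)) \<partial>dV)"
    using assms by (subst nn_integral_dV_scale[of _ "1 / sqrt \<epsilon>"]) (auto simp: power_divide)
  also have "(\<integral>\<^sup>+z. ennreal (exp (- (norm (z :: complex ^ 'n))\<^sup>2)) \<partial>dV) = ennreal 1"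
    using dV_normalized by (subst nn_integral_eq_integral) (auto simp: has_bochner_integral_iff)
  finally show "(\<integral>\<^sup>+z. ennreal (norm (exp (- \<epsilon> * (norm (z :: complex ^ 'n))\<^sup>2))) \<partial>dV) < \<infinity>"
    by (simp add: ennreal_mult_less_top)
qed simp

text \<open>Completing the square: a linear exponent is absorbed at the price of half the Gaussian
  rate and a constant. Every later trade of powers or exponentials against Gaussians rests on
  this.\<close>

lemma linear_minus_square_le:
  fixes \<epsilon> R x :: real
  assumes "\<epsilon> > 0"
  shows "R * x - \<epsilon> * x\<^sup>2 \<le> R\<^sup>2 / (2 * \<epsilon>) - \<epsilon> / 2 * x\<^sup>2"
proof -
  have "0 \<le> (\<epsilon> * x - R)\<^sup>2 / (2 * \<epsilon>)" using assms by simp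
  then show ?thesis using assms by (simp add: power2_eq_square field_simps)
qed

lemma integrable_exp_gaussian:
  assumes "\<epsilon> > 0"
  shows "integrable dV (\<lambda>z :: complex ^ 'n::finite. exp (R * norm z - \<epsilon> * (norm z)\<^sup>2))"
proof (rule Bochner_Integration.integrable_bound)
  show "integrable dV (\<lambda>z :: complex ^ 'n. exp (R\<^sup>2 / (2 * \<epsilon>)) * exp (- (\<epsilon> / 2) * (norm z)\<^sup>2))"
    using assms by (intro integrable_mult_right integrable_gaussian) simp
  show "AE z in dV. norm (exp (R * norm z - \<epsilon> * (norm (z :: complex ^ 'n))\<^sup>2)) \<le> norm (exp (R\<^sup>2 / (2 * \<epsilon>)) * exp (- (\<epsilon> / 2) * (norm z)\<^sup>2))"
    using linear_minus_square_le[OF assms, of R] by (auto simp flip: exp_add)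
qed simp

lemma powr_le_exp:
  fixes x b :: real
  assumes "x \<ge> 0"
  shows "(1 + x) powr b \<le> exp (\<bar>b\<bar> * x)"
proof -
  have "(1 + x) powr b \<le> (1 + x) powr \<bar>b\<bar>" using assms by (intro powr_mono) auto
  also have "\<dots> \<le> exp x powr \<bar>b\<bar>" using assms by (intro powr_mono2) auto
  finally show ?thesis by (simp add: powr_def mult.commute)
qed

section \<open>Entire functions of several variables\<close>

lemma entireE:
  assumes "entire f"
  obtains L where "\<And>z. (f has_derivative L z) (at z)" "\<And>z c v. L z (c *s v) = c * L z v"
  using assms unfolding entire_def by metis

lemma entire_const [intro]: "entire (\<lambda>_. c)"
  unfolding entire_def by (intro allI exI[of _ "\<lambda>_. 0"]) auto

lemma entire_add [intro]:
  assumes "entire f" "entire g"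
  shows "entire (\<lambda>z. f z + g z)"
proof -
  obtain L where L: "\<And>z. (f has_derivative L z) (at z)" "\<And>z c v. L z (c *s v) = c * L z v"
    using assms(1) entireE by blast
  obtain K where K: "\<And>z. (g has_derivative K z) (at z)" "\<And>z c v. K z (c *s v) = c * K z v"
    using assms(2) entireE by blast
  show ?thesis unfolding entire_def
    using L K by (intro allI exI[of _ "\<lambda>v. L _ v + K _ v"]) (auto intro!: has_derivative_add simp: distrib_left)
qed

lemma entire_mult [intro]:
  assumes "entire f" "entire g"
  shows "entire (\<lambda>z. f z * g z)"
proof -
  obtain L where L: "\<And>z. (f has_derivative L z) (at z)" "\<And>z c v. L z (c *s v) = c * L z v"
    using assms(1) entireE by blast
  obtain K where K: "\<And>z. (g has_derivative K z) (at z)" "\<And>z c v. K z (c *s v) = c * K z v"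
    using assms(2) entireE by blast
  show ?thesis unfolding entire_def
  proof (intro allI exI conjI)
    fix z
    show "((\<lambda>z. f z * g z) has_derivative (\<lambda>v. f z * K z v + L z v * g z)) (at z)"
      by (intro has_derivative_mult L K)
  qed (auto simp: L(2) K(2) algebra_simps)
qed

lemma entire_cmult: "entire f \<Longrightarrow> entire (\<lambda>z. c * f z)"
  by (intro entire_mult entire_const)

lemma entire_diff [intro]: "entire f \<Longrightarrow> entire g \<Longrightarrow> entire (\<lambda>z. f z - g z)"
  using entire_add[of f "\<lambda>z. -1 * g z"] entire_cmult[of g "-1"] by simp

lemma entire_sum [intro]: "(\<And>i. i \<in> A \<Longrightarrow> entire (f i)) \<Longrightarrow> entire (\<lambda>z. \<Sum>i\<in>A. f i z)"
  by (induction A rule: infinite_finite_induct) auto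

lemma entire_prod [intro]: "(\<And>i. i \<in> A \<Longrightarrow> entire (f i)) \<Longrightarrow> entire (\<lambda>z. \<Prod>i\<in>A. f i z)"
  by (induction A rule: infinite_finite_induct) auto

lemma entire_power [intro]: "entire f \<Longrightarrow> entire (\<lambda>z. f z ^ k)"
  by (induction k) auto

lemma entire_component [intro]: "entire (\<lambda>z. z $ i)"
  unfolding entire_def
  by (intro allI exI[of _ "\<lambda>v. v $ i"]) (auto intro!: bounded_linear_imp_has_derivative bounded_linear_vec_nth)

lemma entire_compose:
  assumes "entire f" "\<phi> holomorphic_on UNIV"
  shows "entire (\<lambda>z. \<phi> (f z))"
proof -
  obtain L where L: "\<And>z. (f has_derivative L z) (at z)" "\<And>z c v. L z (c *s v) = c * L z v"
    using assms(1) entireE by blast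
  have d: "(\<phi> has_derivative (\<lambda>v. deriv \<phi> w * v)) (at w)" for w
    using holomorphic_derivI[OF assms(2), of w] by (simp add: has_field_derivative_def)
  show ?thesis unfolding entire_def
  proof (intro allI exI conjI)
    fix z
    show "((\<lambda>z. \<phi> (f z)) has_derivative (\<lambda>v. deriv \<phi> (f z) * L z v)) (at z)"
      using diff_chain_at[OF L(1) d] by (simp add: o_def)
  qed (auto simp: L(2))
qed

lemma entire_translate:
  assumes "entire f"
  shows "entire (\<lambda>u. f (a + u))"
proof -
  obtain L where L: "\<And>z. (f has_derivative L z) (at z)" "\<And>z c v. L z (c *s v) = c * L z v"
    using assms(1) entireE by blast
  have "((+) a has_derivative (\<lambda>v. v)) (at u)" for u
    by (auto intro!: derivative_eq_intros)
  then have "((\<lambda>u. f (a + u)) has_derivative L (a + u)) (at u)" for u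
    using diff_chain_at[of "\<lambda>u. a + u" "\<lambda>v. v" u f, OF _ L(1)[of "a + u"]]
    by (simp add: o_def)
  then show ?thesis unfolding entire_def using L(2) by blast
qed

lemma entire_continuous_on: "entire f \<Longrightarrow> continuous_on A f"
  by (elim entireE) (meson continuous_at_imp_continuous_on has_derivative_continuous)

lemma entire_measurable: "entire f \<Longrightarrow> f \<in> borel_measurable borel"
  by (intro borel_measurable_continuous_onI entire_continuous_on)

lemma cnj_measurable [measurable]:
  "f \<in> borel_measurable M \<Longrightarrow> (\<lambda>x. cnj (f x)) \<in> borel_measurable M"
  by (rule borel_measurable_continuous_on[of cnj]) (intro continuous_intros)

lemma has_derivative_line: "((\<lambda>t::complex. z + t *s v) has_derivative (\<lambda>t. t *s v)) (at t)"
proof -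
  have "bounded_linear (\<lambda>t::complex. t *s v)"
    unfolding linear_conv_bounded_linear[symmetric]
    by (rule linearI)
      (simp_all only: vec_eq_iff vector_scaleR_component vector_smult_component vector_add_component
        distrib_right mult_scaleR_left simp_thms)
  then have "((\<lambda>t::complex. t *s v) has_derivative (\<lambda>t. t *s v)) (at t)"
    by (rule bounded_linear_imp_has_derivative)
  then show ?thesis by (auto intro!: derivative_eq_intros)
qed

lemma entire_line_derivative:
  fixes z v :: "complex ^ 'n::finite"
  assumes "(f has_derivative L) (at (z + t *s v))" "\<And>c v. L (c *s v) = c * L v"
  shows "((\<lambda>t. f (z + t *s v)) has_field_derivative L v) (at t)"
  using diff_chain_at[of "\<lambda>t. z + t *s v" "\<lambda>t. t *s v" t f L] has_derivative_line[of z v t] assms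
  by (simp add: has_field_derivative_def o_def mult.commute[of _ "L v"])

lemma entire_line_holomorphic:
  assumes "entire f"
  shows "(\<lambda>t. f (z + t *s v)) holomorphic_on A"
proof -
  obtain L where L: "\<And>z. (f has_derivative L z) (at z)" "\<And>z c v. L z (c *s v) = c * L z v"
    using assms(1) entireE by blast
  show ?thesis
    unfolding holomorphic_on_def field_differentiable_def
    using entire_line_derivative[OF L] by (metis has_field_derivative_at_within)
qed

lemma entire_ray_holomorphic: "entire f \<Longrightarrow> (\<lambda>t. f (t *s v)) holomorphic_on A"
  using entire_line_holomorphic[of f 0 v] by simp

lemma entire_bounded_on_ball:
  assumes "entire f"
  obtains M where "M \<ge> 0" "\<And>w. norm w \<le> R \<Longrightarrow> cmod (f w) \<le> M"
proof -
  have "bounded (f ` cball 0 R)"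
    by (intro compact_imp_bounded compact_continuous_image entire_continuous_on assms compact_cball)
  then obtain M where "\<And>w. w \<in> cball 0 R \<Longrightarrow> cmod (f w) \<le> M"
    unfolding bounded_iff by blast
  then show ?thesis
    by (intro that[of "max M 0"]) (auto simp: le_max_iff_disj)
qed

text \<open>By the Cauchy estimate on complex lines, uniform bounds on the terms over slightly larger
  balls bound the differentials.\<close>

lemma entire_derivative_bound:
  assumes "entire f" and L: "(f has_derivative L) (at z)" "\<And>c v. L (c *s v) = c * L v"
    and bound: "\<And>w. norm w \<le> norm z + 1 \<Longrightarrow> cmod (f w) \<le> B"
  shows "cmod (L v) \<le> B * norm v"
proof (cases "v = 0")
  case True
  then show ?thesis using L(2)[of 0 v] by simp
next
  case False
  \<comment> \<open>With this radius the circle of the Cauchy estimate stays within distance 1 of z,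
    where \<open>B\<close> is a bound.\<close>
  define r where "r = 1 / norm v"
  have r: "r > 0" using False by (simp add: r_def)
  have "cmod ((deriv ^^ 1) (\<lambda>t. f (z + t *s v)) 0) \<le> fact 1 * B / r ^ 1"
  proof (rule Cauchy_inequality)
    show "(\<lambda>t. f (z + t *s v)) holomorphic_on ball 0 r"
      by (rule entire_line_holomorphic) fact
    show "continuous_on (cball 0 r) (\<lambda>t. f (z + t *s v))"
      by (rule holomorphic_on_imp_continuous_on, rule entire_line_holomorphic) fact
    show "cmod (f (z + t *s v)) \<le> B" if "norm (0 - t) = r" for t
    proof (rule bound)
      have "norm (z + t *s v) \<le> norm z + norm (t *s v)" by (rule norm_triangle_ineq)
      also have "norm (t *s v) = 1" using that False by (simp add: norm_vector_smult r_def)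
      finally show "norm (z + t *s v) \<le> norm z + 1" .
    qed
  qed (rule r)
  moreover have "deriv (\<lambda>t. f (z + t *s v)) 0 = L v"
    by (rule DERIV_imp_deriv, rule entire_line_derivative) (use L in auto)
  ultimately show ?thesis using False by (simp add: r_def)
qed

text \<open>By \<open>entire_derivative_bound\<close>, the bounds B k on a ball of radius one larger
  also dominate the differentials, so the series of differentials converges uniformly on the smaller
  ball. Complex linearity of the limit is inherited term by term.\<close>

lemma entire_suminf:
  fixes f :: "nat \<Rightarrow> complex ^ 'n::finite \<Rightarrow> complex"
  assumes ent: "\<And>k. entire (f k)"
    and normal: "\<And>R. \<exists>B. summable B \<and> (\<forall>k z. norm z \<le> R \<longrightarrow> cmod (f k z) \<le> B k)"
  shows "entire (\<lambda>z. \<Sum>k. f k z)"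
proof -
  have "\<forall>k. \<exists>L. \<forall>z. (f k has_derivative L z) (at z) \<and> (\<forall>c v. L z (c *s v) = c * L z v)"
    using ent unfolding entire_def by metis
  then obtain L where L: "\<And>k z. (f k has_derivative L k z) (at z)" "\<And>k z c v. L k z (c *s v) = c * L k z v"
    by metis
  show ?thesis
    unfolding entire_def
  proof
    fix z0 :: "complex ^ 'n"
    define R where "R = norm z0 + 1"
    define S where "S = ball (0 :: complex ^ 'n) R"
    obtain B where B: "summable B" "\<And>k z. norm z \<le> R + 1 \<Longrightarrow> cmod (f k z) \<le> B k"
      using normal[of "R + 1"] by blast
    have Lb: "cmod (L k z v) \<le> B k * norm v" if "z \<in> S" for k z v
      by (rule entire_derivative_bound[OF ent L]) (use that B(2) in \<open>auto simp: S_def\<close>)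
    have sumL: "summable (\<lambda>k. L k z v)" if "z \<in> S" for z v
      by (rule summable_comparison_test'[of "\<lambda>k. B k * norm v"]) (use Lb that B in \<open>auto intro: summable_mult2\<close>)
    have sumf: "summable (\<lambda>k. f k z)" if "z \<in> S" for z
      by (rule summable_comparison_test'[of B]) (use that B in \<open>auto simp: S_def\<close>)
    define G where "G z v = (\<Sum>k. L k z v)" for z v
    have z0: "z0 \<in> S" "0 \<in> S" by (auto simp: S_def R_def add_pos_nonneg add_nonneg_pos)
    have "\<exists>g. \<forall>x\<in>S. (\<lambda>n. f n x) sums g x \<and> (g has_derivative G x) (at x within S)"
    proof (rule has_derivative_series)
      show "convex S" by (simp add: S_def)
      show "(f n has_derivative L n x) (at x within S)" for n x
        using L(1) has_derivative_at_withinI by blast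
      show "0 \<in> S" by (rule z0)
      show "(\<lambda>n. f n 0) sums (\<Sum>n. f n 0)" using sumf z0 by (simp add: summable_sums)
      fix e :: real assume "e > 0"
      obtain N where N: "\<And>n. n \<ge> N \<Longrightarrow> norm (\<Sum>i. B (i + n)) < e"
        using suminf_exist_split[OF \<open>e > 0\<close> B(1)] by blast
      show "\<forall>\<^sub>F n in sequentially. \<forall>x\<in>S. \<forall>h. norm ((\<Sum>i<n. L i x h) - G x h) \<le> e * norm h"
        unfolding eventually_sequentially
      proof (intro exI[of _ N] allI impI ballI)
        fix n x h assume n: "n \<ge> N" and x: "x \<in> S"
        have "norm ((\<Sum>i<n. L i x h) - G x h) = norm (\<Sum>i. L (i + n) x h)"
          using suminf_split_initial_segment[OF sumL[OF x], of h n] by (simp add: G_def)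
        also have "\<dots> \<le> (\<Sum>i. B (i + n) * norm h)"
          by (rule norm_suminf_le) (use Lb x B(1) in \<open>auto intro!: summable_mult2 summable_ignore_initial_segment\<close>)
        also have "\<dots> = (\<Sum>i. B (i + n)) * norm h"
          by (rule suminf_mult2[symmetric]) (use B(1) in \<open>auto intro!: summable_ignore_initial_segment\<close>)
        also have "\<dots> \<le> e * norm h"
          using N[OF n] by (intro mult_right_mono) auto
        finally show "norm ((\<Sum>i<n. L i x h) - G x h) \<le> e * norm h" .
      qed
    qed
    then obtain g where g: "\<And>x. x \<in> S \<Longrightarrow> (\<lambda>n. f n x) sums g x" "\<And>x. x \<in> S \<Longrightarrow> (g has_derivative G x) (at x within S)"
      by blast
    have "(g has_derivative G z0) (at z0)"
      using g(2)[OF z0(1)] z0(1) by (simp add: S_def at_within_open[of _ "ball 0 R"])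
    then have "((\<lambda>z. \<Sum>k. f k z) has_derivative G z0) (at z0)"
      by (rule has_derivative_transform_within_open[of _ _ _ _ S])
        (use z0 g(1) in \<open>auto simp: S_def sums_iff\<close>)
    moreover have "G z0 (c *s v) = c * G z0 v" for c v
      unfolding G_def L(2) by (rule suminf_mult) (rule sumL[OF z0(1)])
    ultimately show "\<exists>L. ((\<lambda>z. \<Sum>k. f k z) has_derivative L) (at z0) \<and> (\<forall>c v. L (c *s v) = c * L v)"
      by blast
  qed
qed

section \<open>Homogeneous parts\<close>

lemma power_series_eq_zero:
  fixes a :: "nat \<Rightarrow> complex"
  assumes "\<And>t. (\<lambda>k. a k * t ^ k) sums 0"
  shows "a k = 0"
proof -
  have "Abs_fps a = 0"
  proof (rule eval_fps_eqD)
    show "fps_conv_radius (Abs_fps a) > 0"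
      using conv_radius_geI[of a 1] assms[of 1] less_le_trans[of 0 "ereal 1" "conv_radius a"]
      by (simp add: fps_conv_radius_def sums_iff)
    show "eventually (\<lambda>t. eval_fps (Abs_fps a) t = eval_fps 0 t) (nhds 0)"
      using assms by (simp add: eval_fps_def sums_iff)
  qed auto
  then show ?thesis by (simp add: fps_eq_iff)
qed

text \<open>The k-th Taylor coefficient at 0 of t -> f (t z). It makes sense for every entire f at
  once, whereas \<open>homogeneous_part\<close> is a definite description that can be evaluated only
  after an expansion into polynomials has been exhibited.\<close>

definition hpart :: "(complex ^ 'n::finite \<Rightarrow> complex) \<Rightarrow> nat \<Rightarrow> complex ^ 'n \<Rightarrow> complex" where
  "hpart f k z = (deriv ^^ k) (\<lambda>t. f (t *s z)) 0 / fact k"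

lemma hpart_sums_smult:
  assumes "entire f"
  shows "(\<lambda>k. hpart f k z * t ^ k) sums f (t *s z)"
proof -
  have "(\<lambda>t. f (t *s z)) holomorphic_on ball 0 (cmod t + 1)"
    by (rule entire_ray_holomorphic) fact
  from holomorphic_power_series[OF this, of t] show ?thesis
    by (simp add: hpart_def)
qed

lemma hpart_sums: "entire f \<Longrightarrow> (\<lambda>k. hpart f k z) sums f z"
  using hpart_sums_smult[of f z 1] by simp

lemma hpart_unique:
  assumes "entire f" "\<And>t. (\<lambda>k. a k * t ^ k) sums f (t *s z)"
  shows "hpart f k z = a k"
proof -
  have "(\<lambda>k. (hpart f k z - a k) * t ^ k) sums 0" for t
    using sums_diff[OF hpart_sums_smult[OF assms(1), of z t] assms(2)[of t]] by (simp add: left_diff_distrib)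
  from power_series_eq_zero[OF this, of k] show ?thesis by simp
qed

lemma hpart_smult:
  assumes "entire f"
  shows "hpart f k (c *s z) = c ^ k * hpart f k z"
proof (rule hpart_unique)
  show "(\<lambda>k. c ^ k * hpart f k z * t ^ k) sums f (t *s (c *s z))" for t
    using hpart_sums_smult[OF assms, of z "t * c"] by (simp add: power_mult_distrib mult_ac vector_smult_assoc)
qed fact

lemma hpart_add: "entire f \<Longrightarrow> entire g \<Longrightarrow> hpart (\<lambda>z. f z + g z) k z = hpart f k z + hpart g k z"
  by (rule hpart_unique) (auto simp: distrib_right intro!: sums_add hpart_sums_smult)

lemma hpart_cmult: "entire f \<Longrightarrow> hpart (\<lambda>z. c * f z) k z = c * hpart f k z"
  by (rule hpart_unique) (auto simp: mult.assoc intro!: entire_cmult sums_mult hpart_sums_smult)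

lemma hpart_zero: "entire f \<Longrightarrow> hpart f 0 z = f 0"
  using hpart_def[of f 0 z] by simp

lemma hpart_homogeneous:
  assumes "entire P" "\<And>t z. P (t *s z) = t ^ k * P z"
  shows "hpart P j z = (if j = k then P z else 0)"
proof (rule hpart_unique)
  show "(\<lambda>j. (if j = k then P z else 0) * t ^ j) sums P (t *s z)" for t
    using sums_If_finite_set[of "{k}" "\<lambda>j. P z * t ^ j"] assms(2)[of t z]
    by (simp add: if_distrib[of "\<lambda>x. x * _"] mult.commute[of _ "P z"] cong: if_cong)
qed fact

text \<open>The Cauchy inequality on the circle |t| = r / |z|, which t -> t z maps into the sphere
  of radius r. For z = 0 this circle degenerates, and only degree 0 contributes.\<close>

lemma hpart_bound:
  assumes ent: "entire f" and r: "r > 0" and M: "\<And>w. norm w \<le> r \<Longrightarrow> cmod (f w) \<le> M"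
  shows "cmod (hpart f k z) \<le> M * (norm z / r) ^ k"
proof (cases "z = 0")
  case True
  then show ?thesis
    using hpart_smult[OF ent, of k 0 z] hpart_zero[OF ent, of z] M[of 0] r by (cases k) auto
next
  case False
  then have "r / norm z > 0" using r by simp
  have "cmod ((deriv ^^ k) (\<lambda>t. f (t *s z)) 0) \<le> fact k * M / (r / norm z) ^ k"
  proof (rule Cauchy_inequality)
    show "(\<lambda>t. f (t *s z)) holomorphic_on ball 0 (r / norm z)"
      by (rule entire_ray_holomorphic) fact
    show "continuous_on (cball 0 (r / norm z)) (\<lambda>t. f (t *s z))"
      by (rule holomorphic_on_imp_continuous_on, rule entire_ray_holomorphic) fact
    show "cmod (f (t *s z)) \<le> M" if "norm (0 - t) = r / norm z" for t
      using that False by (intro M) (simp add: norm_vector_smult)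
  qed fact
  then show ?thesis
    by (simp add: hpart_def norm_divide power_divide field_simps)
qed

text \<open>Polynomiality of the parts comes later and under a growth condition, so measurability is
  obtained by strong induction from a pointwise limit of measurable difference quotients along a
  sequence c i tending to 0.\<close>

lemma hpart_measurable:
  assumes "entire f"
  shows "hpart f k \<in> borel_measurable borel"
proof (induction k rule: less_induct)
  case (less k)
  define c where "c i = complex_of_real (1 / real (Suc i))" for i
  have c: "c i \<noteq> 0" "c \<longlonglongrightarrow> 0" for i
  proof -
    show "c i \<noteq> 0" by (simp add: c_def del: of_nat_Suc)
    have "(\<lambda>i. complex_of_real (1 / real (Suc i))) \<longlonglongrightarrow> complex_of_real 0"
      by (rule tendsto_of_real) (rule LIMSEQ_Suc[OF lim_1_over_n])
    then show "c \<longlonglongrightarrow> 0" unfolding c_def of_real_0 .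
  qed
  have lim: "(\<lambda>i. (f (c i *s z) - (\<Sum>j<k. hpart f j z * c i ^ j)) / c i ^ k) \<longlonglongrightarrow> hpart f k z" for z
  proof -
    have s: "(\<lambda>j. hpart f (j + k) z * t ^ j) sums ((f (t *s z) - (\<Sum>j<k. hpart f j z * t ^ j)) / t ^ k)" if "t \<noteq> 0" for t
    proof -
      have "(\<lambda>j. hpart f (j + k) z * t ^ (j + k)) sums (f (t *s z) - (\<Sum>j<k. hpart f j z * t ^ j))"
        using sums_split_initial_segment[OF hpart_sums_smult[OF assms, of z t], of k] by simp
      from sums_divide[OF this, of "t ^ k"] show ?thesis using that by (simp add: power_add)
    qed
    \<comment> \<open>After removing the first k terms and dividing by t^k, a power series in t is
      left that is continuous at 0 and has the wanted value there.\<close>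
    define h where "h t = (\<Sum>j. hpart f (j + k) z * t ^ j)" for t
    have "isCont h 0"
      unfolding h_def
      by (rule isCont_powser[of _ 1]) (use s[of 1] in \<open>auto simp: sums_iff\<close>)
    moreover have "h 0 = hpart f k z" by (simp add: h_def)
    ultimately have "(\<lambda>i. h (c i)) \<longlonglongrightarrow> hpart f k z"
      using isCont_tendsto_compose[OF _ c(2)] by metis
    then show ?thesis using s c(1) by (simp add: h_def sums_iff)
  qed
  have "(\<lambda>z. f (c i *s z)) \<in> borel_measurable borel" for i
    using measurable_compose[OF vector_smult_measurable entire_measurable[OF assms]] by simp
  then show ?case
    using less by (intro borel_measurable_LIMSEQ_metric[OF _ lim]) (auto intro!: borel_measurable_diff borel_measurable_divide borel_measurable_sum borel_measurable_times)
qed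

section \<open>The Hermitian inner product\<close>

definition hinner :: "complex ^ 'n::finite \<Rightarrow> complex ^ 'n \<Rightarrow> complex" where
  "hinner z w = (\<Sum>i\<in>UNIV. z $ i * cnj (w $ i))"

lemma entire_hinner [intro]: "entire (\<lambda>z. hinner z w)"
  unfolding hinner_def by (intro entire_sum entire_mult entire_component entire_const)

lemma hinner_commute: "hinner w z = cnj (hinner z w)"
  by (simp add: hinner_def mult.commute)

lemma hinner_smult_left: "hinner (c *s z) w = c * hinner z w"
  by (simp add: hinner_def sum_distrib_left mult.assoc)

lemma hinner_add_left: "hinner (z + z') w = hinner z w + hinner z' w"
  by (simp add: hinner_def distrib_right sum.distrib)

lemma hinner_add_right: "hinner z (w + w') = hinner z w + hinner z w'"
  by (simp add: hinner_def distrib_left sum.distrib)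

lemma Re_hinner: "Re (hinner z w) = z \<bullet> w"
  by (simp add: hinner_def inner_vec_def inner_complex_def)

lemma hinner_self: "hinner z z = of_real ((norm z)\<^sup>2)"
  by (simp add: complex_eq_iff Re_hinner power2_norm_eq_inner) (simp add: hinner_def)

lemma norm_hinner_le: "cmod (hinner z w) \<le> norm z * norm w"
proof -
  \<comment> \<open>A unit scalar that makes <c z, w> equal to |<z,w>|, reducing the claim to the
    real Cauchy-Schwarz inequality.\<close>
  define c where "c = (if hinner z w = 0 then 1 else cnj (hinner z w) / cmod (hinner z w))"
  have "cnj (hinner z w) * hinner z w = of_real (cmod (hinner z w)) * of_real (cmod (hinner z w))"
    using complex_norm_square[of "hinner z w"] by (simp add: power2_eq_square mult.commute)
  then have c: "cmod c = 1" "c * hinner z w = cmod (hinner z w)"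
    by (auto simp: c_def norm_divide)
  have "cmod (hinner z w) = Re (hinner (c *s z) w)"
    using c(2) by (simp add: hinner_smult_left)
  also have "\<dots> \<le> norm (c *s z) * norm w"
    unfolding Re_hinner by (rule norm_cauchy_schwarz)
  finally show ?thesis by (simp add: norm_vector_smult c)
qed

lemma hinner_measurable [measurable]:
  "(\<lambda>x. hinner (f x) (g x)) \<in> borel_measurable M"
  if [measurable]: "f \<in> borel_measurable M" "g \<in> borel_measurable M"
  for f g :: "_ \<Rightarrow> complex ^ 'n::finite"
proof -
  have "continuous_on UNIV (\<lambda>p. hinner (fst p) (snd p) :: complex)"
    unfolding hinner_def by (intro continuous_intros)
  then have "(\<lambda>p. hinner (fst p) (snd p)) \<in> borel_measurable (borel :: ((complex ^ 'n) \<times> (complex ^ 'n)) measure)"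
    by (rule borel_measurable_continuous_onI)
  then have "(\<lambda>p. hinner (fst p) (snd p)) \<in> borel_measurable ((borel :: (complex ^ 'n) measure) \<Otimes>\<^sub>M (borel :: (complex ^ 'n) measure))"
    by (simp add: borel_prod)
  from measurable_compose[OF _ this, of "\<lambda>x. (f x, g x)" M] show ?thesis by simp
qed

section \<open>Orthogonality of homogeneous parts\<close>

lemma integrable_dV_bounded_support:
  fixes f :: "complex ^ 'n::finite \<Rightarrow> 'b::{banach, second_countable_topology}"
  assumes [measurable]: "f \<in> borel_measurable borel"
    and "\<And>z. norm z \<le> R \<Longrightarrow> norm (f z) \<le> B" "\<And>z. norm z > R \<Longrightarrow> f z = 0"
  shows "integrable dV f"
proof (rule Bochner_Integration.integrable_bound)
  show "integrable dV (\<lambda>z :: complex ^ 'n. B * indicator (cball 0 R) z)"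
    using finite_dV_bounded[of "cball (0 :: complex ^ 'n) R"]
    by (intro integrable_mult_right integrable_real_indicator) auto
  show "AE z in dV. norm (f z) \<le> norm (B * indicator (cball 0 R) z)"
    using assms by (intro AE_I2) (auto simp: indicator_def not_le intro: order_trans[OF _ abs_ge_self])
qed simp

lemma exists_unit_power_neq_one:
  assumes "k \<noteq> (l :: nat)"
  obtains c where "cmod c = 1" "c ^ k * cnj c ^ l \<noteq> 1"
proof -
  \<comment> \<open>With this angle the product c^k cnj(c)^l is cis pi = -1.\<close>
  define \<theta> where "\<theta> = pi / (real k - real l)"
  have "cis \<theta> ^ k * cnj (cis \<theta>) ^ l = cis (real k * \<theta> + real l * (- \<theta>))"
    unfolding cis_cnj Complex.DeMoivre cis_mult ..
  also have "real k * \<theta> + real l * (- \<theta>) = (real k - real l) * \<theta>"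
    by (simp add: left_diff_distrib)
  also have "\<dots> = pi"
    using assms by (simp add: \<theta>_def)
  finally show ?thesis by (intro that[of "cis \<theta>"]) auto
qed

text \<open>Rotation by c leaves \<open>dV\<close> and m unchanged but multiplies the integral by
  c^k cnj(c)^l; for a suitable unit c this factor differs from 1.\<close>

lemma integral_homogeneous_orthogonal:
  fixes P Q :: "complex ^ 'n::finite \<Rightarrow> complex"
  assumes [measurable]: "P \<in> borel_measurable borel" "Q \<in> borel_measurable borel" "m \<in> borel_measurable borel"
    and P: "\<And>c z. P (c *s z) = c ^ k * P z" and Q: "\<And>c z. Q (c *s z) = c ^ l * Q z"
    and m: "\<And>c z. cmod c = 1 \<Longrightarrow> m (c *s z) = m z" and "k \<noteq> l"
  shows "(LINT z|dV. P z * cnj (Q z) * m z) = 0"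
proof -
  obtain c where c: "cmod c = 1" "c ^ k * cnj c ^ l \<noteq> 1"
    using exists_unit_power_neq_one[OF \<open>k \<noteq> l\<close>] by blast
  have "(LINT z|dV. P z * cnj (Q z) * m z) = (LINT z|dV. P (c *s z) * cnj (Q (c *s z)) * m (c *s z))"
    by (rule integral_dV_rotation[OF _ c(1), symmetric]) simp
  also have "\<dots> = (LINT z|dV. c ^ k * cnj c ^ l * (P z * cnj (Q z) * m z))"
    by (intro Bochner_Integration.integral_cong refl) (simp add: P Q m c mult_ac)
  also have "\<dots> = c ^ k * cnj c ^ l * (LINT z|dV. P z * cnj (Q z) * m z)"
    by simp
  finally show ?thesis using c(2) by simp
qed

text \<open>On the bounded support of m the homogeneous expansion converges geometrically and can be
  integrated term by term; orthogonality then removes every degree other than k.\<close>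

lemma integral_hpart_bounded_support:
  fixes F P :: "complex ^ 'n::finite \<Rightarrow> complex"
  assumes F: "entire F" and P: "entire P" "\<And>c z. P (c *s z) = c ^ k * P z"
    and [measurable]: "m \<in> borel_measurable borel"
    and m: "\<And>c z. cmod c = 1 \<Longrightarrow> m (c *s z) = m z"
    and R: "R > 0" "\<And>z. norm z \<le> R \<Longrightarrow> cmod (m z) \<le> B" "\<And>z. norm z > R \<Longrightarrow> m z = 0"
  shows "(LINT z|dV. F z * cnj (P z) * m z) = (LINT z|dV. hpart F k z * cnj (P z) * m z)"
proof -
  note [measurable] = hpart_measurable[OF F] entire_measurable[OF P(1)] entire_measurable[OF F]
  \<comment> \<open>A bound on the ball of radius 2 R makes the parts decay like (1/2)^l on the ball
    of radius R.\<close>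
  obtain M where M: "M \<ge> 0" "\<And>z. norm z \<le> 2 * R \<Longrightarrow> cmod (F z) \<le> M"
    using entire_bounded_on_ball[OF F] by blast
  obtain MP where MP: "MP \<ge> 0" "\<And>z. norm z \<le> R \<Longrightarrow> cmod (P z) \<le> MP"
    using entire_bounded_on_ball[OF P(1)] by blast
  have B: "B \<ge> 0" using R(2)[of 0] R(1) norm_ge_zero[of "m 0"] by (auto simp del: norm_ge_zero)
  define f where "f l z = hpart F l z * cnj (P z) * m z" for l z
  have [measurable]: "f l \<in> borel_measurable borel" for l
    unfolding f_def by measurable
  have fb: "cmod (f l z) \<le> (M * MP * B) * (1 / 2) ^ l" if "norm z \<le> R" for l z
  proof -
    have "cmod (hpart F l z) \<le> M * (norm z / (2 * R)) ^ l"
      by (rule hpart_bound[OF F]) (use M R in auto)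
    also have "\<dots> \<le> M * (1 / 2) ^ l"
      using that R M by (intro mult_left_mono power_mono) (auto simp: field_simps)
    finally have "cmod (f l z) \<le> M * (1 / 2) ^ l * MP * B"
      unfolding f_def norm_mult complex_mod_cnj
      using that R MP M B by (intro mult_mono) auto
    then show ?thesis by (simp add: mult_ac)
  qed
  have f0: "f l z = 0" if "norm z > R" for l z
    using that R by (simp add: f_def)
  have int: "integrable dV (f l)" for l
    by (rule integrable_dV_bounded_support[OF _ fb f0]) auto
  have sum: "(\<lambda>l. f l z) sums (F z * cnj (P z) * m z)" for z
    unfolding f_def by (intro sums_mult2 hpart_sums F)
  define V where "V = measure (dV :: (complex ^ 'n) measure) (cball 0 R)"
  have "(\<lambda>l. LINT z|dV. f l z) sums (LINT z|dV. (\<Sum>l. f l z))"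
  proof (rule sums_integral[OF int])
    have geom: "summable (\<lambda>l. c * (1 / 2) ^ l)" for c :: real
      by (rule summable_mult[OF summable_geometric]) simp
    have "summable (\<lambda>l. cmod (f l z))" for z
    proof (cases "norm z \<le> R")
      case True
      then show ?thesis
        by (intro summable_comparison_test'[OF geom[of "M * MP * B"], of 0]) (simp add: fb)
    qed (simp add: f0)
    then show "AE z in dV. summable (\<lambda>l. cmod (f l z))" by simp
    have "norm (LINT z|dV. cmod (f l z)) \<le> (M * MP * B) * V * (1 / 2) ^ l" for l
    proof -
      have "(LINT z|dV. cmod (f l z)) \<le> (LINT z|dV. (M * MP * B * (1 / 2) ^ l) * indicator (cball (0 :: complex ^ 'n) R) z)"
      proof (rule integral_mono)
        show "integrable dV (\<lambda>z :: complex ^ 'n. (M * MP * B * (1 / 2) ^ l) * indicator (cball 0 R) z :: real)"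
          using finite_dV_bounded[of "cball (0 :: complex ^ 'n) R"]
          by (intro integrable_mult_right integrable_real_indicator) auto
      qed (use fb f0 int in \<open>auto simp: indicator_def not_le\<close>)
      then show ?thesis by (simp add: V_def mult_ac integral_nonneg_AE)
    qed
    then show "summable (\<lambda>l. LINT z|dV. cmod (f l z))"
      by (intro summable_comparison_test'[OF geom, of 0]) simp
  qed
  then have "(\<lambda>l. LINT z|dV. f l z) sums (LINT z|dV. F z * cnj (P z) * m z)"
    using sum by (simp add: sums_iff)
  moreover have "(LINT z|dV. f l z) = (if l = k then LINT z|dV. f k z else 0)" for l
  proof (cases "l = k")
    case False
    have "(LINT z|dV. hpart F l z * cnj (P z) * m z) = 0"
      by (rule integral_homogeneous_orthogonal[of _ _ _ l k])
        (simp_all add: P(2) hpart_smult[OF F] m False)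
    then show ?thesis using False by (simp add: f_def)
  qed simp
  then have "(\<lambda>l. LINT z|dV. f l z) = (\<lambda>l. if l \<in> {k} then LINT z|dV. f k z else 0)"
    unfolding singleton_iff by (rule ext)
  then have "(\<lambda>l. LINT z|dV. f l z) sums (LINT z|dV. f k z)"
    using sums_If_finite_set[of "{k}" "\<lambda>_. LINT z|dV. f k z"] by (simp only:) simp
  ultimately have "(LINT z|dV. F z * cnj (P z) * m z) = (LINT z|dV. f k z)"
    by (rule sums_unique2)
  then show ?thesis by (simp only: f_def)
qed

abbreviation weight :: "real \<Rightarrow> complex ^ 'n::finite \<Rightarrow> real" where
  "weight \<sigma> z \<equiv> exp (- (norm z)\<^sup>2) * norm z powr (- \<sigma>)"

lemma AE_dV_nonzero: "AE z in (dV :: (complex ^ 'n::finite) measure). z \<noteq> 0"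
proof -
  have "AE z in (lborel :: (complex ^ 'n) measure). z \<noteq> 0" by (rule AE_lborel_singleton)
  then show ?thesis unfolding dV_def by (subst AE_density) auto
qed

lemma weighted_integrand_measurable [measurable]:
  "F \<in> borel_measurable borel \<Longrightarrow> P \<in> borel_measurable borel \<Longrightarrow> weighted_integrand \<sigma> F P \<in> borel_measurable borel"
  unfolding weighted_integrand_def[abs_def] by simp

text \<open>Termwise integration is available only for bounded weights of bounded support. The
  identity is therefore proved on annuli, and the two integrability hypotheses carry it to the limit
  by dominated convergence.\<close>

lemma weighted_inner_hpart:
  fixes F P :: "complex ^ 'n::finite \<Rightarrow> complex"
  assumes F: "entire F" and P: "entire P" "\<And>c z. P (c *s z) = c ^ k * P z"
    and int: "integrable dV (weighted_integrand \<sigma> F P)" "integrable dV (weighted_integrand \<sigma> (hpart F k) P)"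
  shows "weighted_inner \<sigma> F P = weighted_inner \<sigma> (hpart F k) P"
proof -
  note [measurable] = hpart_measurable[OF F] entire_measurable[OF P(1)] entire_measurable[OF F]
  \<comment> \<open>The inner radius keeps the weight bounded when \<sigma> > 0, the outer one gives
    bounded support; both are rotation invariant.\<close>
  define A where "A i = {z :: complex ^ 'n. 1 / real (Suc i) \<le> norm z \<and> norm z \<le> real (Suc i)}" for i
  have [measurable]: "A i \<in> sets borel" for i unfolding A_def by measurable
  have ev: "\<forall>\<^sub>F i in sequentially. z \<in> A i" if "z \<noteq> 0" for z
  proof -
    obtain j where j: "norm z \<le> real j" using real_arch_simple by blast
    obtain l0 where l0: "inverse (real (Suc l0)) < norm z"
      using reals_Archimedean[of "norm z"] \<open>z \<noteq> 0\<close> by auto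
    define l where "l = Suc l0"
    have l: "l > 0" "1 / real l < norm z" using l0 by (simp_all add: l_def inverse_eq_divide)
    show ?thesis
      using eventually_ge_at_top[of "max j l"]
    proof eventually_elim
      case (elim i)
      have "1 / real (Suc i) \<le> 1 / real l" using elim l by (intro divide_left_mono) auto
      then show ?case using elim l j by (auto simp: A_def)
    qed
  qed
  have lim: "(\<lambda>i. LINT z|dV. weighted_integrand \<sigma> H P z * indicator (A i) z) \<longlonglongrightarrow> weighted_inner \<sigma> H P"
    if H: "integrable dV (weighted_integrand \<sigma> H P)" and [measurable]: "H \<in> borel_measurable borel" for H
    unfolding weighted_inner_def
  proof (rule integral_dominated_convergence)
    show "integrable dV (\<lambda>z. cmod (weighted_integrand \<sigma> H P z))" using H by simp
    have "(\<lambda>i. weighted_integrand \<sigma> H P z * indicator (A i) z) \<longlonglongrightarrow> weighted_integrand \<sigma> H P z" for z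
    \<comment> \<open>The origin lies in no annulus, but the integrand is 0 there because
      \<open>0 powr x = 0\<close>.\<close>
    proof (cases "z = 0")
      case True
      then show ?thesis by (simp add: weighted_integrand_def)
    next
      case False
      from ev[OF this] have "\<forall>\<^sub>F i in sequentially. weighted_integrand \<sigma> H P z * indicator (A i) z = weighted_integrand \<sigma> H P z"
        by eventually_elim simp
      then show ?thesis by (rule tendsto_eventually)
    qed
    then show "AE z in dV. (\<lambda>i. weighted_integrand \<sigma> H P z * indicator (A i) z) \<longlonglongrightarrow> weighted_integrand \<sigma> H P z"
      by simp
  qed (auto simp: norm_mult indicator_def)
  have eq: "(LINT z|dV. weighted_integrand \<sigma> F P z * indicator (A i) z) = (LINT z|dV. weighted_integrand \<sigma> (hpart F k) P z * indicator (A i) z)" for i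
  proof -
    define m where "m z = complex_of_real (weight \<sigma> z) * indicator (A i) z" for z
    have [measurable]: "m \<in> borel_measurable borel" unfolding m_def by measurable
    \<comment> \<open>The first entry bounds the weight when \<sigma> \<le> 0, the second, attained
      at the inner radius, when \<sigma> > 0.\<close>
    define B where "B = max (real (Suc i) powr (- \<sigma>)) ((1 / real (Suc i)) powr (- \<sigma>))"
    have "(LINT z|dV. F z * cnj (P z) * m z) = (LINT z|dV. hpart F k z * cnj (P z) * m z)"
    proof (rule integral_hpart_bounded_support[OF F P, where R="real (Suc i)" and B=B])
      show "m (c *s z) = m z" if "cmod c = 1" for c z
        using that by (simp add: m_def A_def norm_vector_smult indicator_def)
      show "cmod (m z) \<le> B" for z
      proof (cases "z \<in> A i")
        case True
        then have z: "1 / real (Suc i) \<le> norm z" "norm z \<le> real (Suc i)" by (auto simp: A_def)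
        then have z0: "norm z > 0" by (smt (verit) of_nat_0_less_iff zero_less_Suc zero_less_divide_1_iff)
        have "norm z powr - \<sigma> \<le> B"
        proof (cases "\<sigma> \<le> 0")
          case True
          then have "norm z powr - \<sigma> \<le> real (Suc i) powr - \<sigma>" using z z0 by (intro powr_mono2) auto
          then show ?thesis by (simp add: B_def)
        next
          case False
          then have "norm z powr - \<sigma> \<le> (1 / real (Suc i)) powr - \<sigma>" using z z0 by (intro powr_mono2') auto
          then show ?thesis by (simp add: B_def)
        qed
        moreover have "weight \<sigma> z \<le> 1 * norm z powr - \<sigma>" by (intro mult_right_mono) auto
        ultimately show ?thesis using True by (simp add: m_def norm_mult del: of_real_mult)
      next
        case False
        then show ?thesis by (simp add: m_def B_def le_max_iff_disj)
      qed
      show "m z = 0" if "norm z > real (Suc i)" for z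
        using that by (simp add: m_def A_def)
    qed auto
    then show ?thesis by (simp add: weighted_integrand_def m_def mult_ac)
  qed
  show ?thesis
    using lim[OF int(1)] lim[OF int(2)] unfolding eq by (auto intro: LIMSEQ_unique)
qed

text \<open>The factor \<open>norm z powr 0\<close> is 1 except at the origin, where it is 0; hence
  equality of the integrands only almost everywhere.\<close>

lemma weighted_inner_0_eq:
  "weighted_inner 0 F P = (LINT z|dV. F z * cnj (P z) * of_real (exp (- (norm z)\<^sup>2)))"
  if [measurable]: "F \<in> borel_measurable borel" "P \<in> borel_measurable borel"
  for F P :: "complex ^ 'n::finite \<Rightarrow> complex"
  unfolding weighted_inner_def
proof (rule integral_cong_AE)
  show "AE z in dV. weighted_integrand 0 F P z = F z * cnj (P z) * of_real (exp (- (norm z)\<^sup>2))"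
    using AE_dV_nonzero by eventually_elim (simp add: weighted_integrand_def)
qed simp_all

lemma integrable_weighted_integrand_0_iff:
  "integrable dV (weighted_integrand 0 F P) \<longleftrightarrow> integrable dV (\<lambda>z. F z * cnj (P z) * of_real (exp (- (norm z)\<^sup>2)))"
  if [measurable]: "F \<in> borel_measurable borel" "P \<in> borel_measurable borel"
  for F P :: "complex ^ 'n::finite \<Rightarrow> complex"
proof (rule integrable_cong_AE)
  show "AE z in dV. weighted_integrand 0 F P z = F z * cnj (P z) * of_real (exp (- (norm z)\<^sup>2))"
    using AE_dV_nonzero by eventually_elim (simp add: weighted_integrand_def)
qed simp_all

section \<open>The reproducing formula\<close>

text \<open>Translating by \<open>z\<close> turns the integral into a Gaussian mean about the origin of the entire
  function \<open>u \<mapsto> f (z + u) exp (- \<langle>u, z\<rangle>)\<close>.\<close>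

lemma reproducing_formula:
  fixes f :: "complex ^ 'n::finite \<Rightarrow> complex"
  assumes f: "entire f" and int: "integrable dV (\<lambda>w. f w * exp (hinner z w) * of_real (exp (- (norm w)\<^sup>2)))"
  shows "(LINT w|dV. f w * exp (hinner z w) * of_real (exp (- (norm w)\<^sup>2))) = f z"
proof -
  note [measurable] = entire_measurable[OF f]
  define F where "F u = f (z + u) * exp (- hinner u z)" for u
  have F: "entire F"
    unfolding F_def
    by (intro entire_mult entire_translate f entire_compose[of "\<lambda>u. hinner u z" "\<lambda>t. exp (- t)"] entire_hinner holomorphic_intros)
  note [measurable] = entire_measurable[OF F]
  \<comment> \<open>In <z, z + u> - |z + u|^2 the terms |z|^2 and <z,u> cancel. What remains besides
    -|u|^2 is -<u,z>, which is holomorphic in u; this makes F entire.\<close>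
  have shift: "f (z + u) * exp (hinner z (z + u)) * of_real (exp (- (norm (z + u))\<^sup>2))
      = F u * of_real (exp (- (norm u)\<^sup>2))" for u
  proof -
    have "complex_of_real ((norm (z + u))\<^sup>2) = of_real ((norm z)\<^sup>2) + hinner z u + hinner u z + of_real ((norm u)\<^sup>2)"
      by (simp only: hinner_self[symmetric] hinner_add_left hinner_add_right) simp
    then have "hinner z (z + u) - of_real ((norm (z + u))\<^sup>2) = - hinner u z - of_real ((norm u)\<^sup>2)"
      by (simp add: hinner_add_right hinner_self)
    then have "exp (hinner z (z + u) + - of_real ((norm (z + u))\<^sup>2)) = exp (- hinner u z + - of_real ((norm u)\<^sup>2))"
      by simp
    then have "exp (hinner z (z + u)) * exp (- of_real ((norm (z + u))\<^sup>2)) = exp (- hinner u z) * exp (- of_real ((norm u)\<^sup>2))"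
      by (simp only: exp_add)
    then have "exp (hinner z (z + u)) * of_real (exp (- (norm (z + u))\<^sup>2)) = exp (- hinner u z) * of_real (exp (- (norm u)\<^sup>2))"
      by (simp only: exp_of_real[symmetric] of_real_minus)
    then show ?thesis by (simp only: F_def mult.assoc)
  qed
  have meas: "(\<lambda>w. f w * exp (hinner z w) * of_real (exp (- (norm w)\<^sup>2))) \<in> borel_measurable borel"
    by measurable
  have intF: "integrable dV (\<lambda>u. F u * of_real (exp (- (norm u)\<^sup>2)))"
    using int integrable_dV_translation[OF meas, of z] by (simp add: shift)
  have gauss: "has_bochner_integral dV (\<lambda>z :: complex ^ 'n. complex_of_real (exp (- (norm z)\<^sup>2))) (of_real 1)"
    by (intro has_bochner_integral_of_real dV_normalized)
  have "(LINT w|dV. f w * exp (hinner z w) * of_real (exp (- (norm w)\<^sup>2))) = (LINT u|dV. F u * of_real (exp (- (norm u)\<^sup>2)))"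
    using integral_dV_translation[OF meas, of z] by (simp add: shift)
  also have "\<dots> = weighted_inner 0 F (\<lambda>_. 1)"
    by (simp add: weighted_inner_0_eq)
  \<comment> \<open>The mean value property: the constant 1 is homogeneous of degree 0, so only the
    degree 0 part of F, the constant F 0, survives.\<close>
  also have "\<dots> = weighted_inner 0 (hpart F 0) (\<lambda>_. 1)"
  proof (rule weighted_inner_hpart[OF F entire_const])
    show "integrable dV (weighted_integrand 0 F (\<lambda>_. 1))"
      using intF by (simp add: integrable_weighted_integrand_0_iff)
    show "integrable dV (weighted_integrand 0 (hpart F 0) (\<lambda>_. 1))"
      using gauss by (subst integrable_weighted_integrand_0_iff)
        (auto simp: hpart_zero[OF F] has_bochner_integral_iff hpart_measurable[OF F])
  qed simp
  also have "\<dots> = F 0"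
    using gauss by (subst weighted_inner_0_eq)
      (auto simp: hpart_zero[OF F] has_bochner_integral_iff hpart_measurable[OF F])
  finally show ?thesis by (simp add: F_def hinner_def)
qed

text \<open>The growth condition shared by the Fock spaces of all exponents above 1 and all weights.
  Since exp (r |w|) with r = |z| dominates exp <z,w> and each of its Taylor terms, the reproducing
  formula and its expansion by degrees become independent of exponent and weight.\<close>

definition gaussian_growth :: "(complex ^ 'n::finite \<Rightarrow> complex) \<Rightarrow> bool" where
  "gaussian_growth f \<longleftrightarrow> entire f \<and> (\<forall>r. integrable dV (\<lambda>w. cmod (f w) * exp (r * norm w - (norm w)\<^sup>2)))"

lemma norm_exp_hinner_le: "cmod (exp (hinner z w)) \<le> exp (norm z * norm w)"
  using norm_cauchy_schwarz[of z w] by (simp add: Re_hinner)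

lemma gaussian_growth_reproducing:
  assumes "gaussian_growth f"
  shows "integrable dV (\<lambda>w. f w * exp (hinner z w) * of_real (exp (- (norm w)\<^sup>2)))"
    and "(LINT w|dV. f w * exp (hinner z w) * of_real (exp (- (norm w)\<^sup>2))) = f z"
proof -
  have f: "entire f" using assms by (simp add: gaussian_growth_def)
  note [measurable] = entire_measurable[OF f]
  show int: "integrable dV (\<lambda>w. f w * exp (hinner z w) * of_real (exp (- (norm w)\<^sup>2)))"
  proof (rule Bochner_Integration.integrable_bound)
    show "integrable dV (\<lambda>w. cmod (f w) * exp (norm z * norm w - (norm w)\<^sup>2))"
      using assms by (simp add: gaussian_growth_def)
    have "cmod (f w * exp (hinner z w) * of_real (exp (- (norm w)\<^sup>2))) \<le> cmod (f w) * exp (norm z * norm w - (norm w)\<^sup>2)" for w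
    proof -
      have "cmod (f w) * cmod (exp (hinner z w)) * exp (- (norm w)\<^sup>2) \<le> cmod (f w) * exp (norm z * norm w) * exp (- (norm w)\<^sup>2)"
        by (intro mult_left_mono mult_right_mono norm_exp_hinner_le) auto
      then show ?thesis
        by (simp add: norm_mult exp_diff exp_minus divide_inverse mult.assoc norm_inverse)
    qed
    then show "AE w in dV. cmod (f w * exp (hinner z w) * of_real (exp (- (norm w)\<^sup>2)))
        \<le> norm (cmod (f w) * exp (norm z * norm w - (norm w)\<^sup>2))" by simp
  qed simp
  show "(LINT w|dV. f w * exp (hinner z w) * of_real (exp (- (norm w)\<^sup>2))) = f z"
    by (rule reproducing_formula[OF f int])
qed

lemma power_le_fact_exp: "(x::real) ^ k \<le> fact k * exp x" if "x \<ge> 0"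
proof -
  have "x ^ k / fact k \<le> exp x"
    using exp_ge_one_plus_x_over_n_power_n sum_le_suminf[OF summable_exp[of x], of "{k}"] that
    by (simp add: exp_def divide_inverse mult.commute)
  then show ?thesis by (simp add: field_simps)
qed

lemma hinner_power_homogeneous: "hinner (c *s w) z ^ k = c ^ k * hinner w z ^ k"
  by (simp add: hinner_smult_left power_mult_distrib)

text \<open>Expanding exp <z,w> in the reproducing formula gives a series for f (z) whose k-th term
  is homogeneous of degree k in z. Uniqueness of Taylor coefficients along the line through z
  identifies that term with \<open>hpart f k z\<close>.\<close>

lemma
  assumes f: "gaussian_growth f"
  shows integrable_hinner_power: "integrable dV (weighted_integrand 0 f (\<lambda>w. hinner w z ^ k))"
    and weighted_inner_hinner_power: "weighted_inner 0 f (\<lambda>w. hinner w z ^ k) = fact k * hpart f k z"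
proof -
  have ent: "entire f" using f by (simp add: gaussian_growth_def)
  note [measurable] = entire_measurable[OF ent]
  define h where "h z k w = f w * hinner z w ^ k / fact k * of_real (exp (- (norm w)\<^sup>2))" for z k w
  have meas[measurable]: "h z k \<in> borel_measurable borel" for z k
    unfolding h_def by measurable
  have hb: "cmod (h z k w) = (norm (hinner z w) ^ k / fact k) * (cmod (f w) * exp (- (norm w)\<^sup>2))" for z k w
    by (simp add: h_def norm_mult norm_divide norm_power)
  have hb': "cmod (h z k w) \<le> cmod (f w) * exp (norm z * norm w - (norm w)\<^sup>2)" for z k w
  proof -
    have "norm (hinner z w) ^ k \<le> (norm z * norm w) ^ k"
      by (intro power_mono norm_hinner_le) auto
    also have "\<dots> \<le> fact k * exp (norm z * norm w)" by (rule power_le_fact_exp) simp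
    finally have "norm (hinner z w) ^ k / fact k \<le> exp (norm z * norm w)" by (simp add: field_simps)
    then have "cmod (h z k w) \<le> exp (norm z * norm w) * (cmod (f w) * exp (- (norm w)\<^sup>2))"
      unfolding hb by (intro mult_right_mono) auto
    then show ?thesis by (simp add: exp_diff exp_minus divide_inverse mult_ac)
  qed
  have int: "integrable dV (h z k)" for z k
    by (rule Bochner_Integration.integrable_bound[of _ "\<lambda>w. cmod (f w) * exp (norm z * norm w - (norm w)\<^sup>2)"])
      (use f hb' in \<open>auto simp: gaussian_growth_def\<close>)
  have abs_sums: "(\<lambda>k. cmod (h z k w)) sums (exp (cmod (hinner z w)) * (cmod (f w) * exp (- (norm w)\<^sup>2)))" for z w
    unfolding hb using exp_converges[of "cmod (hinner z w)"]
    by (intro sums_mult2) (simp add: divide_inverse mult.commute scaleR_conv_of_real)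
  have sums: "(\<lambda>k. LINT w|dV. h z k w) sums f z" for z
  proof -
    have "(\<lambda>k. LINT w|dV. h z k w) sums (LINT w|dV. (\<Sum>k. h z k w))"
    proof (rule sums_integral[OF int])
      show "AE w in dV. summable (\<lambda>k. cmod (h z k w))"
        using abs_sums by (auto simp: sums_iff)
      \<comment> \<open>All partial sums of the norms lie below one integral that is finite by the
        growth condition with r = |z|.\<close>
      have part: "(\<Sum>k<N. LINT w|dV. cmod (h z k w)) \<le> (LINT w|dV. cmod (f w) * exp (norm z * norm w - (norm w)\<^sup>2))" for N
      proof -
        have "(\<Sum>k<N. LINT w|dV. cmod (h z k w)) = (LINT w|dV. (\<Sum>k<N. cmod (h z k w)))"
          using int by (subst Bochner_Integration.integral_sum) auto
        also have "\<dots> \<le> (LINT w|dV. cmod (f w) * exp (norm z * norm w - (norm w)\<^sup>2))"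
        proof (rule integral_mono)
          fix w
          have "(\<Sum>k<N. cmod (h z k w)) \<le> (\<Sum>k. cmod (h z k w))"
            using abs_sums[of z w] by (intro sum_le_suminf) (auto simp: sums_iff)
          also have "\<dots> = exp (cmod (hinner z w)) * (cmod (f w) * exp (- (norm w)\<^sup>2))"
            using abs_sums[of z w] by (simp add: sums_iff)
          also have "\<dots> \<le> exp (norm z * norm w) * (cmod (f w) * exp (- (norm w)\<^sup>2))"
            by (intro mult_right_mono) (auto simp: norm_hinner_le)
          finally show "(\<Sum>k<N. cmod (h z k w)) \<le> cmod (f w) * exp (norm z * norm w - (norm w)\<^sup>2)"
            by (simp add: exp_diff exp_minus divide_inverse mult_ac)
        qed (use int f in \<open>auto simp: gaussian_growth_def\<close>)
        finally show ?thesis .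
      qed
      show "summable (\<lambda>k. LINT w|dV. cmod (h z k w))"
        by (rule summableI_nonneg_bounded[OF _ part]) auto
    qed
    also have "(\<lambda>w. \<Sum>k. h z k w) = (\<lambda>w. f w * exp (hinner z w) * of_real (exp (- (norm w)\<^sup>2)))"
    proof
      fix w
      have "(\<lambda>k. f w * of_real (exp (- (norm w)\<^sup>2)) * (hinner z w ^ k /\<^sub>R fact k)) sums (f w * of_real (exp (- (norm w)\<^sup>2)) * exp (hinner z w))"
        by (intro sums_mult exp_converges)
      then show "(\<Sum>k. h z k w) = f w * exp (hinner z w) * of_real (exp (- (norm w)\<^sup>2))"
        by (simp add: sums_iff h_def scaleR_conv_of_real divide_inverse mult_ac)
    qed
    finally show ?thesis using gaussian_growth_reproducing(2)[OF f, of z] by simp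
  qed
  have "hpart f k z = (LINT w|dV. h z k w)"
  proof (rule hpart_unique[OF ent])
    fix t
    have "(LINT w|dV. h (t *s z) k w) = (LINT w|dV. h z k w) * t ^ k" for k
    proof -
      have "h (t *s z) k w = h z k w * t ^ k" for w
        by (simp add: h_def hinner_power_homogeneous mult_ac)
      then show ?thesis by simp
    qed
    then show "(\<lambda>k. (LINT w|dV. h z k w) * t ^ k) sums f (t *s z)"
      using sums[of "t *s z"] by simp
  qed
  moreover have eq: "f w * cnj (hinner w z ^ k) * of_real (exp (- (norm w)\<^sup>2)) = fact k * h z k w" for w
    by (simp add: h_def hinner_commute[of z w])
  ultimately show "weighted_inner 0 f (\<lambda>w. hinner w z ^ k) = fact k * hpart f k z"
    by (subst weighted_inner_0_eq) (simp_all only: eq, auto)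
  show "integrable dV (weighted_integrand 0 f (\<lambda>w. hinner w z ^ k))"
    using int[of z k] by (subst integrable_weighted_integrand_0_iff) (simp_all only: eq, auto)
qed

section \<open>Homogeneous polynomials\<close>

text \<open>Induction on the degree: multiplication by one more coordinate raises one exponent. The
  multinomial coefficients stay unnamed, as later steps use only that finitely many monomials of
  degree k occur.\<close>

lemma power_sum_multinomial:
  "\<exists>C. \<forall>x :: complex ^ 'n::finite. (\<Sum>i\<in>UNIV. x $ i) ^ k
    = (\<Sum>m | (\<Sum>i\<in>UNIV. m i) = k. C m * (\<Prod>i\<in>UNIV. (x $ i) ^ m i))"
proof (induction k)
  case 0
  have "{m :: 'n \<Rightarrow> nat. (\<Sum>i\<in>UNIV. m i) = 0} = {\<lambda>_. 0}" by auto
  then show ?case by (intro exI[of _ "\<lambda>_. 1"]) simp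
next
  case (Suc k)
  define MI where "MI k = {m :: 'n \<Rightarrow> nat. (\<Sum>i\<in>UNIV. m i) = k}" for k
  define mono where "mono m x = (\<Prod>i\<in>UNIV. (x $ i) ^ m i)" for m :: "'n \<Rightarrow> nat" and x :: "complex ^ 'n"
  have fin: "finite (MI k)" for k unfolding MI_def by (rule finite_multi_indices)
  obtain C where C: "\<And>x :: complex ^ 'n. (\<Sum>i\<in>UNIV. x $ i) ^ k = (\<Sum>m\<in>MI k. C m * mono m x)"
    using Suc by (auto simp: MI_def mono_def)
  \<comment> \<open>Raises one exponent; pairs with the same image contribute to the same monomial
    and are collected by \<open>sum.group\<close>.\<close>
  define g :: "'n \<times> ('n \<Rightarrow> nat) \<Rightarrow> 'n \<Rightarrow> nat" where "g = (\<lambda>(i, m). m(i := Suc (m i)))"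
  have mono_g: "mono (g (i, m)) x = x $ i * mono m x" for i m x
  proof -
    have "mono (g (i, m)) x = (\<Prod>j\<in>UNIV. (if j = i then x $ i else 1) * (x $ j) ^ m j)"
      unfolding mono_def g_def by (intro prod.cong) auto
    then show ?thesis by (simp add: prod.distrib mono_def)
  qed
  have g_in: "g ` (UNIV \<times> MI k) \<subseteq> MI (Suc k)"
  proof clarify
    fix i and m :: "'n \<Rightarrow> nat" assume m: "m \<in> MI k"
    have "(\<Sum>j\<in>UNIV. g (i, m) j) = (\<Sum>j\<in>UNIV. (if j = i then 1 else 0) + m j)"
      unfolding g_def by (intro sum.cong) auto
    then show "g (i, m) \<in> MI (Suc k)" using m by (simp add: sum.distrib MI_def)
  qed
  have "(\<Sum>i\<in>UNIV. x $ i) ^ Suc k = (\<Sum>m'\<in>MI (Suc k). (\<Sum>p | p \<in> UNIV \<times> MI k \<and> g p = m'. C (snd p)) * mono m' x)" for x :: "complex ^ 'n"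
  proof -
    have "(\<Sum>i\<in>UNIV. x $ i) ^ Suc k = (\<Sum>i\<in>UNIV. \<Sum>m\<in>MI k. C m * mono (g (i, m)) x)"
      unfolding power_Suc C by (simp add: sum_product mono_g mult_ac)
    also have "\<dots> = (\<Sum>p\<in>UNIV \<times> MI k. C (snd p) * mono (g p) x)"
      by (simp add: sum.cartesian_product case_prod_unfold)
    also have "\<dots> = (\<Sum>m'\<in>MI (Suc k). \<Sum>p | p \<in> UNIV \<times> MI k \<and> g p = m'. C (snd p) * mono (g p) x)"
      using sum.group[OF _ fin g_in, of "\<lambda>p. C (snd p) * mono (g p) x"] fin by simp
    also have "\<dots> = (\<Sum>m'\<in>MI (Suc k). (\<Sum>p | p \<in> UNIV \<times> MI k \<and> g p = m'. C (snd p)) * mono m' x)"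
      unfolding sum_distrib_right by (intro sum.cong) auto
    finally show ?thesis .
  qed
  then show ?case
    by (intro exI[of _ "\<lambda>m'. \<Sum>p | p \<in> UNIV \<times> MI k \<and> g p = m'. C (snd p)"]) (simp only: MI_def mono_def, simp)
qed

definition monomial :: "('n::finite \<Rightarrow> nat) \<Rightarrow> complex ^ 'n \<Rightarrow> complex" where
  "monomial m z = (\<Prod>i\<in>UNIV. (z $ i) ^ m i)"

lemma entire_monomial [intro]: "entire (monomial m)"
  unfolding monomial_def[abs_def] by (intro entire_prod entire_power entire_component)

lemma monomial_smult: "monomial m (c *s z) = c ^ (\<Sum>i\<in>UNIV. m i) * monomial m z"
  by (simp add: monomial_def power_mult_distrib prod.distrib power_sum)

text \<open>This separates the variables z and w in a finite sum. It is what allows integrals in w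
  and linear functionals in z to be exchanged by linearity alone.\<close>

lemma hinner_power_eq_monomials:
  obtains C where "\<And>z w :: complex ^ 'n::finite. hinner z w ^ k
    = (\<Sum>m | (\<Sum>i\<in>UNIV. m i) = k. C m * monomial m z * cnj (monomial m w))"
proof -
  obtain C where C: "\<And>x :: complex ^ 'n. (\<Sum>i\<in>UNIV. x $ i) ^ k
    = (\<Sum>m | (\<Sum>i\<in>UNIV. m i) = k. C m * (\<Prod>i\<in>UNIV. (x $ i) ^ m i))"
    using power_sum_multinomial by blast
  have "hinner z w ^ k = (\<Sum>m | (\<Sum>i\<in>UNIV. m i) = k. C m * monomial m z * cnj (monomial m w))" for z w :: "complex ^ 'n"
    using C[of "\<chi> i. z $ i * cnj (w $ i)"]
    by (simp add: hinner_def monomial_def power_mult_distrib prod.distrib mult.assoc)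
  then show ?thesis using that by blast
qed

lemma homogeneous_polynomial_alt:
  "homogeneous_polynomial k P \<longleftrightarrow> (\<exists>c. \<forall>z. P z = (\<Sum>m | (\<Sum>i\<in>UNIV. m i) = k. c m * monomial m z))"
  by (simp add: homogeneous_polynomial_def monomial_def)

lemma homogeneous_polynomial_entire: "homogeneous_polynomial k P \<Longrightarrow> entire P"
proof -
  assume "homogeneous_polynomial k P"
  then obtain c where "P = (\<lambda>z. \<Sum>m | (\<Sum>i\<in>UNIV. m i) = k. c m * monomial m z)"
    unfolding homogeneous_polynomial_alt by blast
  then show ?thesis by (auto intro!: entire_sum entire_cmult)
qed

lemma norm_monomial_le: "cmod (monomial m z) \<le> norm z ^ (\<Sum>i\<in>UNIV. m i)"
proof -
  have "cmod (monomial m z) \<le> (\<Prod>i\<in>UNIV. norm z ^ m i)"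
    unfolding monomial_def prod_norm[symmetric]
    by (intro prod_mono) (auto simp: norm_power intro!: power_mono Finite_Cartesian_Product.norm_nth_le)
  then show ?thesis by (simp add: power_sum)
qed

text \<open>The part of degree k is a Gaussian integral of f against <z,w>^k divided by k!, and in
  <z,w>^k the variable z enters only through finitely many monomials. This supplies the polynomials
  required by \<open>homogeneous_expansion\<close>.\<close>

lemma gaussian_growth_hpart_polynomial:
  assumes f: "gaussian_growth f"
  shows "homogeneous_polynomial k (hpart f k)"
proof -
  have ent: "entire f" using f by (simp add: gaussian_growth_def)
  note [measurable] = entire_measurable[OF ent] entire_measurable[OF entire_monomial]
  obtain C where C: "\<And>z w :: complex ^ 'a. hinner z w ^ k
    = (\<Sum>m | (\<Sum>i\<in>UNIV. m i) = k. C m * monomial m z * cnj (monomial m w))"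
    using hinner_power_eq_monomials by blast
  define I where "I m = (LINT w|dV. f w * cnj (monomial m w) * of_real (exp (- (norm w)\<^sup>2)))" for m
  have int: "integrable dV (\<lambda>w. f w * cnj (monomial m w) * of_real (exp (- (norm w)\<^sup>2)))" for m
  proof (rule Bochner_Integration.integrable_bound)
    let ?k = "\<Sum>i\<in>UNIV. m i"
    show "integrable dV (\<lambda>w. fact ?k * (cmod (f w) * exp (1 * norm w - (norm w)\<^sup>2)))"
      using f unfolding gaussian_growth_def by (intro integrable_mult_right) blast
    have "cmod (f w * cnj (monomial m w) * of_real (exp (- (norm w)\<^sup>2)))
        \<le> fact ?k * (cmod (f w) * exp (1 * norm w - (norm w)\<^sup>2))" for w
    proof -
      have "cmod (monomial m w) \<le> fact ?k * exp (norm w)"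
        using norm_monomial_le[of m w] power_le_fact_exp[OF norm_ge_zero, of w ?k] by linarith
      then have "cmod (f w) * cmod (monomial m w) * exp (- (norm w)\<^sup>2) \<le> cmod (f w) * (fact ?k * exp (norm w)) * exp (- (norm w)\<^sup>2)"
        by (intro mult_left_mono mult_right_mono) auto
      then show ?thesis by (simp add: norm_mult exp_diff exp_minus divide_inverse mult_ac norm_inverse)
    qed
    then show "AE w in dV. cmod (f w * cnj (monomial m w) * of_real (exp (- (norm w)\<^sup>2)))
        \<le> norm (fact ?k * (cmod (f w) * exp (1 * norm w - (norm w)\<^sup>2)))" by simp
  qed simp
  have "hpart f k z = (\<Sum>m | (\<Sum>i\<in>UNIV. m i) = k. (C m * I m / fact k) * monomial m z)" for z
  proof -
    have "fact k * hpart f k z = (LINT w|dV. f w * cnj (hinner w z ^ k) * of_real (exp (- (norm w)\<^sup>2)))"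
      using weighted_inner_hinner_power[OF f, of z k] by (simp add: weighted_inner_0_eq)
    also have "\<dots> = (LINT w|dV. (\<Sum>m | (\<Sum>i\<in>UNIV. m i) = k. C m * monomial m z * (f w * cnj (monomial m w) * of_real (exp (- (norm w)\<^sup>2)))))"
    proof (intro Bochner_Integration.integral_cong refl)
      fix w
      have "cnj (hinner w z ^ k) = hinner z w ^ k" by (simp add: hinner_commute[of z w])
      then show "f w * cnj (hinner w z ^ k) * of_real (exp (- (norm w)\<^sup>2)) = (\<Sum>m | (\<Sum>i\<in>UNIV. m i) = k. C m * monomial m z * (f w * cnj (monomial m w) * of_real (exp (- (norm w)\<^sup>2))))"
        unfolding C sum_distrib_left sum_distrib_right by (simp add: C sum_distrib_left sum_distrib_right mult_ac)
    qed
    also have "\<dots> = (\<Sum>m | (\<Sum>i\<in>UNIV. m i) = k. C m * monomial m z * I m)"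
      using int by (subst Bochner_Integration.integral_sum) (auto simp: I_def)
    finally have "hpart f k z = (\<Sum>m | (\<Sum>i\<in>UNIV. m i) = k. C m * monomial m z * I m) / fact k"
      by (simp add: field_simps)
    then show ?thesis by (simp add: sum_divide_distrib mult_ac)
  qed
  then show ?thesis unfolding homogeneous_polynomial_alt
    by (intro exI[of _ "\<lambda>m. C m * I m / fact k"]) simp
qed

lemma gaussian_growth_homogeneous_part:
  assumes "gaussian_growth f"
  shows "homogeneous_part f = hpart f"
proof (rule homogeneous_part_eqI)
  have "entire f" using assms by (simp add: gaussian_growth_def)
  then show "homogeneous_expansion f (hpart f)"
    using gaussian_growth_hpart_polynomial[OF assms] hpart_sums unfolding homogeneous_expansion_def by blast
qed

text \<open>The constant in \<open>homogeneous_Gamma\<close> is the same for all s: the value at s =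
  0 is known from the Gaussian case and determines it, and s = \<sigma>/2 then gives the claim. This
  is where the ratio of Gamma values in the kernel originates.\<close>

lemma weighted_inner_hpart_hinner_power:
  fixes f :: "complex ^ 'n::finite \<Rightarrow> complex"
  assumes f: "gaussian_growth f" and \<sigma>: "\<sigma> / 2 < real (CARD('n) + k)"
  shows "integrable dV (weighted_integrand \<sigma> (hpart f k) (\<lambda>w. hinner w z ^ k))"
    and "weighted_inner \<sigma> (hpart f k) (\<lambda>w. hinner w z ^ k)
      = of_real (Gamma (real (CARD('n) + k) - \<sigma> / 2) / Gamma (real (CARD('n) + k))) * fact k * hpart f k z"
proof -
  have ent: "entire f" using f by (simp add: gaussian_growth_def)
  note [measurable] = hpart_measurable[OF ent]
  define G where "G w = hpart f k w * cnj (hinner w z ^ k)" for w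
  obtain M where M: "M \<ge> 0" "\<And>w. norm w \<le> 1 \<Longrightarrow> cmod (f w) \<le> M"
    using entire_bounded_on_ball[OF ent] by blast
  have "\<exists>c. \<forall>s < real (CARD('n) + k). has_bochner_integral dV
    (\<lambda>z. G z * of_real (weight (2 * s) z)) (c * of_real (Gamma (real (CARD('n) + k) - s)))"
  proof (rule homogeneous_Gamma)
    show "G \<in> borel_measurable borel" unfolding G_def by measurable
    show "G (r *\<^sub>R w) = of_real r ^ (2 * k) * G w" for r w
      unfolding scaleR_eq_vector_smult G_def hpart_smult[OF ent] hinner_power_homogeneous
      by (simp add: mult_2_right power_add mult_ac)
    show "cmod (G w) \<le> M * norm z ^ k" if "norm w \<le> 1" for w
    proof -
      have "cmod (hpart f k w) \<le> M * (norm w / 1) ^ k"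
        by (rule hpart_bound[OF ent]) (use M in auto)
      also have "\<dots> \<le> M" using that M by (simp add: mult_left_le power_le_one)
      finally have "cmod (hpart f k w) \<le> M" .
      moreover have "cmod (hinner w z) \<le> norm z"
        using norm_hinner_le[of w z] mult_right_mono[OF that norm_ge_zero[of z]] by linarith
      ultimately show ?thesis
        unfolding G_def norm_mult complex_mod_cnj norm_power
        using M by (intro mult_mono power_mono) auto
    qed
  qed
  then obtain c where c: "\<And>s. s < real (CARD('n) + k) \<Longrightarrow> has_bochner_integral dV
    (\<lambda>z. G z * of_real (weight (2 * s) z)) (c * of_real (Gamma (real (CARD('n) + k) - s)))"
    by blast
  have G: "weighted_integrand (2 * s) (hpart f k) (\<lambda>w. hinner w z ^ k) = (\<lambda>w. G w * of_real (weight (2 * s) w))" for s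
    by (rule ext) (simp add: weighted_integrand_def G_def)
  note c' = c[folded G]
  show "integrable dV (weighted_integrand \<sigma> (hpart f k) (\<lambda>w. hinner w z ^ k))"
    using c'[OF \<sigma>] by (simp add: has_bochner_integral_iff)
  have pos: "0 < real (CARD('n) + k)" by (simp add: add_pos_nonneg)
  have "c * of_real (Gamma (real (CARD('n) + k))) = weighted_inner 0 (hpart f k) (\<lambda>w. hinner w z ^ k)"
    using c'[OF pos] by (simp add: has_bochner_integral_iff weighted_inner_def)
  also have "\<dots> = weighted_inner 0 f (\<lambda>w. hinner w z ^ k)"
  proof (rule weighted_inner_hpart[symmetric, OF ent])
    show "integrable dV (weighted_integrand 0 (hpart f k) (\<lambda>w. hinner w z ^ k))"
      using c'[OF pos] by (simp add: has_bochner_integral_iff)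
  qed (auto intro: integrable_hinner_power f hinner_power_homogeneous)
  also have "\<dots> = fact k * hpart f k z" by (rule weighted_inner_hinner_power[OF f])
  finally have "c = fact k * hpart f k z / of_real (Gamma (real (CARD('n) + k)))"
    using Gamma_real_pos[OF pos] by (simp add: nonzero_eq_divide_eq)
  moreover have "weighted_inner \<sigma> (hpart f k) (\<lambda>w. hinner w z ^ k) = c * of_real (Gamma (real (CARD('n) + k) - \<sigma> / 2))"
    using c'[OF \<sigma>] by (simp add: has_bochner_integral_iff weighted_inner_def)
  ultimately show "weighted_inner \<sigma> (hpart f k) (\<lambda>w. hinner w z ^ k)
      = of_real (Gamma (real (CARD('n) + k) - \<sigma> / 2) / Gamma (real (CARD('n) + k))) * fact k * hpart f k z"
    by (simp add: mult_ac)
qed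

section \<open>Estimates for the reproducing kernel\<close>

text \<open>For j = 0 the sum is exp y. The next Pochhammer factor k + a + j splits into the
  constant a + j and the index k; since k y^k / k! = y y^(k-1) / (k-1)!, the latter part is y times
  the series for a + 1, so the induction has to cover all a. The sum is a polynomial of degree at
  most j times exp y, whence exp (Re y) in the bound.\<close>

lemma pochhammer_exponential_series:
  fixes a :: real
  shows "\<exists>S C. C \<ge> 0 \<and> (\<forall>y::complex. (\<lambda>k. of_real (pochhammer (real k + a) j) * y ^ k / fact k) sums S y \<and>
    cmod (S y) \<le> C * (1 + cmod y) ^ j * exp (Re y))"
proof (induction j arbitrary: a)
  case 0
  have "(\<lambda>k. y ^ k / fact k) sums exp y" for y :: complex
    using exp_converges[of y] by (simp add: scaleR_conv_of_real divide_inverse mult.commute)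
  then show ?case by (intro exI[of _ exp] exI[of _ 1]) simp
next
  case (Suc j)
  obtain S C where S: "C \<ge> 0" "\<And>y::complex. (\<lambda>k. of_real (pochhammer (real k + a) j) * y ^ k / fact k) sums S y"
    "\<And>y. cmod (S y) \<le> C * (1 + cmod y) ^ j * exp (Re y)"
    using Suc[of a] by blast
  obtain S' C' where S': "C' \<ge> 0" "\<And>y::complex. (\<lambda>k. of_real (pochhammer (real k + (a + 1)) j) * y ^ k / fact k) sums S' y"
    "\<And>y. cmod (S' y) \<le> C' * (1 + cmod y) ^ j * exp (Re y)"
    using Suc[of "a + 1"] by blast
  have sums: "(\<lambda>k. of_real (pochhammer (real k + a) (Suc j)) * y ^ k / fact k) sums (of_real (a + real j) * S y + y * S' y)" for y :: complex
  proof -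
    define u where "u k = of_real (real k * pochhammer (real k + a) j) * y ^ k / fact k" for k
    have "u (Suc k) = y * (of_real (pochhammer (real k + (a + 1)) j) * y ^ k / fact k)" for k
    proof -
      have "of_nat (Suc k) \<noteq> (0 :: complex)" by (simp del: of_nat_Suc)
      moreover have "real (Suc k) + a = real k + (a + 1)" by simp
      ultimately show ?thesis
        unfolding u_def fact_Suc by (simp only: of_nat_mult of_nat_id power_Suc of_real_mult of_real_of_nat_eq) (simp del: of_nat_Suc)
    qed
    then have "(\<lambda>k. u (Suc k)) sums (y * S' y)"
      using sums_mult[OF S'(2)[of y], of y] by simp
    then have "u sums (y * S' y)"
      by (subst (asm) sums_Suc_iff) (simp add: u_def)
    then have "(\<lambda>k. of_real (a + real j) * (of_real (pochhammer (real k + a) j) * y ^ k / fact k) + u k)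
        sums (of_real (a + real j) * S y + y * S' y)"
      by (intro sums_add sums_mult S)
    then show ?thesis
      by (rule sums_cong[THEN iffD1, rotated])
        (simp add: u_def pochhammer_rec' divide_inverse algebra_simps)
  qed
  have bound: "cmod (of_real (a + real j) * S y + y * S' y) \<le> (\<bar>a + real j\<bar> * C + C') * (1 + cmod y) ^ Suc j * exp (Re y)" for y
  proof -
    have "cmod (of_real (a + real j) * S y + y * S' y) \<le> \<bar>a + real j\<bar> * cmod (S y) + cmod y * cmod (S' y)"
      by (rule order_trans[OF norm_triangle_ineq]) (simp add: norm_mult del: of_real_add)
    also have "\<dots> \<le> \<bar>a + real j\<bar> * (C * (1 + cmod y) ^ j * exp (Re y)) + (1 + cmod y) * (C' * (1 + cmod y) ^ j * exp (Re y))"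
      using S(3)[of y] S'(3)[of y] by (intro add_mono mult_mono) auto
    also have "\<dots> \<le> (1 + cmod y) * (\<bar>a + real j\<bar> * (C * (1 + cmod y) ^ j * exp (Re y))) + (1 + cmod y) * (C' * (1 + cmod y) ^ j * exp (Re y))"
      using mult_right_mono[of 1 "1 + cmod y" "\<bar>a + real j\<bar> * (C * (1 + cmod y) ^ j * exp (Re y))"] S(1)
      by (intro add_right_mono) simp
    finally show ?thesis by (simp add: algebra_simps)
  qed
  show ?case
    by (intro exI[of _ "\<lambda>y. of_real (a + real j) * S y + y * S' y"] exI[of _ "\<bar>a + real j\<bar> * C + C'"])
      (use sums bound S(1) S'(1) in auto)
qed

lemma abs_pochhammer_le: "\<bar>pochhammer (a::real) j\<bar> \<le> (\<bar>a\<bar> + real j) ^ j"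
proof -
  have "\<bar>pochhammer a j\<bar> = (\<Prod>i<j. \<bar>a + real i\<bar>)"
    by (simp add: pochhammer_prod abs_prod atLeast0LessThan)
  also have "\<dots> \<le> (\<Prod>i<j. \<bar>a\<bar> + real j)"
    by (intro prod_mono) auto
  finally show ?thesis by simp
qed

text \<open>The unnormalised Beta density. Its k-th moment is \<open>Beta (n + k) v\<close>, so
  integrating a power series in t x against it inserts this factor into the k-th
  coefficient.\<close>

definition beta_density :: "nat \<Rightarrow> real \<Rightarrow> real \<Rightarrow> real" where
  "beta_density n v t = indicator {0..1} t * (t powr (real n - 1) * (1 - t) powr (v - 1))"

lemma beta_density_nonneg: "beta_density n v t \<ge> 0"
  by (simp add: beta_density_def)

lemma beta_density_measurable [measurable]: "beta_density n v \<in> borel_measurable borel"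
  unfolding beta_density_def[abs_def] by measurable

lemma beta_density_moment:
  assumes "n > 0" "v > 0"
  shows "has_bochner_integral lborel (\<lambda>t. beta_density n v t * t ^ k) (Beta (real n + real k) v)"
proof -
  have eq: "beta_density n v t * t ^ k = indicator {0..1} t *\<^sub>R (t powr (real n + real k - 1) * (1 - t) powr (v - 1))" for t
  proof (cases "t > 0")
    case True
    then have "t powr (real n + real k - 1) = t powr (real n - 1) * t ^ k"
      using powr_add[of t "real n - 1" "real k"] by (simp add: powr_realpow diff_add_eq)
    then show ?thesis by (simp add: beta_density_def)
  next
    case False
    then show ?thesis by (cases "t = 0") (auto simp: beta_density_def)
  qed
  have nk: "real n + real k > 0" using assms by simp
  have int: "set_integrable lborel {0..1} (\<lambda>t. t powr (real n + real k - 1) * (1 - t) powr (v - 1))"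
    by (rule integrable_Beta) (use nk assms in auto)
  have "(LINT t:{0..1}|lborel. t powr (real n + real k - 1) * (1 - t) powr (v - 1)) = Beta (real n + real k) v"
    using set_borel_integral_eq_integral(2)[OF int] has_integral_Beta_real[OF nk assms(2)]
    by (simp add: integral_unique)
  then show ?thesis
    using int unfolding has_bochner_integral_iff eq set_integrable_def set_lebesgue_integral_def by simp
qed

text \<open>The integral is dominated by t near 1, where the density behaves like (1 - t)^(v-1) and
  exp (t \<rho>) = exp \<rho> exp (-(1 - t) \<rho>); this produces the gain (1 + \<rho>)^(-v). Using
  the rate 1 + \<rho> keeps the estimate valid at \<rho> = 0 and costs the factor exp 1, because 1 -
  t \<le> 1.\<close>

lemma beta_density_exp:
  assumes "n > 0" "v > 0" "\<rho> \<ge> 0"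
  shows "integrable lborel (\<lambda>t. beta_density n v t * exp (t * \<rho>))"
    and "(LINT t|lborel. beta_density n v t * exp (t * \<rho>)) \<le> exp 1 * Gamma v * ((1 + \<rho>) powr (- v) * exp \<rho>)"
proof -
  define l where "l = 1 + \<rho>"
  have l: "l > 0" using assms by (simp add: l_def)
  \<comment> \<open>The majorant lives on the whole half-line t \<le> 1, which makes its integral a
    complete Gamma integral.\<close>
  define F where "F t = indicator {..1} t * ((1 - t) powr (v - 1) * exp (- ((1 - t) * l)))" for t :: real
  have [measurable]: "F \<in> borel_measurable borel" unfolding F_def by measurable
  have F0: "F t \<ge> 0" for t by (simp add: F_def)
  have le: "beta_density n v t * exp (t * \<rho>) \<le> exp 1 * exp \<rho> * F t" for t
  proof (cases "t \<in> {0..1}")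
    case True
    have "t powr (real n - 1) \<le> 1 powr (real n - 1)"
      using True assms by (intro powr_mono2) auto
    moreover have "exp (t * \<rho>) \<le> exp 1 * exp \<rho> * exp (- ((1 - t) * l))"
      using True by (simp add: exp_add[symmetric] l_def algebra_simps)
    ultimately have "(t powr (real n - 1) * (1 - t) powr (v - 1)) * exp (t * \<rho>)
        \<le> (1 * (1 - t) powr (v - 1)) * (exp 1 * exp \<rho> * exp (- ((1 - t) * l)))"
      by (intro mult_mono) auto
    then show ?thesis using True by (simp add: beta_density_def F_def mult_ac)
  next
    case False
    then show ?thesis using F0[of t] by (simp add: beta_density_def)
  qed
  have "(\<integral>\<^sup>+t. ennreal (F t) \<partial>lborel) = ennreal (1 / l) * (\<integral>\<^sup>+u. ennreal (F (1 + (- 1 / l) * u)) \<partial>lborel)"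
    using l by (subst nn_integral_real_affine[of "\<lambda>t. ennreal (F t)" "- 1 / l" 1]) auto
  also have "(\<integral>\<^sup>+u. ennreal (F (1 + (- 1 / l) * u)) \<partial>lborel)
      = (\<integral>\<^sup>+u. ennreal (l powr (1 - v)) * ennreal (indicator {0..} u * u powr (v - 1) / exp u) \<partial>lborel)"
  proof (intro nn_integral_cong)
    fix u :: real
    have "F (1 + (- 1 / l) * u) = l powr (1 - v) * (indicator {0..} u * u powr (v - 1) / exp u)"
    proof (cases "u \<ge> 0")
      case True
      have "(u / l) powr (v - 1) = l powr (1 - v) * u powr (v - 1)"
        using True l powr_minus_divide[of l "v - 1"] by (simp add: powr_divide)
      moreover have "1 - (1 + (- 1 / l) * u) = u / l" "u / l * l = u" "u / l \<ge> 0"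
        using l True by simp_all
      ultimately show ?thesis using True by (simp add: F_def exp_minus field_simps)
    next
      case False
      then have "- u / l > 0" using l by (simp add: field_simps)
      then show ?thesis using False by (simp add: F_def)
    qed
    then show "ennreal (F (1 + (- 1 / l) * u)) = ennreal (l powr (1 - v)) * ennreal (indicator {0..} u * u powr (v - 1) / exp u)"
      by (simp add: ennreal_mult'[symmetric])
  qed
  also have "\<dots> = ennreal (l powr (1 - v)) * ennreal (Gamma v)"
    using assms by (subst nn_integral_cmult) (auto simp: Gamma_conv_nn_integral_real)
  also have "ennreal (1 / l) * (ennreal (l powr (1 - v)) * ennreal (Gamma v)) = ennreal (l powr (- v) * Gamma v)"
  proof -
    have "l powr (1 - v) = l * l powr (- v)" using l powr_add[of l 1 "- v"] by simp
    then show ?thesis using l by (simp add: ennreal_mult'[symmetric])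
  qed
  finally have "has_bochner_integral lborel F (l powr (- v) * Gamma v)"
    using assms F0 by (intro has_bochner_integral_nn_integral) (auto simp: Gamma_real_pos less_imp_le)
  then have F: "integrable lborel F" "(LINT t|lborel. F t) = l powr (- v) * Gamma v"
    by (auto simp: has_bochner_integral_iff)
  show int: "integrable lborel (\<lambda>t. beta_density n v t * exp (t * \<rho>))"
  proof (rule Bochner_Integration.integrable_bound)
    show "integrable lborel (\<lambda>t. exp 1 * exp \<rho> * F t)" using F by simp
    show "AE t in lborel. norm (beta_density n v t * exp (t * \<rho>)) \<le> norm (exp 1 * exp \<rho> * F t)"
      using le F0 beta_density_nonneg[of n v] by (auto simp: abs_mult)
  qed measurable
  have "(LINT t|lborel. beta_density n v t * exp (t * \<rho>)) \<le> (LINT t|lborel. exp 1 * exp \<rho> * F t)"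
    by (rule integral_mono[OF int _ le]) (use F in simp)
  then show "(LINT t|lborel. beta_density n v t * exp (t * \<rho>)) \<le> exp 1 * Gamma v * ((1 + \<rho>) powr (- v) * exp \<rho>)"
    using F by (simp add: l_def mult_ac)
qed

text \<open>For \<open>a = n - s\<close> and \<open>v = j - s\<close> the coefficient is \<open>\<Gamma>(v) \<Gamma>(n + k) / \<Gamma>(n + k - s)\<close>.\<close>

lemma beta_pochhammer_series:
  fixes a v :: real
  assumes "n > 0" "v > 0"
  shows "\<exists>E C. C \<ge> 0 \<and> (\<forall>x::complex.
    (\<lambda>k. of_real (pochhammer (real k + a) j * Beta (real n + real k) v) * x ^ k / fact k) sums E x \<and>
    cmod (E x) \<le> C * (1 + cmod x) ^ j * ((1 + max (Re x) 0) powr (- v) * exp (max (Re x) 0)))"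
proof -
  obtain S C where S: "C \<ge> 0" "\<And>y::complex. (\<lambda>k. of_real (pochhammer (real k + a) j) * y ^ k / fact k) sums S y"
    "\<And>y. cmod (S y) \<le> C * (1 + cmod y) ^ j * exp (Re y)"
    using pochhammer_exponential_series[where j = j and a = a] by blast
  \<comment> \<open>The k-th coefficient of \<open>S (t x)\<close> carries t^k, which the
    integration replaces by the k-th moment.\<close>
  define E where "E x = (LINT t|lborel. of_real (beta_density n v t) * S (of_real t * x))" for x
  define C' where "C' = C * (exp 1 * Gamma v)"
  have C': "C' \<ge> 0" using S(1) assms by (simp add: C'_def Gamma_real_pos less_imp_le)
  have "(\<lambda>k. of_real (pochhammer (real k + a) j * Beta (real n + real k) v) * x ^ k / fact k) sums E x \<and>
    cmod (E x) \<le> C' * (1 + cmod x) ^ j * ((1 + max (Re x) 0) powr (- v) * exp (max (Re x) 0))" for x :: complex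
  proof
    define c where "c k = of_real (pochhammer (real k + a) j) * x ^ k / fact k" for k
    define f where "f k t = c k * of_real (beta_density n v t * t ^ k)" for k t
    have int: "integrable lborel (f k)" and If: "(LINT t|lborel. f k t) = c k * of_real (Beta (real n + real k) v)" for k
    proof -
      have "has_bochner_integral lborel (f k) (c k * of_real (Beta (real n + real k) v))"
        unfolding f_def
        by (intro has_bochner_integral_mult_right has_bochner_integral_of_real beta_density_moment assms)
      then show "integrable lborel (f k)" "(LINT t|lborel. f k t) = c k * of_real (Beta (real n + real k) v)"
        unfolding has_bochner_integral_iff by blast+
    qed
    have b1: "beta_density n v t * \<bar>t\<bar> ^ k \<le> beta_density n v t" for t k
      by (cases "t \<in> {0..1}") (auto simp: beta_density_def mult_left_le power_le_one)
    have nf: "cmod (f k t) \<le> cmod (c k) * beta_density n v t" for k t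
    proof -
      have "cmod (f k t) = cmod (c k) * (beta_density n v t * \<bar>t\<bar> ^ k)"
        by (simp add: f_def norm_mult norm_power beta_density_nonneg abs_mult power_abs)
      then show ?thesis using b1 by (simp add: mult_left_mono)
    qed
    \<comment> \<open>Convergence at the larger radius |x| + 1 yields absolute convergence at
      x.\<close>
    have csum: "summable (\<lambda>k. cmod (c k))"
    proof -
      have "summable (\<lambda>k. of_real (pochhammer (real k + a) j) / fact k * of_real (cmod x + 1) ^ k :: complex)"
        using S(2)[of "of_real (cmod x + 1)"] by (simp add: sums_iff)
      then have "summable (\<lambda>k. cmod (of_real (pochhammer (real k + a) j) / fact k * x ^ k))"
        by (rule powser_insidea) (simp del: of_real_add)
      then show ?thesis by (simp add: c_def)
    qed
    have sums: "(\<lambda>k. f k t) sums (of_real (beta_density n v t) * S (of_real t * x))" for t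
      using sums_mult[OF S(2)[of "of_real t * x"], of "of_real (beta_density n v t)"]
      by (simp add: f_def c_def power_mult_distrib mult_ac)
    have bint: "integrable lborel (beta_density n v)" "(LINT t|lborel. beta_density n v t) = Beta n v"
      using beta_density_moment[OF assms, of 0] by (auto simp: has_bochner_integral_iff)
    have "(\<lambda>k. LINT t|lborel. f k t) sums (LINT t|lborel. (\<Sum>k. f k t))"
    proof (rule sums_integral[OF int])
      show "AE t in lborel. summable (\<lambda>k. cmod (f k t))"
        using nf csum by (intro AE_I2 summable_comparison_test'[OF summable_mult2[OF csum]]) auto
      have "norm (LINT t|lborel. cmod (f k t)) \<le> cmod (c k) * Beta n v" for k
      proof -
        have "(LINT t|lborel. cmod (f k t)) \<le> (LINT t|lborel. cmod (c k) * beta_density n v t)"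
          using int bint nf by (intro integral_mono) auto
        then show ?thesis using bint by (simp add: integral_nonneg_AE)
      qed
      then show "summable (\<lambda>k. LINT t|lborel. cmod (f k t))"
        by (intro summable_comparison_test'[OF summable_mult2[OF csum], of 0])
    qed
    moreover have "(\<lambda>t. \<Sum>k. f k t) = (\<lambda>t. of_real (beta_density n v t) * S (of_real t * x))"
      using sums by (auto simp: sums_iff)
    ultimately have "(\<lambda>k. c k * of_real (Beta (real n + real k) v)) sums E x"
      by (simp add: If E_def)
    then show "(\<lambda>k. of_real (pochhammer (real k + a) j * Beta (real n + real k) v) * x ^ k / fact k) sums E x"
      by (simp add: c_def mult_ac)
    \<comment> \<open>A negative real part is replaced by 0 since \<open>beta_density_exp\<close>
      needs a nonnegative rate; t Re x \<le> t \<rho> on [0,1].\<close>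
    define \<rho> where "\<rho> = max (Re x) 0"
    have \<rho>: "\<rho> \<ge> 0" by (simp add: \<rho>_def)
    have nE: "cmod (of_real (beta_density n v t) * S (of_real t * x)) \<le> C * (1 + cmod x) ^ j * (beta_density n v t * exp (t * \<rho>))" for t
    proof (cases "t \<in> {0..1}")
      case True
      have "cmod (S (of_real t * x)) \<le> C * (1 + cmod (of_real t * x)) ^ j * exp (Re (of_real t * x))"
        by (rule S)
      also have "\<dots> \<le> C * (1 + cmod x) ^ j * exp (t * \<rho>)"
        using True S(1) by (intro mult_mono power_mono)
          (auto simp: norm_mult mult_left_le_one_le \<rho>_def intro!: mult_left_mono)
      finally have "beta_density n v t * cmod (S (of_real t * x)) \<le> beta_density n v t * (C * (1 + cmod x) ^ j * exp (t * \<rho>))"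
        by (intro mult_left_mono beta_density_nonneg)
      then show ?thesis by (simp add: norm_mult beta_density_nonneg mult_ac)
    qed (simp add: beta_density_def)
    have "cmod (E x) \<le> (LINT t|lborel. C * (1 + cmod x) ^ j * (beta_density n v t * exp (t * \<rho>)))"
      unfolding E_def using beta_density_exp(1)[OF assms \<rho>] nE
      by (intro order_trans[OF integral_norm_bound] integral_mono') (auto simp: beta_density_nonneg S(1))
    also have "\<dots> \<le> C * (1 + cmod x) ^ j * (exp 1 * Gamma v * ((1 + \<rho>) powr (- v) * exp \<rho>))"
      using beta_density_exp(2)[OF assms \<rho>] S(1) by (simp add: mult_left_mono)
    finally show "cmod (E x) \<le> C' * (1 + cmod x) ^ j * ((1 + max (Re x) 0) powr (- v) * exp (max (Re x) 0))"
      by (simp add: C'_def \<rho>_def mult_ac)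
  qed
  then show ?thesis using C' by blast
qed

text \<open>The inverses of the numbers by which the pairing multiplies the unweighted inner product on
  homogeneous polynomials of degree \<open>k\<close>.\<close>

definition kernel_coeff :: "nat \<Rightarrow> nat \<Rightarrow> real \<Rightarrow> nat \<Rightarrow> real" where
  "kernel_coeff N n s k = (if k < N then 1 else Gamma (real (n + k)) / Gamma (real (n + k) - s))"

lemma kernel_coeff_pos:
  assumes "n > 0" "s < real (n + N)"
  shows "kernel_coeff N n s k > 0"
  using assms by (auto simp: kernel_coeff_def intro!: divide_pos_pos Gamma_real_pos)

definition kernel :: "nat \<Rightarrow> nat \<Rightarrow> real \<Rightarrow> complex \<Rightarrow> complex" where
  "kernel N n s x = (\<Sum>k. of_real (kernel_coeff N n s k) * x ^ k / fact k)"

text \<open>The Pochhammer symbol is Gamma (n + k + v) / Gamma (n + k - s), the Beta value is Gamma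
  (n + k) Gamma v / Gamma (n + k + v), and the common Gamma value cancels. Taking j above s makes v
  positive, so the Beta integral exists even for s > 0.\<close>

lemma kernel_coeff_eq_beta:
  assumes "n > 0" "s < real (n + N)" "N \<le> k" and v: "v = real j - s" "v > 0"
  shows "kernel_coeff N n s k = 1 / Gamma v * (pochhammer (real k + (real n - s)) j * Beta (real n + real k) v)"
proof -
  have pos: "real (n + k) - s > 0" using assms by simp
  have "pochhammer (real (n + k) - s) j = Gamma (real (n + k) - s + real j) / Gamma (real (n + k) - s)"
    using pos by (intro pochhammer_Gamma) (auto dest!: nonpos_Ints_nonpos)
  then have p: "pochhammer (real k + (real n - s)) j = Gamma (real (n + k) + v) / Gamma (real (n + k) - s)"
  proof -
    have "real (n + k) - s + real j = real (n + k) + v" "real (n + k) - s = real k + (real n - s)"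
      using v by simp_all
    then show ?thesis
      using \<open>pochhammer (real (n + k) - s) j = _\<close> by metis
  qed
  have "Gamma (real (n + k) + v) > 0" "Gamma v > 0"
    using v by (auto intro!: Gamma_real_pos simp: add_nonneg_pos)
  then show ?thesis
    using assms(3) by (simp add: kernel_coeff_def p Beta_def)
qed

text \<open>A crude bound that serves only convergence: divided by k!, coefficients of size e^k
  still give an entire series of exponential type.\<close>

lemma kernel_coeff_bound:
  assumes "n > 0" "s < real (n + N)"
  obtains C where "C \<ge> 0" "\<And>k. kernel_coeff N n s k \<le> C * exp 1 ^ k"
proof -
  obtain j where j: "s < real j" using reals_Archimedean2 by blast
  define v where "v = real j - s"
  have v: "v > 0" using j by (simp add: v_def)
  define A where "A = \<bar>real n - s\<bar> + real j"
  define C where "C = max 1 (1 / Gamma v * (fact j * exp A * Beta n v))"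
  have G: "Gamma v > 0" using v by (rule Gamma_real_pos)
  have Beta_mono: "0 \<le> Beta (real n + real k) v \<and> Beta (real n + real k) v \<le> Beta n v" for k
  proof -
    have m: "beta_density n v t * t ^ k \<le> beta_density n v t" "beta_density n v t * t ^ k \<ge> 0" for t
      by (cases "t \<in> {0..1}"; auto simp: beta_density_def mult_left_le power_le_one)+
    have "(LINT t|lborel. beta_density n v t * t ^ k) \<le> (LINT t|lborel. beta_density n v t * t ^ 0)"
    proof (rule integral_mono)
      show "integrable lborel (\<lambda>t. beta_density n v t * t ^ k)" "integrable lborel (\<lambda>t. beta_density n v t * t ^ 0)"
        using beta_density_moment[OF assms(1) v] unfolding has_bochner_integral_iff by blast+
      show "beta_density n v t * t ^ k \<le> beta_density n v t * t ^ 0" for t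
        using m by simp
    qed
    moreover have "(LINT t|lborel. beta_density n v t * t ^ k) \<ge> 0"
      using m by (intro integral_nonneg_AE) auto
    moreover have I: "(LINT t|lborel. beta_density n v t * t ^ k) = Beta (real n + real k) v" for k
      using beta_density_moment[OF assms(1) v, of k] by (simp add: has_bochner_integral_iff)
    ultimately show ?thesis unfolding I by simp
  qed
  have "kernel_coeff N n s k \<le> C * exp 1 ^ k" for k
  proof (cases "k < N")
    case True
    have "1 * 1 \<le> C * exp 1 ^ k" by (intro mult_mono) (auto simp: C_def)
    then show ?thesis using True by (simp add: kernel_coeff_def)
  next
    case False
    have "\<bar>pochhammer (real k + (real n - s)) j\<bar> \<le> (\<bar>real k + (real n - s)\<bar> + real j) ^ j"
      by (rule abs_pochhammer_le)
    also have "\<dots> \<le> (real k + A) ^ j"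
      by (intro power_mono) (auto simp: A_def)
    also have "\<dots> \<le> fact j * exp (real k + A)"
      by (intro power_le_fact_exp) (auto simp: A_def)
    also have "\<dots> = fact j * exp A * exp 1 ^ k"
      by (simp add: exp_add exp_of_nat_mult[symmetric])
    finally have p: "\<bar>pochhammer (real k + (real n - s)) j\<bar> \<le> fact j * exp A * exp 1 ^ k" .
    have "kernel_coeff N n s k = 1 / Gamma v * (pochhammer (real k + (real n - s)) j * Beta (real n + real k) v)"
      by (rule kernel_coeff_eq_beta) (use assms False v v_def in auto)
    also have "\<dots> \<le> 1 / Gamma v * ((fact j * exp A * exp 1 ^ k) * Beta n v)"
      using p Beta_mono[of k] G by (intro mult_left_mono mult_mono) auto
    also have "\<dots> = 1 / Gamma v * (fact j * exp A * Beta n v) * exp 1 ^ k" by simp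
    also have "\<dots> \<le> C * exp 1 ^ k" by (intro mult_right_mono) (auto simp: C_def)
    finally show ?thesis .
  qed
  moreover have "C \<ge> 0" by (simp add: C_def)
  ultimately show ?thesis using that by blast
qed

text \<open>If both norms exceed 1, then |z| + |w| \<le> 1 + |z| |w|; otherwise one is at most 1 and
  the other within |z - w| of it, so |z| + |w| \<le> 2 + |z - w|. This lets 1 + |z| |w| be replaced
  by the product weight also under a negative exponent.\<close>

lemma one_plus_norms_le:
  fixes z w :: "'a::real_normed_vector"
  shows "(1 + norm z) * (1 + norm w) \<le> 4 * (1 + norm z * norm w) * (1 + norm (z - w))"
proof -
  define a b d where "a = norm z" "b = norm w" "d = norm (z - w)"
  have ab: "a \<le> b + d" "b \<le> a + d" "a \<ge> 0" "b \<ge> 0" "d \<ge> 0"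
    using norm_triangle_sub[of z w] norm_triangle_sub[of w z]
    by (auto simp: a_b_d_def norm_minus_commute)
  have expand: "(1 + a) * (1 + b) = 1 + a + b + a * b" "4 * (1 + a * b) * (1 + d) = 4 + 4 * d + 4 * (a * b) + 4 * (a * b * d)"
    by (simp_all add: algebra_simps)
  have nonneg: "0 \<le> a * b" "0 \<le> a * b * d" using ab by auto
  have "(1 + a) * (1 + b) \<le> 4 * (1 + a * b) * (1 + d)"
  proof (cases "a \<le> 1 \<or> b \<le> 1")
    case True
    then have "a + b \<le> 2 + d" using ab by auto
    then show ?thesis using nonneg ab unfolding expand by linarith
  next
    case False
    then have "0 \<le> (a - 1) * (b - 1)" by simp
    then have "a + b \<le> 1 + a * b" by (simp add: algebra_simps)
    then show ?thesis using nonneg ab unfolding expand by linarith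
  qed
  then show ?thesis by (simp add: a_b_d_def)
qed

lemma norm_diff_sq:
  fixes z w :: "complex ^ 'n::finite"
  shows "(norm (z - w))\<^sup>2 = (norm z)\<^sup>2 + (norm w)\<^sup>2 - 2 * Re (hinner z w)"
  unfolding Re_hinner by (simp add: power2_norm_eq_inner inner_diff inner_commute)

lemma norm_diff_sq_le:
  fixes z w :: "'a::real_inner"
  shows "(norm (z - w))\<^sup>2 \<le> 2 * (norm z)\<^sup>2 + 2 * (norm w)\<^sup>2"
proof -
  have "(norm (z + w))\<^sup>2 \<ge> 0" by simp
  then show ?thesis by (simp add: power2_norm_eq_inner inner_diff inner_add inner_commute)
qed

text \<open>For s \<ge> 0 the base is at most (1 + |z|)(1 + |w|) and the extra factors are at least
  1. For s < 0 the reverse comparison \<open>one_plus_norms_le\<close> is needed; its factor 4 (1 +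
  |z - w|) appears with the exponent |s|.\<close>

lemma one_plus_product_powr_le:
  fixes z w :: "'a::real_normed_vector"
  shows "(1 + norm z * norm w) powr s \<le> 4 powr \<bar>s\<bar> * (1 + norm (z - w)) powr \<bar>s\<bar> * ((1 + norm z) powr s * (1 + norm w) powr s)"
proof (cases "s \<ge> 0")
  case True
  have "(1 + norm z * norm w) powr s \<le> ((1 + norm z) * (1 + norm w)) powr s"
    using True by (intro powr_mono2) (auto simp: algebra_simps)
  also have "\<dots> = 1 * ((1 + norm z) powr s * (1 + norm w) powr s)"
    by (simp add: powr_mult)
  also have "\<dots> \<le> (4 powr \<bar>s\<bar> * (1 + norm (z - w)) powr \<bar>s\<bar>) * ((1 + norm z) powr s * (1 + norm w) powr s)"
  proof (rule mult_right_mono)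
    have "1 * 1 \<le> 4 powr \<bar>s\<bar> * (1 + norm (z - w)) powr \<bar>s\<bar>"
      by (intro mult_mono ge_one_powr_ge_zero) auto
    then show "1 \<le> 4 powr \<bar>s\<bar> * (1 + norm (z - w)) powr \<bar>s\<bar>" by simp
  qed auto
  finally show ?thesis .
next
  case False
  define X where "X = 4 * (1 + norm (z - w))"
  have X: "X > 0" by (simp add: X_def add_pos_nonneg)
  have pos: "1 + norm z * norm w > 0" "(1 + norm z) * (1 + norm w) > 0"
    by (auto simp: add_pos_nonneg)
  have "(1 + norm z) * (1 + norm w) / X \<le> 1 + norm z * norm w"
    using one_plus_norms_le[of z w] X by (simp add: X_def field_simps)
  then have "(1 + norm z * norm w) powr s \<le> ((1 + norm z) * (1 + norm w) / X) powr s"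
    using False X pos by (intro powr_mono2') auto
  also have "\<dots> = X powr \<bar>s\<bar> * ((1 + norm z) * (1 + norm w)) powr s"
    using X pos False by (simp add: powr_divide powr_minus_divide)
  also have "\<dots> = 4 powr \<bar>s\<bar> * (1 + norm (z - w)) powr \<bar>s\<bar> * ((1 + norm z) powr s * (1 + norm w) powr s)"
    unfolding X_def by (simp only: powr_mult mult_ac)
  finally show ?thesis .
qed

lemma exp_minus_quarter_sq_le:
  fixes x b :: real
  assumes "x \<ge> 0"
  shows "(1 + x) powr b * exp (- x\<^sup>2 / 4) \<le> exp (2 * b\<^sup>2) * exp (- x\<^sup>2 / 8)"
proof -
  have "(1 + x) powr b * exp (- x\<^sup>2 / 4) \<le> exp (\<bar>b\<bar> * x) * exp (- x\<^sup>2 / 4)"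
    using powr_le_exp[OF assms, of b] by (intro mult_right_mono) auto
  also have "\<dots> = exp (\<bar>b\<bar> * x - 1 / 4 * x\<^sup>2)" by (simp flip: exp_add)
  also have "\<dots> \<le> exp (\<bar>b\<bar>\<^sup>2 / (2 * (1 / 4)) - 1 / 4 / 2 * x\<^sup>2)"
    using linear_minus_square_le[of "1/4" "\<bar>b\<bar>" x] by simp
  also have "\<dots> = exp (2 * b\<^sup>2) * exp (- x\<^sup>2 / 8)" by (simp flip: exp_add)
  finally show ?thesis .
qed

text \<open>The main term is controlled through \<open>1 + |z| |w| \<le> (1 + max (Re \<langle>z, w\<rangle>) 0) (1 + |z - w|)\<^sup>2\<close>,
  the finitely many exceptional terms by brute force.\<close>

lemma kernel_main_term_bound:
  fixes z w :: "complex ^ 'n::finite"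
  assumes v: "v = real j - s" "v > 0"
  defines "\<rho> \<equiv> max (Re (hinner z w)) 0"
  shows "(1 + cmod (hinner z w)) ^ j * ((1 + \<rho>) powr (- v) * exp \<rho>)
    \<le> 4 powr \<bar>s\<bar> * exp (2 * (2 * v + \<bar>s\<bar>)\<^sup>2) * ((1 + norm z) powr s * (1 + norm w) powr s) *
      exp ((norm z)\<^sup>2 / 2 + (norm w)\<^sup>2 / 2 - (norm (z - w))\<^sup>2 / 8)"
proof -
  define d y where "d = norm (z - w)" "y = norm z * norm w"
  have dy: "d \<ge> 0" "y \<ge> 0" by (auto simp: d_y_def)
  have \<rho>: "\<rho> \<ge> 0" by (simp add: \<rho>_def)
  have dsq: "d\<^sup>2 = (norm z)\<^sup>2 + (norm w)\<^sup>2 - 2 * Re (hinner z w)"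
    unfolding d_y_def by (rule norm_diff_sq)
  have "2 * y \<le> (norm z)\<^sup>2 + (norm w)\<^sup>2"
    using sum_squares_bound[of "norm z" "norm w"] by (simp add: d_y_def)
  moreover have "Re (hinner z w) \<le> \<rho>" by (simp add: \<rho>_def)
  ultimately have "y \<le> \<rho> + d\<^sup>2 / 2" using dsq by linarith
  moreover have "0 \<le> \<rho> * d\<^sup>2" "0 \<le> d * \<rho>" "0 \<le> d\<^sup>2" using dy \<rho> by simp_all
  ultimately have "1 + y \<le> (1 + \<rho>) + d\<^sup>2 * 1 + 2 * d + \<rho> * d\<^sup>2 + 2 * (d * \<rho>)"
    using dy by linarith
  then have y1: "1 + y \<le> (1 + \<rho>) * (1 + d)\<^sup>2" by (simp add: power2_eq_square algebra_simps)
  have "(1 + \<rho>) powr (- v) \<le> ((1 + y) / (1 + d)\<^sup>2) powr (- v)"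
  proof (rule powr_mono2')
    show "0 < (1 + y) / (1 + d)\<^sup>2" using dy by (simp add: add_pos_nonneg)
    show "(1 + y) / (1 + d)\<^sup>2 \<le> 1 + \<rho>" using y1 dy by (simp add: field_simps add_pos_nonneg)
  qed (use v in simp)
  also have "\<dots> = (1 + y) powr (- v) * (1 + d) powr (2 * v)"
  proof -
    have "((1 + d)\<^sup>2) powr (- v) = (1 + d) powr (- (2 * v))"
      using dy by (simp add: powr_powr flip: powr_numeral)
    then show ?thesis using dy by (simp add: powr_divide powr_minus_divide)
  qed
  finally have p1: "(1 + \<rho>) powr (- v) \<le> (1 + y) powr (- v) * (1 + d) powr (2 * v)" .
  \<comment> \<open>The real part alone would allow d^2/2. The weaker d^2/4 also covers the value 0
    of the maximum, because d^2 \<le> 2 |z|^2 + 2 |w|^2.\<close>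
  have "\<rho> \<le> (norm z)\<^sup>2 / 2 + (norm w)\<^sup>2 / 2 - d\<^sup>2 / 4"
  proof -
    have "0 \<le> d\<^sup>2" by simp
    then have "Re (hinner z w) \<le> (norm z)\<^sup>2 / 2 + (norm w)\<^sup>2 / 2 - d\<^sup>2 / 4"
      using dsq by linarith
    moreover have "0 \<le> (norm z)\<^sup>2 / 2 + (norm w)\<^sup>2 / 2 - d\<^sup>2 / 4"
      using norm_diff_sq_le[of z w] by (simp add: d_y_def(1))
    ultimately show ?thesis by (simp add: \<rho>_def)
  qed
  then have p2: "exp \<rho> \<le> exp ((norm z)\<^sup>2 / 2 + (norm w)\<^sup>2 / 2) * exp (- d\<^sup>2 / 4)"
    by (simp flip: exp_add)
  have p3: "(1 + cmod (hinner z w)) ^ j \<le> (1 + y) powr real j"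
    using norm_hinner_le[of z w] dy by (subst powr_realpow) (auto simp: d_y_def intro!: power_mono add_pos_nonneg)
  have "(1 + cmod (hinner z w)) ^ j * ((1 + \<rho>) powr (- v) * exp \<rho>)
    \<le> (1 + y) powr real j * (((1 + y) powr (- v) * (1 + d) powr (2 * v)) * (exp ((norm z)\<^sup>2 / 2 + (norm w)\<^sup>2 / 2) * exp (- d\<^sup>2 / 4)))"
    by (intro mult_mono p1 p2 p3) auto
  \<comment> \<open>Here the polynomial of degree j and the gain of order v combine to the exponent
    j - v = s that the weights require.\<close>
  also have "\<dots> = (1 + y) powr s * ((1 + d) powr (2 * v) * exp (- d\<^sup>2 / 4)) * exp ((norm z)\<^sup>2 / 2 + (norm w)\<^sup>2 / 2)"
    using v(1) powr_add[of "1 + y" "real j" "- v"] by (simp add: mult_ac)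
  also have "\<dots> \<le> (4 powr \<bar>s\<bar> * (1 + d) powr \<bar>s\<bar> * ((1 + norm z) powr s * (1 + norm w) powr s)) *
      ((1 + d) powr (2 * v) * exp (- d\<^sup>2 / 4)) * exp ((norm z)\<^sup>2 / 2 + (norm w)\<^sup>2 / 2)"
    unfolding d_y_def by (intro mult_right_mono one_plus_product_powr_le) auto
  also have "\<dots> = 4 powr \<bar>s\<bar> * ((1 + norm z) powr s * (1 + norm w) powr s) * ((1 + d) powr (2 * v + \<bar>s\<bar>) * exp (- d\<^sup>2 / 4)) * exp ((norm z)\<^sup>2 / 2 + (norm w)\<^sup>2 / 2)"
    by (simp add: powr_add mult_ac)
  also have "\<dots> \<le> 4 powr \<bar>s\<bar> * ((1 + norm z) powr s * (1 + norm w) powr s) * (exp (2 * (2 * v + \<bar>s\<bar>)\<^sup>2) * exp (- d\<^sup>2 / 8)) * exp ((norm z)\<^sup>2 / 2 + (norm w)\<^sup>2 / 2)"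
    by (intro mult_right_mono mult_left_mono exp_minus_quarter_sq_le dy) auto
  also have "\<dots> = 4 powr \<bar>s\<bar> * exp (2 * (2 * v + \<bar>s\<bar>)\<^sup>2) * ((1 + norm z) powr s * (1 + norm w) powr s) *
      exp ((norm z)\<^sup>2 / 2 + (norm w)\<^sup>2 / 2 - d\<^sup>2 / 8)"
  proof -
    have "exp (- d\<^sup>2 / 8) * exp ((norm z)\<^sup>2 / 2 + (norm w)\<^sup>2 / 2) = exp ((norm z)\<^sup>2 / 2 + (norm w)\<^sup>2 / 2 - d\<^sup>2 / 8)"
      by (simp flip: exp_add)
    from this[symmetric] show ?thesis by (simp only: mult_ac)
  qed
  finally show ?thesis by (simp add: d_y_def)
qed

text \<open>A single power grows only polynomially: y^k / k! \<le> 4^k exp (y/4) costs |z|^2/8 +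
  |w|^2/8. As much again pays for inserting the two weights, whatever the sign of s, and the total
  |z|^2/4 + |w|^2/4 still fits below the exponent of the claim.\<close>

lemma kernel_exceptional_term_bound:
  fixes z w :: "complex ^ 'n::finite"
  shows "cmod (hinner z w) ^ k / fact k
    \<le> 4 ^ k * exp (4 * s\<^sup>2) ^ 2 * ((1 + norm z) powr s * (1 + norm w) powr s) *
      exp ((norm z)\<^sup>2 / 2 + (norm w)\<^sup>2 / 2 - (norm (z - w))\<^sup>2 / 8)"
proof -
  define y where "y = cmod (hinner z w)"
  have "(y / 4) ^ k \<le> fact k * exp (y / 4)" by (rule power_le_fact_exp) (simp add: y_def)
  then have "y ^ k / fact k \<le> 4 ^ k * exp (y / 4)" by (simp add: field_simps power_divide)
  moreover have "y / 4 \<le> (norm z)\<^sup>2 / 8 + (norm w)\<^sup>2 / 8"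
    using norm_hinner_le[of z w] sum_squares_bound[of "norm z" "norm w"] by (simp add: y_def)
  ultimately have 1: "y ^ k / fact k \<le> 4 ^ k * exp ((norm z)\<^sup>2 / 8 + (norm w)\<^sup>2 / 8)"
    by (elim order_trans) (simp add: mult_left_mono)
  have 2: "1 \<le> exp (4 * s\<^sup>2) * (1 + norm u) powr s * exp ((norm u)\<^sup>2 / 8)" for u :: "complex ^ 'n"
  proof -
    have "(1 + norm u) powr (- s) \<le> exp (\<bar>s\<bar> * norm u)"
      using powr_le_exp[of "norm u" "- s"] by simp
    also have "\<dots> \<le> exp (4 * s\<^sup>2 + (norm u)\<^sup>2 / 8)"
    proof -
      have "\<bar>s\<bar> * norm u - 1 / 8 * (norm u)\<^sup>2 \<le> 4 * s\<^sup>2 - 1 / 16 * (norm u)\<^sup>2"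
        using linear_minus_square_le[of "1/8" "\<bar>s\<bar>" "norm u"] by simp
      moreover have "(norm u)\<^sup>2 \<ge> 0" by simp
      ultimately show ?thesis unfolding exp_le_cancel_iff by linarith
    qed
    finally have "(1 + norm u) powr s * (1 + norm u) powr (- s) \<le> (1 + norm u) powr s * exp (4 * s\<^sup>2 + (norm u)\<^sup>2 / 8)"
      by (intro mult_left_mono) auto
    moreover have "(1 + norm u) powr s * (1 + norm u) powr (- s) = 1"
      by (subst powr_add[symmetric]) (simp add: add_nonneg_eq_0_iff)
    ultimately show ?thesis by (simp add: exp_add mult_ac)
  qed
  have "1 * 1 \<le> (exp (4 * s\<^sup>2) * (1 + norm z) powr s * exp ((norm z)\<^sup>2 / 8)) * (exp (4 * s\<^sup>2) * (1 + norm w) powr s * exp ((norm w)\<^sup>2 / 8))"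
    by (intro mult_mono 2) auto
  then have 3: "1 \<le> exp (4 * s\<^sup>2) ^ 2 * ((1 + norm z) powr s * (1 + norm w) powr s) * exp ((norm z)\<^sup>2 / 8 + (norm w)\<^sup>2 / 8)"
    by (simp add: exp_add power2_eq_square mult_ac)
  define P where "P = 4 ^ k * exp (4 * s\<^sup>2) ^ 2 * ((1 + norm z) powr s * (1 + norm w) powr s)"
  have P: "P \<ge> 0" by (simp add: P_def)
  define Q where "Q = exp ((norm z)\<^sup>2 / 8 + (norm w)\<^sup>2 / 8)"
  have "y ^ k / fact k \<le> (4 ^ k * Q) * 1" using 1 by (simp add: Q_def)
  also have "\<dots> \<le> (4 ^ k * Q) * (exp (4 * s\<^sup>2) ^ 2 * ((1 + norm z) powr s * (1 + norm w) powr s) * Q)"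
    using 3 by (intro mult_left_mono) (simp_all add: Q_def)
  also have "\<dots> = P * (exp ((norm z)\<^sup>2 / 8 + (norm w)\<^sup>2 / 8) * exp ((norm z)\<^sup>2 / 8 + (norm w)\<^sup>2 / 8))"
    by (simp add: P_def Q_def mult_ac)
  also have "\<dots> = P * exp ((norm z)\<^sup>2 / 4 + (norm w)\<^sup>2 / 4)"
    by (simp flip: exp_add)
  also have "\<dots> \<le> P * exp ((norm z)\<^sup>2 / 2 + (norm w)\<^sup>2 / 2 - (norm (z - w))\<^sup>2 / 8)"
    using norm_diff_sq_le[of z w] P by (intro mult_left_mono) auto
  finally show ?thesis by (simp add: P_def y_def)
qed

lemma kernel_bound:
  assumes s: "s < real (CARD('n::finite) + N)"
  obtains C where "C \<ge> 0" "\<And>z w :: complex ^ 'n. cmod (kernel N CARD('n) s (hinner z w))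
    \<le> C * ((1 + norm z) powr s * (1 + norm w) powr s) * exp ((norm z)\<^sup>2 / 2 + (norm w)\<^sup>2 / 2 - (norm (z - w))\<^sup>2 / 8)"
proof -
  define n where "n = CARD('n)"
  have n: "n > 0" by (simp add: n_def)
  obtain j where j: "s < real j" using reals_Archimedean2 by blast
  define v where "v = real j - s"
  have v: "v > 0" using j by (simp add: v_def)
  have G: "Gamma v > 0" using v by (rule Gamma_real_pos)
  obtain E C where E: "C \<ge> 0"
    "\<And>x::complex. (\<lambda>k. of_real (pochhammer (real k + (real n - s)) j * Beta (real n + real k) v) * x ^ k / fact k) sums E x"
    "\<And>x. cmod (E x) \<le> C * (1 + cmod x) ^ j * ((1 + max (Re x) 0) powr (- v) * exp (max (Re x) 0))"
    using beta_pochhammer_series[OF n v, of "real n - s" j] by blast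
  \<comment> \<open>In the degrees below N the coefficient is 1 instead of the Beta expression. The
    latter is defined there as well, even where Gamma (n + k - s) is not, so the main series can run
    over all k and is corrected by finitely many terms.\<close>
  define e where "e k = (1 - 1 / Gamma v * (pochhammer (real k + (real n - s)) j * Beta (real n + real k) v))" for k
  have ksum: "(\<lambda>k. of_real (kernel_coeff N n s k) * x ^ k / fact k) sums (of_real (1 / Gamma v) * E x + (\<Sum>k<N. of_real (e k) * x ^ k / fact k))" for x :: complex
  proof -
    have "(\<lambda>k. of_real (1 / Gamma v) * (of_real (pochhammer (real k + (real n - s)) j * Beta (real n + real k) v) * x ^ k / fact k)
        + (if k \<in> {..<N} then of_real (e k) * x ^ k / fact k else 0)) sums (of_real (1 / Gamma v) * E x + (\<Sum>k<N. of_real (e k) * x ^ k / fact k))"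
      by (intro sums_add sums_mult E sums_If_finite_set) simp
    moreover have "of_real (kernel_coeff N n s k) * x ^ k / fact k = of_real (1 / Gamma v) * (of_real (pochhammer (real k + (real n - s)) j * Beta (real n + real k) v) * x ^ k / fact k)
        + (if k \<in> {..<N} then of_real (e k) * x ^ k / fact k else 0)" for k
    proof (cases "k < N")
      case True
      then show ?thesis by (simp add: kernel_coeff_def e_def ring_distribs diff_divide_distrib)
    next
      case False
      then have "kernel_coeff N n s k = 1 / Gamma v * (pochhammer (real k + (real n - s)) j * Beta (real n + real k) v)"
        by (intro kernel_coeff_eq_beta) (use s n v v_def n_def in auto)
      then show ?thesis using False by simp
    qed
    ultimately show ?thesis by simp
  qed
  define C1 where "C1 = 1 / Gamma v * (C * (4 powr \<bar>s\<bar> * exp (2 * (2 * v + \<bar>s\<bar>)\<^sup>2)))"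
  define C2 where "C2 = (\<Sum>k<N. \<bar>e k\<bar> * (4 ^ k * exp (4 * s\<^sup>2) ^ 2))"
  have C12: "C1 \<ge> 0" "C2 \<ge> 0"
    unfolding C1_def C2_def using E(1) G by (auto intro!: sum_nonneg)
  show ?thesis
  proof
    show "C1 + C2 \<ge> 0" using C12 by simp
    fix z w :: "complex ^ 'n"
    define W where "W = ((1 + norm z) powr s * (1 + norm w) powr s) * exp ((norm z)\<^sup>2 / 2 + (norm w)\<^sup>2 / 2 - (norm (z - w))\<^sup>2 / 8)"
    define x where "x = hinner z w"
    have "cmod (E x) \<le> C * ((1 + cmod x) ^ j * ((1 + max (Re x) 0) powr (- v) * exp (max (Re x) 0)))"
      using E(3)[of x] by (simp add: mult_ac)
    also have "\<dots> \<le> C * (4 powr \<bar>s\<bar> * exp (2 * (2 * v + \<bar>s\<bar>)\<^sup>2) * W)"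
      using kernel_main_term_bound[of v j s z w] v v_def E(1) unfolding x_def W_def
      by (intro mult_left_mono) (simp_all add: mult_ac)
    finally have "1 / Gamma v * cmod (E x) \<le> 1 / Gamma v * (C * (4 powr \<bar>s\<bar> * exp (2 * (2 * v + \<bar>s\<bar>)\<^sup>2) * W))"
      using G by (intro mult_left_mono) auto
    then have 1: "cmod (of_real (1 / Gamma v) * E x) \<le> C1 * W"
      using G by (simp add: norm_mult norm_divide C1_def mult_ac)
    have "cmod (\<Sum>k<N. of_real (e k) * x ^ k / fact k) \<le> (\<Sum>k<N. \<bar>e k\<bar> * (cmod x ^ k / fact k))"
      by (rule order_trans[OF norm_sum]) (simp add: norm_mult norm_divide norm_power)
    also have "\<dots> \<le> (\<Sum>k<N. \<bar>e k\<bar> * (4 ^ k * exp (4 * s\<^sup>2) ^ 2 * W))"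
      using kernel_exceptional_term_bound[of z w _ s] unfolding x_def W_def
      by (intro sum_mono mult_left_mono) (simp_all add: mult_ac)
    also have "\<dots> = C2 * W" by (simp add: C2_def sum_distrib_right mult.assoc)
    finally have 2: "cmod (\<Sum>k<N. of_real (e k) * x ^ k / fact k) \<le> C2 * W" .
    have "kernel N n s x = of_real (1 / Gamma v) * E x + (\<Sum>k<N. of_real (e k) * x ^ k / fact k)"
      using ksum[of x] by (simp add: kernel_def sums_iff)
    then have "cmod (kernel N n s x) \<le> C1 * W + C2 * W"
      using 1 2 norm_triangle_ineq[of "of_real (1 / Gamma v) * E x"] by (smt (verit))
    then show "cmod (kernel N CARD('n) s (hinner z w)) \<le> (C1 + C2) * ((1 + norm z) powr s * (1 + norm w) powr s) * exp ((norm z)\<^sup>2 / 2 + (norm w)\<^sup>2 / 2 - (norm (z - w))\<^sup>2 / 8)"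
      by (simp add: W_def x_def n_def algebra_simps)
  qed
qed

section \<open>Fock spaces\<close>

lemma conjugate_exponents:
  fixes p q :: real
  assumes "1 < p" "1 / p + 1 / q = 1"
  shows "1 < q" "(p - 1) * q = p" "(q - 1) * p = q" "q = p / (p - 1)"
proof -
  have "q \<noteq> 0" using assms by auto
  then have "p + q = p * q" using assms by (simp add: field_simps)
  then show q: "q = p / (p - 1)" using assms by (simp add: field_simps)
  show "1 < q" using assms by (simp add: q field_simps)
  show "(p - 1) * q = p" using assms by (simp add: q)
  show "(q - 1) * p = q" using \<open>p + q = p * q\<close> by (simp add: algebra_simps)
qed

lemma Holder_inequality_integral:
  fixes F G :: "'a \<Rightarrow> real"
  assumes p: "1 < p" "1 / p + 1 / q = 1"
    and [measurable]: "F \<in> borel_measurable M" "G \<in> borel_measurable M"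
    and F: "\<And>x. F x \<ge> 0" "integrable M (\<lambda>x. F x powr p)"
    and G: "\<And>x. G x \<ge> 0" "integrable M (\<lambda>x. G x powr q)"
  shows "integrable M (\<lambda>x. F x * G x)"
    and "(LINT x|M. F x * G x) \<le> (LINT x|M. F x powr p) powr (1 / p) * (LINT x|M. G x powr q) powr (1 / q)"
proof -
  have q: "1 < q" using conjugate_exponents[OF p] by blast
  show int: "integrable M (\<lambda>x. F x * G x)"
  proof (rule Bochner_Integration.integrable_bound)
    show "integrable M (\<lambda>x. F x powr p / p + G x powr q / q)" using F G by simp
    show "AE x in M. norm (F x * G x) \<le> norm (F x powr p / p + G x powr q / q)"
      using Youngs_inequality[OF p(1) q p(2) F(1) G(1)] F(1) G(1) p q
      by (intro AE_I2) (simp add: abs_mult)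
  qed simp
  define A B where "A = (LINT x|M. F x powr p) powr (1 / p)" "B = (LINT x|M. G x powr q) powr (1 / q)"
  have nn: "(LINT x|M. F x powr p) \<ge> 0" "(LINT x|M. G x powr q) \<ge> 0" by (auto intro!: integral_nonneg_AE)
  have Ap: "A powr p = (LINT x|M. F x powr p)" "B powr q = (LINT x|M. G x powr q)"
    using nn p q by (simp_all add: A_B_def powr_powr)
  have AB0: "A \<ge> 0" "B \<ge> 0" by (auto simp: A_B_def)
  have zero: "AE x in M. H x = 0" if "H \<in> borel_measurable M" "\<And>x. H x \<ge> 0" "integrable M (\<lambda>x. H x powr r)" "(LINT x|M. H x powr r) = 0"
    for H :: "'a \<Rightarrow> real" and r
  proof -
    have "AE x in M. H x powr r = 0"
      using that by (subst (asm) integral_nonneg_eq_0_iff_AE) auto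
    then show ?thesis by eventually_elim auto
  qed
  have "(LINT x|M. F x * G x) \<le> A * B"
  \<comment> \<open>Young's inequality is applied to F/A and G/B; a vanishing norm makes one factor
    zero almost everywhere.\<close>
  proof (cases "A = 0 \<or> B = 0")
    case True
    then have "AE x in M. F x * G x = 0"
    proof
      assume "A = 0"
      then have "(LINT x|M. F x powr p) = 0" using Ap(1) by simp
      then have "AE x in M. F x = 0" using F by (intro zero) auto
      then show ?thesis by eventually_elim simp
    next
      assume "B = 0"
      then have "(LINT x|M. G x powr q) = 0" using Ap(2) by simp
      then have "AE x in M. G x = 0" using G by (intro zero) auto
      then show ?thesis by eventually_elim simp
    qed
    then have "(LINT x|M. F x * G x) = 0" by (rule integral_eq_zero_AE)
    then show ?thesis using AB0 by simp
  next
    case False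
    then have AB: "A > 0" "B > 0" using AB0 by auto
    have pt: "F x * G x \<le> A * B * (F x powr p / (A powr p) / p + G x powr q / (B powr q) / q)" for x
    proof -
      have "(F x / A) * (G x / B) \<le> (F x / A) powr p / p + (G x / B) powr q / q"
        using AB F(1) G(1) by (intro Youngs_inequality p q) auto
      then have "(F x / A) * (G x / B) \<le> F x powr p / (A powr p) / p + G x powr q / (B powr q) / q"
        using AB F(1) G(1) by (simp add: powr_divide)
      then have "A * B * ((F x / A) * (G x / B)) \<le> A * B * (F x powr p / (A powr p) / p + G x powr q / (B powr q) / q)"
        using AB by (intro mult_left_mono) auto
      then show ?thesis using AB by simp
    qed
    have "(LINT x|M. F x * G x) \<le> (LINT x|M. A * B * (F x powr p / (A powr p) / p + G x powr q / (B powr q) / q))"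
      using F G int pt by (intro integral_mono) auto
    also have "\<dots> = A * B * ((LINT x|M. F x powr p) / A powr p / p + (LINT x|M. G x powr q) / B powr q / q)"
      using F G by simp
    also have "\<dots> = A * B"
      using AB p by (simp add: Ap[symmetric])
    finally show ?thesis .
  qed
  then show "(LINT x|M. F x * G x) \<le> (LINT x|M. F x powr p) powr (1 / p) * (LINT x|M. G x powr q) powr (1 / q)"
    by (simp add: A_B_def)
qed

text \<open>The p-th power of this modulus is the integrand for the weight exponent \<alpha> p. The
  parametrisation by \<alpha> p makes (1 + |z|)^(-\<alpha>) a multiplier independent of p, so that
  Holder's inequality can pair the weights \<alpha> and \<beta> directly.\<close>

definition wmod :: "real \<Rightarrow> (complex ^ 'n::finite \<Rightarrow> complex) \<Rightarrow> complex ^ 'n \<Rightarrow> real" where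
  "wmod \<alpha> f z = cmod (f z) * exp (- (norm z)\<^sup>2 / 2) * (1 + norm z) powr (- \<alpha>)"

lemma wmod_nonneg: "wmod \<alpha> f z \<ge> 0"
  by (simp add: wmod_def)

lemma wmod_measurable [measurable]: "wmod \<alpha> f \<in> borel_measurable borel"
  if [measurable]: "f \<in> borel_measurable borel" for f :: "complex ^ 'n::finite \<Rightarrow> complex"
  unfolding wmod_def[abs_def] by measurable

lemma wmod_add_le: "wmod \<alpha> (\<lambda>z. f z + h z) z \<le> wmod \<alpha> f z + wmod \<alpha> h z"
  unfolding wmod_def distrib_right[symmetric] by (intro mult_right_mono norm_triangle_ineq) auto

lemma wmod_cmult: "wmod \<alpha> (\<lambda>z. c * f z) z = cmod c * wmod \<alpha> f z"
  by (simp add: wmod_def norm_mult)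

lemma fock_integrand_eq: "fock_integrand (\<alpha> * p) p f z = wmod \<alpha> f z powr p"
  by (simp add: fock_integrand_def wmod_def norm_mult powr_mult powr_powr)

lemma fock_space_iff: "f \<in> fock_space (\<alpha> * p) p \<longleftrightarrow> entire f \<and> integrable dV (\<lambda>z. wmod \<alpha> f z powr p)"
proof -
  have "fock_integrand (\<alpha> * p) p f = (\<lambda>z. wmod \<alpha> f z powr p)" by (intro ext fock_integrand_eq)
  then show ?thesis by (simp add: fock_space_def)
qed

lemma fock_norm_eq: "fock_norm (\<alpha> * p) p f = (LINT z|dV. wmod \<alpha> f z powr p) powr (1 / p)"
  by (simp add: fock_norm_def fock_integrand_eq)

lemma fock_norm_nonneg: "fock_norm a p f \<ge> 0"
  by (simp add: fock_norm_def)

lemma fock_space_dominated: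
  assumes p: "p > 0" and f: "entire f"
    and \<Phi>: "integrable dV (\<lambda>z. \<Phi> z powr p)" "\<And>z. wmod \<alpha> f z \<le> \<Phi> z"
  shows "f \<in> fock_space (\<alpha> * p) p" and "fock_norm (\<alpha> * p) p f \<le> (LINT z|dV. \<Phi> z powr p) powr (1 / p)"
proof -
  note [measurable] = entire_measurable[OF f]
  have le: "wmod \<alpha> f z powr p \<le> \<Phi> z powr p" for z
    using \<Phi>(2) wmod_nonneg p by (intro powr_mono2) auto
  have int: "integrable dV (\<lambda>z. wmod \<alpha> f z powr p)"
    by (rule Bochner_Integration.integrable_bound[OF \<Phi>(1)]) (use le in auto)
  then show "f \<in> fock_space (\<alpha> * p) p" using f by (simp add: fock_space_iff)
  have "(LINT z|dV. wmod \<alpha> f z powr p) \<le> (LINT z|dV. \<Phi> z powr p)"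
    by (rule integral_mono[OF int \<Phi>(1) le])
  then show "fock_norm (\<alpha> * p) p f \<le> (LINT z|dV. \<Phi> z powr p) powr (1 / p)"
    unfolding fock_norm_eq using p by (intro powr_mono2 integral_nonneg_AE) auto
qed

lemma fock_space_cmult:
  assumes "p > 0" "f \<in> fock_space (\<alpha> * p) p"
  shows "(\<lambda>z. c * f z) \<in> fock_space (\<alpha> * p) p"
    and "fock_norm (\<alpha> * p) p (\<lambda>z. c * f z) = cmod c * fock_norm (\<alpha> * p) p f"
proof -
  have eq: "wmod \<alpha> (\<lambda>z. c * f z) z powr p = cmod c powr p * wmod \<alpha> f z powr p" for z
    by (simp add: wmod_cmult powr_mult)
  show "(\<lambda>z. c * f z) \<in> fock_space (\<alpha> * p) p"
    using assms by (auto simp: fock_space_iff eq intro: entire_cmult)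
  have "(LINT z|dV. wmod \<alpha> f z powr p) \<ge> 0" by (intro integral_nonneg_AE) auto
  then show "fock_norm (\<alpha> * p) p (\<lambda>z. c * f z) = cmod c * fock_norm (\<alpha> * p) p f"
    using assms(1) by (simp add: fock_norm_eq eq powr_mult powr_powr)
qed

lemma add_powr_le:
  fixes a b p :: real
  assumes "a \<ge> 0" "b \<ge> 0" "p > 0"
  shows "(a + b) powr p \<le> 2 powr p * (a powr p + b powr p)"
proof -
  have "(a + b) powr p \<le> (2 * max a b) powr p" using assms by (intro powr_mono2) auto
  also have "\<dots> = 2 powr p * max a b powr p" by (simp add: powr_mult)
  also have "\<dots> \<le> 2 powr p * (a powr p + b powr p)" by (intro mult_left_mono) (auto simp: max_def)
  finally show ?thesis .
qed

text \<open>A quasi-triangle inequality in place of Minkowski's: the constant 4 bounds 2 times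
  2^(1/p), and it suffices for closure under sums and for norm limits.\<close>

lemma fock_space_add:
  assumes p: "p > 1" and f: "f \<in> fock_space (\<alpha> * p) p" and h: "h \<in> fock_space (\<alpha> * p) p"
  shows "(\<lambda>z. f z + h z) \<in> fock_space (\<alpha> * p) p"
    and "fock_norm (\<alpha> * p) p (\<lambda>z. f z + h z) \<le> 4 * (fock_norm (\<alpha> * p) p f + fock_norm (\<alpha> * p) p h)"
proof -
  have F: "entire f" "integrable dV (\<lambda>z. wmod \<alpha> f z powr p)" and H: "entire h" "integrable dV (\<lambda>z. wmod \<alpha> h z powr p)"
    using f h by (auto simp: fock_space_iff)
  note [measurable] = entire_measurable[OF F(1)] entire_measurable[OF H(1)]
  define A B where "A = (LINT z|dV. wmod \<alpha> f z powr p)" "B = (LINT z|dV. wmod \<alpha> h z powr p)"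
  have AB: "A \<ge> 0" "B \<ge> 0" by (auto simp: A_B_def intro!: integral_nonneg_AE)
  have le: "(wmod \<alpha> f z + wmod \<alpha> h z) powr p \<le> 2 powr p * (wmod \<alpha> f z powr p + wmod \<alpha> h z powr p)" for z
    using p by (intro add_powr_le wmod_nonneg) auto
  have int: "integrable dV (\<lambda>z. (wmod \<alpha> f z + wmod \<alpha> h z) powr p)"
    by (rule Bochner_Integration.integrable_bound[of _ "\<lambda>z. 2 powr p * (wmod \<alpha> f z powr p + wmod \<alpha> h z powr p)"])
      (use F H le in \<open>auto simp: add_nonneg_nonneg\<close>)
  note dom = fock_space_dominated[of p "\<lambda>z. f z + h z" "\<lambda>z. wmod \<alpha> f z + wmod \<alpha> h z" \<alpha>, OF _ _ int wmod_add_le]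
  show "(\<lambda>z. f z + h z) \<in> fock_space (\<alpha> * p) p"
    using p F H by (intro dom(1)) auto
  have "fock_norm (\<alpha> * p) p (\<lambda>z. f z + h z) \<le> (LINT z|dV. (wmod \<alpha> f z + wmod \<alpha> h z) powr p) powr (1 / p)"
    using p F H by (intro dom(2)) auto
  also have "\<dots> \<le> (2 powr p * (A + B)) powr (1 / p)"
  proof (intro powr_mono2)
    have "(LINT z|dV. (wmod \<alpha> f z + wmod \<alpha> h z) powr p) \<le> (LINT z|dV. 2 powr p * (wmod \<alpha> f z powr p + wmod \<alpha> h z powr p))"
      by (rule integral_mono[OF int _ le]) (use F H in simp)
    then show "(LINT z|dV. (wmod \<alpha> f z + wmod \<alpha> h z) powr p) \<le> 2 powr p * (A + B)"
      using F H by (simp add: A_B_def)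
  qed (use p in \<open>auto intro!: integral_nonneg_AE\<close>)
  also have "\<dots> = 2 * (A + B) powr (1 / p)"
    using p AB by (simp add: powr_mult powr_powr)
  also have "(A + B) powr (1 / p) \<le> 2 powr (1 / p) * (A powr (1 / p) + B powr (1 / p))"
    using p AB by (intro add_powr_le) auto
  also have "\<dots> \<le> 2 * (A powr (1 / p) + B powr (1 / p))"
    using p powr_mono[of "1 / p" 1 2] by (intro mult_right_mono) auto
  finally show "fock_norm (\<alpha> * p) p (\<lambda>z. f z + h z) \<le> 4 * (fock_norm (\<alpha> * p) p f + fock_norm (\<alpha> * p) p h)"
    by (simp add: fock_norm_eq A_B_def)
qed

lemma fock_space_diff:
  assumes p: "p > 1" and f: "f \<in> fock_space (\<alpha> * p) p" and h: "h \<in> fock_space (\<alpha> * p) p"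
  shows "(\<lambda>z. f z - h z) \<in> fock_space (\<alpha> * p) p"
    and "fock_norm (\<alpha> * p) p (\<lambda>z. f z - h z) \<le> 4 * (fock_norm (\<alpha> * p) p f + fock_norm (\<alpha> * p) p h)"
  using fock_space_add[OF p f fock_space_cmult(1)[OF _ h, of "-1"]] fock_space_cmult(2)[OF _ h, of "-1"] p
  by auto

lemma fock_space_zero: "p > 0 \<Longrightarrow> (\<lambda>z. 0) \<in> fock_space (\<alpha> * p) p"
  by (auto simp: fock_space_iff wmod_def)

lemma fock_space_sum:
  assumes p: "p > 1" and "\<And>i. i \<in> A \<Longrightarrow> f i \<in> fock_space (\<alpha> * p) p"
  shows "(\<lambda>z. \<Sum>i\<in>A. f i z) \<in> fock_space (\<alpha> * p) p"
  using assms(2)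
  by (induction A rule: infinite_finite_induct) (use p in \<open>auto intro: fock_space_zero fock_space_add\<close>)

section \<open>Functions of exponential type and growth of Fock functions\<close>

lemma exp_weight_le:
  fixes x :: real
  assumes "x \<ge> 0"
  shows "exp (r * x) * exp (- x\<^sup>2 / 2) * (1 + x) powr a \<le> exp ((r + \<bar>a\<bar>) * x - 1 / 2 * x\<^sup>2)"
proof -
  have "exp (r * x) * exp (- x\<^sup>2 / 2) * (1 + x) powr a \<le> exp (r * x) * exp (- x\<^sup>2 / 2) * exp (\<bar>a\<bar> * x)"
    using powr_le_exp[OF assms, of a] by (intro mult_left_mono) auto
  also have "\<dots> = exp ((r + \<bar>a\<bar>) * x - 1 / 2 * x\<^sup>2)"
    by (simp flip: exp_add) (simp add: algebra_simps)
  finally show ?thesis .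
qed

lemma integrable_exp_weight:
  assumes "p > 0"
  shows "integrable dV (\<lambda>z :: complex ^ 'n::finite. (exp (r * norm z) * exp (- (norm z)\<^sup>2 / 2) * (1 + norm z) powr a) powr p)"
proof (rule Bochner_Integration.integrable_bound)
  show "integrable dV (\<lambda>z :: complex ^ 'n. exp (p * (r + \<bar>a\<bar>) * norm z - p / 2 * (norm z)\<^sup>2))"
    using assms by (intro integrable_exp_gaussian) simp
  have "(exp (r * norm z) * exp (- (norm z)\<^sup>2 / 2) * (1 + norm z) powr a) powr p \<le> exp (p * (r + \<bar>a\<bar>) * norm z - p / 2 * (norm z)\<^sup>2)" for z :: "complex ^ 'n"
  proof -
    have "(exp (r * norm z) * exp (- (norm z)\<^sup>2 / 2) * (1 + norm z) powr a) powr p \<le> exp ((r + \<bar>a\<bar>) * norm z - 1 / 2 * (norm z)\<^sup>2) powr p"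
      using assms by (intro powr_mono2 exp_weight_le) auto
    then show ?thesis by (simp add: powr_def algebra_simps)
  qed
  then show "AE z :: complex ^ 'n in dV. norm ((exp (r * norm z) * exp (- (norm z)\<^sup>2 / 2) * (1 + norm z) powr a) powr p)
      \<le> norm (exp (p * (r + \<bar>a\<bar>) * norm z - p / 2 * (norm z)\<^sup>2))" by simp
qed simp

text \<open>The constant next to M depends on the type r but not on f. The powers of the inner
  product are estimated through this, with r free to be chosen.\<close>

lemma fock_space_exp_type:
  fixes f :: "complex ^ 'n::finite \<Rightarrow> complex"
  assumes p: "p > 0" and f: "entire f" and M: "\<And>z. cmod (f z) \<le> M * exp (r * norm z)"
  shows "f \<in> fock_space (\<alpha> * p) p"
    and "fock_norm (\<alpha> * p) p f \<le> M * (LINT z|(dV :: (complex ^ 'n) measure). (exp (r * norm z) * exp (- (norm z)\<^sup>2 / 2) * (1 + norm z) powr (- \<alpha>)) powr p) powr (1 / p)"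
proof -
  let ?u = "\<lambda>z :: complex ^ 'n. exp (r * norm z) * exp (- (norm z)\<^sup>2 / 2) * (1 + norm z) powr (- \<alpha>)"
  have M0: "M \<ge> 0"
  proof -
    have "0 \<le> cmod (f 0)" by simp
    also have "\<dots> \<le> M" using M[of 0] by simp
    finally show ?thesis .
  qed
  have le: "wmod \<alpha> f z \<le> M * ?u z" for z
    unfolding wmod_def mult.assoc[symmetric] by (intro mult_right_mono M) auto
  have eq: "(M * ?u z) powr p = M powr p * ?u z powr p" for z by (simp add: powr_mult)
  have int: "integrable dV (\<lambda>z. (M * ?u z) powr p)"
    unfolding eq by (intro integrable_mult_right integrable_exp_weight p)
  show "f \<in> fock_space (\<alpha> * p) p" by (rule fock_space_dominated(1)[OF p f int le])
  have "(LINT z|dV. ?u z powr p) \<ge> 0" by (intro integral_nonneg_AE) auto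
  then show "fock_norm (\<alpha> * p) p f \<le> M * (LINT z|dV. ?u z powr p) powr (1 / p)"
    using fock_space_dominated(2)[OF p f int le] p M0 by (simp add: eq powr_mult powr_powr)
qed

text \<open>Holder's inequality with the Gaussian split evenly: one half and the weight complete |f|
  to \<open>wmod\<close>, the other half times exp (r |w|) and the inverse weight has finite L^q
  norm, which is C.\<close>

lemma fock_gaussian_growth_bound:
  assumes p: "1 < p"
  obtains C where "C \<ge> 0" "\<And>f :: complex ^ 'n::finite \<Rightarrow> complex. f \<in> fock_space (\<alpha> * p) p \<Longrightarrow>
    integrable dV (\<lambda>w. cmod (f w) * exp (r * norm w - (norm w)\<^sup>2)) \<and>
    (LINT w|dV. cmod (f w) * exp (r * norm w - (norm w)\<^sup>2)) \<le> C * fock_norm (\<alpha> * p) p f"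
proof -
  define q where "q = p / (p - 1)"
  have pq: "1 / p + 1 / q = 1" using p by (simp add: q_def field_simps)
  have q: "q > 1" using conjugate_exponents[OF p pq] by blast
  define G where "G w = exp (r * norm w) * exp (- (norm w)\<^sup>2 / 2) * (1 + norm w) powr \<alpha>" for w :: "complex ^ 'n"
  define C where "C = (LINT w|dV. G w powr q) powr (1 / q)"
  have [measurable]: "G \<in> borel_measurable borel" unfolding G_def by measurable
  have "integrable dV (\<lambda>w. cmod (f w) * exp (r * norm w - (norm w)\<^sup>2)) \<and>
    (LINT w|dV. cmod (f w) * exp (r * norm w - (norm w)\<^sup>2)) \<le> C * fock_norm (\<alpha> * p) p f"
    if "f \<in> fock_space (\<alpha> * p) p" for f :: "complex ^ 'n \<Rightarrow> complex"
  proof -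
    have f: "entire f" "integrable dV (\<lambda>z. wmod \<alpha> f z powr p)" using that by (auto simp: fock_space_iff)
    note [measurable] = entire_measurable[OF f(1)]
    have eq: "cmod (f w) * exp (r * norm w - (norm w)\<^sup>2) = wmod \<alpha> f w * G w" for w
    proof -
      have "(1 + norm w) powr (- \<alpha>) * (1 + norm w) powr \<alpha> = 1"
        by (subst powr_add[symmetric]) (simp add: add_nonneg_eq_0_iff)
      moreover have "exp (r * norm w - (norm w)\<^sup>2) = exp (- (norm w)\<^sup>2 / 2) * (exp (r * norm w) * exp (- (norm w)\<^sup>2 / 2))"
        by (simp flip: exp_add)
      ultimately show ?thesis by (simp add: wmod_def G_def)
    qed
    have Gint: "integrable dV (\<lambda>w. G w powr q)" unfolding G_def using q by (intro integrable_exp_weight) simp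
    have G0: "G w \<ge> 0" for w by (simp add: G_def)
    have "wmod \<alpha> f \<in> borel_measurable dV" "G \<in> borel_measurable dV" by measurable
    note H = Holder_inequality_integral[OF p pq this wmod_nonneg f(2) G0 Gint]
    show ?thesis
      unfolding eq C_def fock_norm_eq using H(1) H(2)[THEN order_trans, OF eq_refl[OF mult.commute]] by blast
  qed
  moreover have "C \<ge> 0" by (simp add: C_def)
  ultimately show ?thesis using that by blast
qed

lemma fock_gaussian_growth:
  assumes p: "1 < p" and f: "f \<in> fock_space (\<alpha> * p) p"
  shows "gaussian_growth f"
  unfolding gaussian_growth_def
proof (intro conjI allI)
  show "entire f" using f by (simp add: fock_space_iff)
  show "integrable dV (\<lambda>w. cmod (f w) * exp (r * norm w - (norm w)\<^sup>2))" for r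
    by (rule fock_gaussian_growth_bound[OF p, of \<alpha> r]) (use f in blast)
qed

text \<open>Taking absolute values in the reproducing formula bounds f on a ball by the preceding
  integral with r = R. The constant is not sharp in R, as it is used only on fixed balls.\<close>

lemma fock_pointwise_bound:
  assumes p: "1 < p"
  obtains C where "C \<ge> 0" "\<And>(f :: complex ^ 'n::finite \<Rightarrow> complex) z. f \<in> fock_space (\<alpha> * p) p \<Longrightarrow> norm z \<le> R \<Longrightarrow>
    cmod (f z) \<le> C * fock_norm (\<alpha> * p) p f"
proof -
  obtain C where C: "C \<ge> 0" "\<And>f :: complex ^ 'n \<Rightarrow> complex. f \<in> fock_space (\<alpha> * p) p \<Longrightarrow>
    integrable dV (\<lambda>w. cmod (f w) * exp (R * norm w - (norm w)\<^sup>2)) \<and>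
    (LINT w|dV. cmod (f w) * exp (R * norm w - (norm w)\<^sup>2)) \<le> C * fock_norm (\<alpha> * p) p f"
    using fock_gaussian_growth_bound[OF p, of \<alpha> R] by blast
  have "cmod (f z) \<le> C * fock_norm (\<alpha> * p) p f" if f: "f \<in> fock_space (\<alpha> * p) p" and z: "norm z \<le> R"
    for f :: "complex ^ 'n \<Rightarrow> complex" and z
  proof -
    have g: "gaussian_growth f" by (rule fock_gaussian_growth[OF p f])
    note rep = gaussian_growth_reproducing[OF g, of z]
    have "cmod (f z) \<le> (LINT w|dV. cmod (f w * exp (hinner z w) * of_real (exp (- (norm w)\<^sup>2))))"
      unfolding rep(2)[symmetric] by (rule integral_norm_bound)
    also have "\<dots> \<le> (LINT w|dV. cmod (f w) * exp (R * norm w - (norm w)\<^sup>2))"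
    proof (rule integral_mono)
      fix w
      have "cmod (exp (hinner z w)) \<le> exp (R * norm w)"
        using norm_exp_hinner_le[of z w] z mult_right_mono[OF z norm_ge_zero[of w]]
        by (meson exp_le_cancel_iff order_trans)
      then have "cmod (f w) * cmod (exp (hinner z w)) * exp (- (norm w)\<^sup>2) \<le> cmod (f w) * exp (R * norm w) * exp (- (norm w)\<^sup>2)"
        by (intro mult_left_mono mult_right_mono) auto
      then show "cmod (f w * exp (hinner z w) * of_real (exp (- (norm w)\<^sup>2))) \<le> cmod (f w) * exp (R * norm w - (norm w)\<^sup>2)"
        by (simp add: norm_mult exp_diff exp_minus divide_inverse mult.assoc norm_inverse)
    qed (use rep C(2)[OF f] in \<open>auto intro: integrable_norm\<close>)
    also have "\<dots> \<le> C * fock_norm (\<alpha> * p) p f" using C(2)[OF f] by blast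
    finally show ?thesis .
  qed
  then show ?thesis using that C(1) by blast
qed

lemma fock_hpart_bound:
  assumes p: "1 < p" and R: "R > 0"
  obtains C where "C \<ge> 0" "\<And>(f :: complex ^ 'n::finite \<Rightarrow> complex) k z. f \<in> fock_space (\<alpha> * p) p \<Longrightarrow>
    cmod (hpart f k z) \<le> C * fock_norm (\<alpha> * p) p f * (norm z / R) ^ k"
proof -
  obtain C where C: "C \<ge> 0" "\<And>(f :: complex ^ 'n \<Rightarrow> complex) z. f \<in> fock_space (\<alpha> * p) p \<Longrightarrow> norm z \<le> R \<Longrightarrow>
    cmod (f z) \<le> C * fock_norm (\<alpha> * p) p f"
    using fock_pointwise_bound[OF p, of \<alpha> R] by blast
  show ?thesis
    by (rule that[OF C(1)], rule hpart_bound[OF _ R]) (use C(2) in \<open>auto simp: fock_space_iff\<close>)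
qed

section \<open>The pairing\<close>

definition lo :: "nat \<Rightarrow> (complex ^ 'n::finite \<Rightarrow> complex) \<Rightarrow> complex ^ 'n \<Rightarrow> complex" where
  "lo N f z = (\<Sum>k<N. hpart f k z)"

definition hi :: "nat \<Rightarrow> (complex ^ 'n::finite \<Rightarrow> complex) \<Rightarrow> complex ^ 'n \<Rightarrow> complex" where
  "hi N f z = f z - lo N f z"

text \<open>With \<open>N = 0\<close> this covers the case \<open>\<sigma> < 2n\<close> of the pairing as well.\<close>

definition split_pairing :: "nat \<Rightarrow> real \<Rightarrow> (complex ^ 'n::finite \<Rightarrow> complex) \<Rightarrow> (complex ^ 'n \<Rightarrow> complex) \<Rightarrow> complex" where
  "split_pairing N \<sigma> f g = weighted_inner 0 (lo N f) (lo N g) + weighted_inner \<sigma> (hi N f) (hi N g)"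

text \<open>The number of degrees k \<le> \<sigma>/2, hence the first degree of the high part; the
  successor accounts for degree 0. Below 2n the pairing is not split and every degree counts as
  high.\<close>

definition cutoff :: "nat \<Rightarrow> real \<Rightarrow> nat" where
  "cutoff n \<sigma> = (if \<sigma> < 2 * real n then 0 else Suc (nat \<lfloor>\<sigma> / 2\<rfloor>))"

lemma less_cutoff: "\<sigma> / 2 < real (n + cutoff n \<sigma>)"
  by (auto simp: cutoff_def) linarith

lemma cutoff_iff:
  assumes "\<sigma> \<ge> 2 * real n"
  shows "real k \<le> \<bar>\<sigma> / 2\<bar> \<longleftrightarrow> k < cutoff n \<sigma>"
proof -
  have "\<sigma> / 2 \<ge> 0" using assms by (smt (verit) divide_nonneg_pos of_nat_0_le_iff)
  then have "real k \<le> \<bar>\<sigma> / 2\<bar> \<longleftrightarrow> int k \<le> \<lfloor>\<sigma> / 2\<rfloor>" by (simp add: le_floor_iff)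
  also have "\<dots> \<longleftrightarrow> k \<le> nat \<lfloor>\<sigma> / 2\<rfloor>" using \<open>\<sigma> / 2 \<ge> 0\<close> by (simp add: le_nat_iff)
  finally show ?thesis using assms by (simp add: cutoff_def less_Suc_eq_le)
qed

lemma low_part_eq_lo:
  fixes f :: "complex ^ 'n::finite \<Rightarrow> complex"
  assumes "gaussian_growth f" "\<sigma> \<ge> 2 * real CARD('n)"
  shows "low_part (\<sigma> / 2) f = lo (cutoff CARD('n) \<sigma>) f"
proof -
  have "{k. real k \<le> \<bar>\<sigma> / 2\<bar>} = {..<cutoff CARD('n) \<sigma>}"
    using cutoff_iff[OF assms(2)] by auto
  then show ?thesis
    by (intro ext) (simp only: low_part_def lo_def gaussian_growth_homogeneous_part[OF assms(1)])
qed

lemma high_part_eq_hi: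
  fixes f :: "complex ^ 'n::finite \<Rightarrow> complex"
  assumes "gaussian_growth f" "\<sigma> \<ge> 2 * real CARD('n)"
  shows "high_part (\<sigma> / 2) f = hi (cutoff CARD('n) \<sigma>) f"
proof
  fix z
  have "entire f" using assms by (simp add: gaussian_growth_def)
  then have "(\<lambda>k. hpart f k z - (if k \<in> {..<cutoff CARD('n) \<sigma>} then hpart f k z else 0)) sums (f z - lo (cutoff CARD('n) \<sigma>) f z)"
    unfolding lo_def by (intro sums_diff hpart_sums sums_If_finite_set) auto
  moreover have "hpart f k z - (if k \<in> {..<cutoff CARD('n) \<sigma>} then hpart f k z else 0) = (if real k > \<bar>\<sigma> / 2\<bar> then homogeneous_part f k z else 0)" for k
    using cutoff_iff[OF assms(2), of k] by (auto simp: gaussian_growth_homogeneous_part[OF assms(1)] not_le)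
  ultimately show "high_part (\<sigma> / 2) f z = hi (cutoff CARD('n) \<sigma>) f z"
    by (simp add: high_part_def hi_def sums_iff)
qed

lemma lo_0 [simp]: "lo 0 f = (\<lambda>_. 0)" and hi_0 [simp]: "hi 0 f = f"
  by (auto simp: lo_def[abs_def] hi_def[abs_def])

lemma pairing_eq_split_pairing:
  fixes f g :: "complex ^ 'n::finite \<Rightarrow> complex"
  assumes "gaussian_growth f" "gaussian_growth g"
  shows "pairing \<sigma> f g = split_pairing (cutoff CARD('n) \<sigma>) \<sigma> f g"
proof (cases "\<sigma> < 2 * real CARD('n)")
  case True
  then have "cutoff CARD('n) \<sigma> = 0" by (simp add: cutoff_def)
  then show ?thesis using True by (simp add: pairing_def split_pairing_def weighted_inner_def weighted_integrand_def)
next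
  case False
  then show ?thesis using assms
    by (simp add: pairing_def split_pairing_def low_part_eq_lo high_part_eq_hi)
qed

lemma pairing_well_definedI:
  fixes f g :: "complex ^ 'n::finite \<Rightarrow> complex"
  assumes "gaussian_growth f" "gaussian_growth g"
    and "N = cutoff CARD('n) \<sigma>" "integrable dV (weighted_integrand 0 (lo N f) (lo N g))" "integrable dV (weighted_integrand \<sigma> (hi N f) (hi N g))"
  shows "pairing_well_defined \<sigma> f g"
proof (cases "\<sigma> < 2 * real CARD('n)")
  case True
  then have "cutoff CARD('n) \<sigma> = 0" by (simp add: cutoff_def)
  then show ?thesis using True assms by (simp add: pairing_well_defined_def)
next
  case False
  then show ?thesis using assms
    by (simp add: pairing_well_defined_def low_part_eq_lo high_part_eq_hi)
qed

lemma fock_hpart_entire: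
  assumes "1 < p" "f \<in> fock_space (\<alpha> * p) p"
  shows "entire (hpart f k)"
  using gaussian_growth_hpart_polynomial[OF fock_gaussian_growth[OF assms]] homogeneous_polynomial_entire by blast

text \<open>The estimate of the parts on the unit ball together with |z|^k \<le> k! exp |z| makes
  the low part of exponential type, with a constant linear in the norm of f. The maximum merely
  combines the pointwise and the norm bound.\<close>

lemma lo_bound:
  assumes p: "1 < p"
  obtains C where "C \<ge> 0" "\<And>f :: complex ^ 'n::finite \<Rightarrow> complex. f \<in> fock_space (\<alpha> * p) p \<Longrightarrow>
    lo N f \<in> fock_space (\<alpha> * p) p \<and> (\<forall>z. cmod (lo N f z) \<le> C * fock_norm (\<alpha> * p) p f * exp (norm z)) \<and>
    fock_norm (\<alpha> * p) p (lo N f) \<le> C * fock_norm (\<alpha> * p) p f"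
proof -
  obtain C where C: "C \<ge> 0" "\<And>(f :: complex ^ 'n \<Rightarrow> complex) k z. f \<in> fock_space (\<alpha> * p) p \<Longrightarrow>
    cmod (hpart f k z) \<le> C * fock_norm (\<alpha> * p) p f * (norm z / 1) ^ k"
    using fock_hpart_bound[OF p zero_less_one, of \<alpha>] by blast
  define I where "I = (LINT z|(dV :: (complex ^ 'n) measure). (exp (1 * norm z) * exp (- (norm z)\<^sup>2 / 2) * (1 + norm z) powr (- \<alpha>)) powr p) powr (1 / p)"
  define K where "K = C * (\<Sum>k<N. fact k)"
  have K: "K \<ge> 0" using C by (simp add: K_def sum_nonneg)
  have I: "I \<ge> 0" by (simp add: I_def)
  have "lo N f \<in> fock_space (\<alpha> * p) p \<and> (\<forall>z. cmod (lo N f z) \<le> max K (K * I) * fock_norm (\<alpha> * p) p f * exp (norm z)) \<and>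
    fock_norm (\<alpha> * p) p (lo N f) \<le> max K (K * I) * fock_norm (\<alpha> * p) p f"
    if f: "f \<in> fock_space (\<alpha> * p) p" for f :: "complex ^ 'n \<Rightarrow> complex"
  proof -
    have ent: "entire (lo N f)"
      unfolding lo_def[abs_def] by (intro entire_sum fock_hpart_entire[OF p f])
    have le: "cmod (lo N f z) \<le> (K * fock_norm (\<alpha> * p) p f) * exp (1 * norm z)" for z
    proof -
      have "cmod (lo N f z) \<le> (\<Sum>k<N. cmod (hpart f k z))" unfolding lo_def by (rule norm_sum)
      also have "\<dots> \<le> (\<Sum>k<N. C * fock_norm (\<alpha> * p) p f * (fact k * exp (norm z)))"
      proof (rule sum_mono)
        fix k
        have "cmod (hpart f k z) \<le> C * fock_norm (\<alpha> * p) p f * norm z ^ k" using C(2)[OF f, of k z] by simp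
        also have "\<dots> \<le> C * fock_norm (\<alpha> * p) p f * (fact k * exp (norm z))"
          using C(1) by (intro mult_left_mono power_le_fact_exp mult_nonneg_nonneg fock_norm_nonneg) auto
        finally show "cmod (hpart f k z) \<le> C * fock_norm (\<alpha> * p) p f * (fact k * exp (norm z))" .
      qed
      also have "\<dots> = (K * fock_norm (\<alpha> * p) p f) * exp (1 * norm z)"
        by (simp add: K_def sum_distrib_left sum_distrib_right mult_ac)
      finally show ?thesis .
    qed
    have p0: "p > 0" using p by simp
    have max: "K * fock_norm (\<alpha> * p) p f \<le> max K (K * I) * fock_norm (\<alpha> * p) p f"
      "K * I * fock_norm (\<alpha> * p) p f \<le> max K (K * I) * fock_norm (\<alpha> * p) p f"
      by (intro mult_right_mono fock_norm_nonneg; simp)+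
    have "cmod (lo N f z) \<le> max K (K * I) * fock_norm (\<alpha> * p) p f * exp (norm z)" for z
      using order_trans[OF le[of z] mult_right_mono[OF max(1), of "exp (1 * norm z)"]] by simp
    moreover have "fock_norm (\<alpha> * p) p (lo N f) \<le> max K (K * I) * fock_norm (\<alpha> * p) p f"
      using fock_space_exp_type(2)[OF p0 ent le, of \<alpha>] max(2) by (simp add: I_def mult_ac)
    ultimately show ?thesis using fock_space_exp_type(1)[OF p0 ent le, of \<alpha>] by blast
  qed
  moreover have "max K (K * I) \<ge> 0" using K by simp
  ultimately show ?thesis using that by blast
qed

text \<open>The vanishing of order N at the origin is what later compensates the singular weight.
  Estimating the parts on the ball of radius 2 gives the ratio 1/2 for the tail on the unit
  ball.\<close>

lemma hi_bound:
  assumes p: "1 < p"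
  obtains C where "C \<ge> 0" "\<And>f :: complex ^ 'n::finite \<Rightarrow> complex. f \<in> fock_space (\<alpha> * p) p \<Longrightarrow>
    hi N f \<in> fock_space (\<alpha> * p) p \<and> (\<forall>z. norm z \<le> 1 \<longrightarrow> cmod (hi N f z) \<le> C * fock_norm (\<alpha> * p) p f * norm z ^ N) \<and>
    fock_norm (\<alpha> * p) p (hi N f) \<le> C * fock_norm (\<alpha> * p) p f"
proof -
  obtain C1 where C1: "C1 \<ge> 0" "\<And>f :: complex ^ 'n \<Rightarrow> complex. f \<in> fock_space (\<alpha> * p) p \<Longrightarrow>
    lo N f \<in> fock_space (\<alpha> * p) p \<and> (\<forall>z. cmod (lo N f z) \<le> C1 * fock_norm (\<alpha> * p) p f * exp (norm z)) \<and>
    fock_norm (\<alpha> * p) p (lo N f) \<le> C1 * fock_norm (\<alpha> * p) p f"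
    using lo_bound[OF p, of \<alpha> N] by blast
  have two: "(0::real) < 2" by simp
  obtain C2 where C2: "C2 \<ge> 0" "\<And>(f :: complex ^ 'n \<Rightarrow> complex) k z. f \<in> fock_space (\<alpha> * p) p \<Longrightarrow>
    cmod (hpart f k z) \<le> C2 * fock_norm (\<alpha> * p) p f * (norm z / 2) ^ k"
    using fock_hpart_bound[OF p two, of \<alpha>] by blast
  define C where "C = max (4 * (1 + C1)) (2 * C2)"
  have "hi N f \<in> fock_space (\<alpha> * p) p \<and> (\<forall>z. norm z \<le> 1 \<longrightarrow> cmod (hi N f z) \<le> C * fock_norm (\<alpha> * p) p f * norm z ^ N) \<and>
    fock_norm (\<alpha> * p) p (hi N f) \<le> C * fock_norm (\<alpha> * p) p f"
    if f: "f \<in> fock_space (\<alpha> * p) p" for f :: "complex ^ 'n \<Rightarrow> complex"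
  proof (intro conjI allI impI)
    note diff = fock_space_diff[OF p f, of "lo N f"]
    show "hi N f \<in> fock_space (\<alpha> * p) p"
      unfolding hi_def[abs_def] using diff(1) C1(2)[OF f] by blast
    have "fock_norm (\<alpha> * p) p (hi N f) \<le> 4 * (fock_norm (\<alpha> * p) p f + fock_norm (\<alpha> * p) p (lo N f))"
      unfolding hi_def[abs_def] using diff(2) C1(2)[OF f] by blast
    also have "\<dots> \<le> 4 * (1 + C1) * fock_norm (\<alpha> * p) p f" using C1(2)[OF f] by (simp add: algebra_simps)
    also have "\<dots> \<le> C * fock_norm (\<alpha> * p) p f"
      by (intro mult_right_mono fock_norm_nonneg) (simp add: C_def)
    finally show "fock_norm (\<alpha> * p) p (hi N f) \<le> C * fock_norm (\<alpha> * p) p f" .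
    fix z :: "complex ^ 'n" assume z: "norm z \<le> 1"
    have ent: "entire f" using f by (simp add: fock_space_iff)
    define K where "K = C2 * fock_norm (\<alpha> * p) p f"
    have K: "K \<ge> 0" using C2(1) by (simp add: K_def fock_norm_nonneg)
    have tm: "cmod (hpart f (k + N) z) \<le> K * norm z ^ N * (1 / 2) ^ k" for k
    proof -
      have "cmod (hpart f (k + N) z) \<le> K * ((norm z / 2) ^ N * (norm z / 2) ^ k)"
        using C2(2)[OF f, of "k + N" z] by (simp add: K_def power_add mult.commute)
      also have "\<dots> \<le> K * (norm z ^ N * (1 / 2) ^ k)"
        using K z by (intro mult_left_mono mult_mono power_mono) auto
      finally show ?thesis by simp
    qed
    have "(\<lambda>k. hpart f (k + N) z) sums hi N f z"
      using sums_split_initial_segment[OF hpart_sums[OF ent, of z], of N] by (simp add: hi_def lo_def)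
    moreover have geo: "(\<lambda>k. K * norm z ^ N * (1 / 2) ^ k) sums (K * norm z ^ N * 2)"
      using sums_mult[OF geometric_sums[of "1 / 2 :: real"], of "K * norm z ^ N"] by simp
    ultimately have "cmod (hi N f z) \<le> K * norm z ^ N * 2"
      using norm_suminf_le[of "\<lambda>k. hpart f (k + N) z" "\<lambda>k. K * norm z ^ N * (1 / 2) ^ k"] tm
      by (simp add: sums_iff)
    also have "\<dots> = 2 * C2 * (fock_norm (\<alpha> * p) p f * norm z ^ N)" by (simp add: K_def)
    also have "\<dots> \<le> C * (fock_norm (\<alpha> * p) p f * norm z ^ N)"
      by (intro mult_right_mono mult_nonneg_nonneg fock_norm_nonneg) (auto simp: C_def)
    finally show "cmod (hi N f z) \<le> C * fock_norm (\<alpha> * p) p f * norm z ^ N" by (simp add: mult.assoc)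
  qed
  moreover have "C \<ge> 0" using C2 by (simp add: C_def)
  ultimately show ?thesis using that by blast
qed

lemma integrable_norm_power_weight:
  assumes "\<sigma> / 2 < real (CARD('n::finite) + N)"
  shows "integrable dV (\<lambda>z :: complex ^ 'n. norm z ^ (2 * N) * weight \<sigma> z)"
proof -
  have "\<exists>c. \<forall>s < real (CARD('n) + N). has_bochner_integral dV
    (\<lambda>z :: complex ^ 'n. norm z ^ (2 * N) * weight (2 * s) z) (c * Gamma (real (CARD('n) + N) - s))"
    by (rule homogeneous_Gamma_nonneg[of _ _ 1]) (auto simp: power_mult_distrib power_le_one)
  then obtain c where "\<forall>s < real (CARD('n) + N). has_bochner_integral dV
    (\<lambda>z :: complex ^ 'n. norm z ^ (2 * N) * weight (2 * s) z) (c * Gamma (real (CARD('n) + N) - s))" by blast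
  from this[rule_format, OF assms] show ?thesis by (simp add: has_bochner_integral_iff)
qed

lemma powr_minus_le_one_plus:
  fixes x \<sigma> :: real
  assumes "x \<ge> 1"
  shows "x powr (- \<sigma>) \<le> 2 powr \<bar>\<sigma>\<bar> * (1 + x) powr (- \<sigma>)"
proof (cases "\<sigma> \<ge> 0")
  case True
  have "x powr (- \<sigma>) \<le> ((1 + x) / 2) powr (- \<sigma>)" using assms True by (intro powr_mono2') auto
  then show ?thesis using True assms by (simp add: powr_divide powr_minus_divide)
next
  case False
  have "x powr (- \<sigma>) \<le> (1 + x) powr (- \<sigma>)" using assms False by (intro powr_mono2) auto
  also have "\<dots> \<le> 2 powr \<bar>\<sigma>\<bar> * (1 + x) powr (- \<sigma>)"
    using ge_one_powr_ge_zero[of 2 "\<bar>\<sigma>\<bar>"] mult_right_mono[of 1 "2 powr \<bar>\<sigma>\<bar>" "(1 + x) powr (- \<sigma>)"] by simp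
  finally show ?thesis .
qed

text \<open>The low parts are of exponential type, so their Gaussian product is integrable. For the
  high parts the unit ball is separated: inside, the two zeros of order N beat |z|^(-\<sigma>);
  outside, |z|^(-\<sigma>) is comparable to the product of the two weights and Holder's inequality
  applies.\<close>

lemma split_pairing_bound:
  assumes p: "1 < p" "1 / p + 1 / q = 1" and N: "(\<alpha> + \<beta>) / 2 < real (CARD('n::finite) + N)"
  obtains C where "C \<ge> 0" "\<And>f g :: complex ^ 'n \<Rightarrow> complex. f \<in> fock_space (\<alpha> * p) p \<Longrightarrow> g \<in> fock_space (\<beta> * q) q \<Longrightarrow>
    integrable dV (weighted_integrand 0 (lo N f) (lo N g)) \<and>
    integrable dV (weighted_integrand (\<alpha> + \<beta>) (hi N f) (hi N g)) \<and>
    cmod (split_pairing N (\<alpha> + \<beta>) f g) \<le> C * fock_norm (\<alpha> * p) p f * fock_norm (\<beta> * q) q g"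
proof -
  define \<sigma> where "\<sigma> = \<alpha> + \<beta>"
  have q: "1 < q" using conjugate_exponents[OF p] by blast
  obtain A1 where A1: "A1 \<ge> 0" "\<And>f :: complex ^ 'n \<Rightarrow> complex. f \<in> fock_space (\<alpha> * p) p \<Longrightarrow>
    lo N f \<in> fock_space (\<alpha> * p) p \<and> (\<forall>z. cmod (lo N f z) \<le> A1 * fock_norm (\<alpha> * p) p f * exp (norm z)) \<and>
    fock_norm (\<alpha> * p) p (lo N f) \<le> A1 * fock_norm (\<alpha> * p) p f"
    using lo_bound[OF p(1), of \<alpha> N] by blast
  obtain A2 where A2: "A2 \<ge> 0" "\<And>f :: complex ^ 'n \<Rightarrow> complex. f \<in> fock_space (\<beta> * q) q \<Longrightarrow>
    lo N f \<in> fock_space (\<beta> * q) q \<and> (\<forall>z. cmod (lo N f z) \<le> A2 * fock_norm (\<beta> * q) q f * exp (norm z)) \<and>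
    fock_norm (\<beta> * q) q (lo N f) \<le> A2 * fock_norm (\<beta> * q) q f"
    using lo_bound[OF q, of \<beta> N] by blast
  obtain B1 where B1: "B1 \<ge> 0" "\<And>f :: complex ^ 'n \<Rightarrow> complex. f \<in> fock_space (\<alpha> * p) p \<Longrightarrow>
    hi N f \<in> fock_space (\<alpha> * p) p \<and> (\<forall>z. norm z \<le> 1 \<longrightarrow> cmod (hi N f z) \<le> B1 * fock_norm (\<alpha> * p) p f * norm z ^ N) \<and>
    fock_norm (\<alpha> * p) p (hi N f) \<le> B1 * fock_norm (\<alpha> * p) p f"
    using hi_bound[OF p(1), of \<alpha> N] by blast
  obtain B2 where B2: "B2 \<ge> 0" "\<And>f :: complex ^ 'n \<Rightarrow> complex. f \<in> fock_space (\<beta> * q) q \<Longrightarrow>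
    hi N f \<in> fock_space (\<beta> * q) q \<and> (\<forall>z. norm z \<le> 1 \<longrightarrow> cmod (hi N f z) \<le> B2 * fock_norm (\<beta> * q) q f * norm z ^ N) \<and>
    fock_norm (\<beta> * q) q (hi N f) \<le> B2 * fock_norm (\<beta> * q) q f"
    using hi_bound[OF q, of \<beta> N] by blast
  define I0 where "I0 = (LINT z|(dV :: (complex ^ 'n) measure). exp (2 * norm z - 1 * (norm z)\<^sup>2))"
  define I1 where "I1 = (LINT z|(dV :: (complex ^ 'n) measure). norm z ^ (2 * N) * weight \<sigma> z)"
  have I0int: "integrable dV (\<lambda>z :: complex ^ 'n. exp (2 * norm z - 1 * (norm z)\<^sup>2))"
    by (rule integrable_exp_gaussian) simp
  have I1int: "integrable dV (\<lambda>z :: complex ^ 'n. norm z ^ (2 * N) * weight \<sigma> z)"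
    by (rule integrable_norm_power_weight) (use N in \<open>simp add: \<sigma>_def\<close>)
  have I0: "I0 \<ge> 0" and I1: "I1 \<ge> 0"
    by (auto simp: I0_def I1_def intro!: integral_nonneg_AE)
  define C where "C = A1 * A2 * I0 + (B1 * B2 * I1 + 2 powr \<bar>\<sigma>\<bar> * (B1 * B2))"
  have "integrable dV (weighted_integrand 0 (lo N f) (lo N g)) \<and>
    integrable dV (weighted_integrand (\<alpha> + \<beta>) (hi N f) (hi N g)) \<and>
    cmod (split_pairing N (\<alpha> + \<beta>) f g) \<le> C * fock_norm (\<alpha> * p) p f * fock_norm (\<beta> * q) q g"
    if f: "f \<in> fock_space (\<alpha> * p) p" and g: "g \<in> fock_space (\<beta> * q) q" for f g :: "complex ^ 'n \<Rightarrow> complex"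
  proof -
    define nf ng where "nf = fock_norm (\<alpha> * p) p f" "ng = fock_norm (\<beta> * q) q g"
    have nn: "nf \<ge> 0" "ng \<ge> 0" by (auto simp: nf_ng_def fock_norm_nonneg)
    note F = A1(2)[OF f, folded nf_ng_def] B1(2)[OF f, folded nf_ng_def]
    note G = A2(2)[OF g, folded nf_ng_def] B2(2)[OF g, folded nf_ng_def]
    have ent: "entire (lo N f)" "entire (lo N g)" "entire (hi N f)" "entire (hi N g)"
      using F G by (auto simp: fock_space_iff)
    note [measurable] = ent[THEN entire_measurable]
    have w0: "cmod (weighted_integrand 0 (lo N f) (lo N g) z) \<le> (A1 * A2 * nf * ng) * exp (2 * norm z - 1 * (norm z)\<^sup>2)" for z
    proof -
      have "cmod (lo N f z) * cmod (lo N g z) \<le> (A1 * nf * exp (norm z)) * (A2 * ng * exp (norm z))"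
        using F G A1(1) nn by (intro mult_mono) auto
      then have "(cmod (lo N f z) * cmod (lo N g z)) * weight 0 z \<le> ((A1 * nf * exp (norm z)) * (A2 * ng * exp (norm z))) * (exp (- (norm z)\<^sup>2) * 1)"
        using A1(1) A2(1) nn by - (rule mult_mono, auto)
      also have "\<dots> = (A1 * A2 * nf * ng) * (exp (norm z) * exp (norm z) * exp (- (norm z)\<^sup>2))" by simp
      also have "exp (norm z) * exp (norm z) * exp (- (norm z)\<^sup>2) = exp (2 * norm z - 1 * (norm z)\<^sup>2)"
        by (simp flip: exp_add)
      finally show ?thesis by (simp add: weighted_integrand_def norm_mult)
    qed
    have int0: "integrable dV (weighted_integrand 0 (lo N f) (lo N g))"
      by (rule Bochner_Integration.integrable_bound[of _ "\<lambda>z. (A1 * A2 * nf * ng) * exp (2 * norm z - 1 * (norm z)\<^sup>2)"])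
        (use I0int w0 A1(1) A2(1) nn in \<open>auto simp: abs_mult\<close>)
    have b0: "cmod (weighted_inner 0 (lo N f) (lo N g)) \<le> (A1 * A2 * nf * ng) * I0"
    proof -
      have "cmod (weighted_inner 0 (lo N f) (lo N g)) \<le> (LINT z|(dV :: (complex ^ 'n) measure). (A1 * A2 * nf * ng) * exp (2 * norm z - 1 * (norm z)\<^sup>2))"
        unfolding weighted_inner_def using int0 I0int w0
        by (intro order_trans[OF integral_norm_bound] integral_mono) auto
      then show ?thesis by (simp add: I0_def)
    qed
    \<comment> \<open>One majorant for all z: the first summand dominates inside the unit ball, the
      second outside.\<close>
    define H where "H z = (B1 * B2 * nf * ng) * (norm z ^ (2 * N) * weight \<sigma> z) + 2 powr \<bar>\<sigma>\<bar> * (wmod \<alpha> (hi N f) z * wmod \<beta> (hi N g) z)" for z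
    have hol: "integrable dV (\<lambda>z. wmod \<alpha> (hi N f) z * wmod \<beta> (hi N g) z)"
      "(LINT z|dV. wmod \<alpha> (hi N f) z * wmod \<beta> (hi N g) z) \<le> fock_norm (\<alpha> * p) p (hi N f) * fock_norm (\<beta> * q) q (hi N g)"
      using Holder_inequality_integral[OF p, of "wmod \<alpha> (hi N f)" dV "wmod \<beta> (hi N g)"] F G wmod_nonneg
      by (auto simp: fock_norm_eq fock_space_iff)
    have Hint: "integrable dV H"
      unfolding H_def using hol I1int by (intro Bochner_Integration.integrable_add integrable_mult_right)
    have w1: "cmod (weighted_integrand \<sigma> (hi N f) (hi N g) z) \<le> H z" for z
    proof (cases "norm z \<le> 1")
      case True
      have "cmod (hi N f z) * cmod (hi N g z) \<le> (B1 * nf * norm z ^ N) * (B2 * ng * norm z ^ N)"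
        using F G B1(1) nn True by (intro mult_mono) auto
      then have "(cmod (hi N f z) * cmod (hi N g z)) * weight \<sigma> z \<le> ((B1 * nf * norm z ^ N) * (B2 * ng * norm z ^ N)) * weight \<sigma> z"
        by (intro mult_right_mono) auto
      also have "\<dots> = (B1 * B2 * nf * ng) * (norm z ^ (2 * N) * weight \<sigma> z)"
        by (simp add: mult_2 power_add)
      also have "\<dots> \<le> H z" by (simp add: H_def wmod_nonneg)
      finally show ?thesis by (simp add: weighted_integrand_def norm_mult)
    next
      case False
      have le: "weight \<sigma> z \<le> exp (- (norm z)\<^sup>2) * (2 powr \<bar>\<sigma>\<bar> * (1 + norm z) powr (- \<sigma>))"
        using False by (intro mult_left_mono powr_minus_le_one_plus) auto
      have e: "exp (- (norm z)\<^sup>2) = exp (- (norm z)\<^sup>2 / 2) * exp (- (norm z)\<^sup>2 / 2)"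
          "(1 + norm z) powr (- \<sigma>) = (1 + norm z) powr (- \<alpha>) * (1 + norm z) powr (- \<beta>)"
        by (simp_all add: \<sigma>_def flip: exp_add powr_add)
      have "(cmod (hi N f z) * cmod (hi N g z)) * weight \<sigma> z \<le> (cmod (hi N f z) * cmod (hi N g z)) * (exp (- (norm z)\<^sup>2) * (2 powr \<bar>\<sigma>\<bar> * (1 + norm z) powr (- \<sigma>)))"
        using le by (rule mult_left_mono) simp
      also have "\<dots> = (cmod (hi N f z) * cmod (hi N g z)) *
          (exp (- (norm z)\<^sup>2 / 2) * exp (- (norm z)\<^sup>2 / 2) * (2 powr \<bar>\<sigma>\<bar> * ((1 + norm z) powr (- \<alpha>) * (1 + norm z) powr (- \<beta>))))"
        by (simp only: e)
      also have "\<dots> = 2 powr \<bar>\<sigma>\<bar> * (wmod \<alpha> (hi N f) z * wmod \<beta> (hi N g) z)"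
        by (simp only: wmod_def mult_ac)
      also have "\<dots> \<le> H z" using B1(1) B2(1) nn by (simp add: H_def)
      finally show ?thesis by (simp add: weighted_integrand_def norm_mult)
    qed
    have int1: "integrable dV (weighted_integrand \<sigma> (hi N f) (hi N g))"
    proof (rule Bochner_Integration.integrable_bound[OF Hint])
      show "AE z in dV. cmod (weighted_integrand \<sigma> (hi N f) (hi N g) z) \<le> norm (H z)"
        using order_trans[OF w1 abs_ge_self] by simp
    qed simp
    have b1: "cmod (weighted_inner \<sigma> (hi N f) (hi N g)) \<le> (B1 * B2 * nf * ng) * I1 + 2 powr \<bar>\<sigma>\<bar> * ((B1 * nf) * (B2 * ng))"
    proof -
      have "cmod (weighted_inner \<sigma> (hi N f) (hi N g)) \<le> (LINT z|dV. H z)"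
        unfolding weighted_inner_def using int1 Hint w1
        by (intro order_trans[OF integral_norm_bound] integral_mono) auto
      also have "\<dots> = (B1 * B2 * nf * ng) * I1 + 2 powr \<bar>\<sigma>\<bar> * (LINT z|dV. wmod \<alpha> (hi N f) z * wmod \<beta> (hi N g) z)"
        unfolding H_def I1_def using hol I1int
        by (subst Bochner_Integration.integral_add) (auto intro: integrable_mult_right)
      also have "(LINT z|dV. wmod \<alpha> (hi N f) z * wmod \<beta> (hi N g) z) \<le> (B1 * nf) * (B2 * ng)"
        using hol(2) F G B1(1) nn by (elim order_trans) (auto intro!: mult_mono fock_norm_nonneg)
      finally show ?thesis by simp
    qed
    have "cmod (split_pairing N \<sigma> f g) \<le> (A1 * A2 * nf * ng) * I0 + ((B1 * B2 * nf * ng) * I1 + 2 powr \<bar>\<sigma>\<bar> * ((B1 * nf) * (B2 * ng)))"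
      unfolding split_pairing_def by (rule order_trans[OF norm_triangle_ineq]) (intro add_mono b0 b1)
    also have "\<dots> = C * nf * ng" by (simp add: C_def algebra_simps)
    finally show ?thesis using int0 int1 by (simp add: \<sigma>_def nf_ng_def)
  qed
  moreover have "C \<ge> 0" using A1(1) A2(1) B1(1) B2(1) I0 I1 by (simp add: C_def)
  ultimately show ?thesis using that by blast
qed

section \<open>Linearity of the pairing and its values on powers of the inner product\<close>

lemma lo_add: "entire f \<Longrightarrow> entire h \<Longrightarrow> lo N (\<lambda>z. f z + h z) = (\<lambda>z. lo N f z + lo N h z)"
  by (intro ext) (simp add: lo_def hpart_add sum.distrib)

lemma hi_add: "entire f \<Longrightarrow> entire h \<Longrightarrow> hi N (\<lambda>z. f z + h z) = (\<lambda>z. hi N f z + hi N h z)"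
  by (intro ext) (simp add: hi_def lo_add)

lemma lo_cmult: "entire f \<Longrightarrow> lo N (\<lambda>z. c * f z) = (\<lambda>z. c * lo N f z)"
  by (intro ext) (simp add: lo_def hpart_cmult sum_distrib_left)

lemma hi_cmult: "entire f \<Longrightarrow> hi N (\<lambda>z. c * f z) = (\<lambda>z. c * hi N f z)"
  by (intro ext) (simp add: hi_def lo_cmult right_diff_distrib)

lemma weighted_inner_add:
  "integrable dV (weighted_integrand \<sigma> f g) \<Longrightarrow> integrable dV (weighted_integrand \<sigma> h g) \<Longrightarrow>
   weighted_inner \<sigma> (\<lambda>z. f z + h z) g = weighted_inner \<sigma> f g + weighted_inner \<sigma> h g"
proof -
  assume int: "integrable dV (weighted_integrand \<sigma> f g)" "integrable dV (weighted_integrand \<sigma> h g)"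
  have "weighted_integrand \<sigma> (\<lambda>z. f z + h z) g = (\<lambda>z. weighted_integrand \<sigma> f g z + weighted_integrand \<sigma> h g z)"
    by (intro ext) (simp add: weighted_integrand_def distrib_right)
  then show ?thesis using int by (simp add: weighted_inner_def)
qed

lemma weighted_inner_cmult: "weighted_inner \<sigma> (\<lambda>z. c * f z) g = c * weighted_inner \<sigma> f g"
  unfolding weighted_inner_def weighted_integrand_def mult.assoc by simp

lemma weighted_integrand_commute: "weighted_integrand \<sigma> f g = (\<lambda>z. cnj (weighted_integrand \<sigma> g f z))"
  by (auto simp: weighted_integrand_def)

lemma weighted_inner_commute: "weighted_inner \<sigma> f g = cnj (weighted_inner \<sigma> g f)"
  unfolding weighted_inner_def by (subst weighted_integrand_commute) simp

lemma integrable_weighted_integrand_commute: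
  "integrable dV (weighted_integrand \<sigma> f g) \<longleftrightarrow> integrable dV (weighted_integrand \<sigma> g f)"
  by (subst weighted_integrand_commute) simp

lemma bounded_functional_split_pairing:
  fixes g :: "complex ^ 'n::finite \<Rightarrow> complex"
  assumes p: "1 < p" "1 / p + 1 / q = 1" and N: "(\<alpha> + \<beta>) / 2 < real (CARD('n) + N)"
    and g: "g \<in> fock_space (\<beta> * q) q"
  shows "bounded_functional (\<alpha> * p) p (\<lambda>f. split_pairing N (\<alpha> + \<beta>) f g)"
proof -
  obtain C where C: "C \<ge> 0" "\<And>f g :: complex ^ 'n \<Rightarrow> complex. f \<in> fock_space (\<alpha> * p) p \<Longrightarrow> g \<in> fock_space (\<beta> * q) q \<Longrightarrow>
    integrable dV (weighted_integrand 0 (lo N f) (lo N g)) \<and>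
    integrable dV (weighted_integrand (\<alpha> + \<beta>) (hi N f) (hi N g)) \<and>
    cmod (split_pairing N (\<alpha> + \<beta>) f g) \<le> C * fock_norm (\<alpha> * p) p f * fock_norm (\<beta> * q) q g"
    using split_pairing_bound[OF p N] by blast
  show ?thesis
    unfolding bounded_functional_def
  proof (intro conjI ballI allI exI[of _ "C * fock_norm (\<beta> * q) q g"])
    fix f h :: "complex ^ 'n \<Rightarrow> complex" assume f: "f \<in> fock_space (\<alpha> * p) p" and h: "h \<in> fock_space (\<alpha> * p) p"
    have "entire f" "entire h" using f h by (auto simp: fock_space_iff)
    then show "split_pairing N (\<alpha> + \<beta>) (\<lambda>z. f z + h z) g = split_pairing N (\<alpha> + \<beta>) f g + split_pairing N (\<alpha> + \<beta>) h g"
      using C(2)[OF f g] C(2)[OF h g] by (simp add: split_pairing_def lo_add hi_add weighted_inner_add)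
  next
    fix c and f :: "complex ^ 'n \<Rightarrow> complex" assume f: "f \<in> fock_space (\<alpha> * p) p"
    then have "entire f" by (auto simp: fock_space_iff)
    then show "split_pairing N (\<alpha> + \<beta>) (\<lambda>z. c * f z) g = c * split_pairing N (\<alpha> + \<beta>) f g"
      by (simp add: split_pairing_def lo_cmult hi_cmult weighted_inner_cmult distrib_left)
  next
    fix f :: "complex ^ 'n \<Rightarrow> complex" assume f: "f \<in> fock_space (\<alpha> * p) p"
    show "cmod (split_pairing N (\<alpha> + \<beta>) f g) \<le> C * fock_norm (\<beta> * q) q g * fock_norm (\<alpha> * p) p f"
      using C(2)[OF f g] by (simp add: mult_ac)
  qed
qed

lemma entire_hinner_power: "entire (\<lambda>w. hinner w z ^ k)"
  by (intro entire_power entire_hinner)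

text \<open>The type t is free: increasing it makes the constant k! / t^k smaller, which later
  outweighs the growth of the kernel coefficients.\<close>

lemma hinner_power_exp_bound:
  assumes "t > 0"
  shows "cmod (hinner w z ^ k) \<le> (norm z ^ k * fact k / t ^ k) * exp (t * norm w)"
proof -
  have "(t * norm w) ^ k \<le> fact k * exp (t * norm w)" using assms by (intro power_le_fact_exp) auto
  then have "norm w ^ k \<le> fact k / t ^ k * exp (t * norm w)"
    using assms by (simp add: power_mult_distrib field_simps)
  then have "norm z ^ k * norm w ^ k \<le> norm z ^ k * (fact k / t ^ k * exp (t * norm w))"
    by (intro mult_left_mono) auto
  moreover have "cmod (hinner w z ^ k) \<le> (norm w * norm z) ^ k"
    unfolding norm_power by (intro power_mono norm_hinner_le) auto
  ultimately show ?thesis by (simp add: power_mult_distrib mult_ac)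
qed

lemma hinner_power_in_fock_space: "p > 0 \<Longrightarrow> (\<lambda>w. hinner w z ^ k) \<in> fock_space (\<alpha> * p) p"
  using fock_space_exp_type(1)[OF _ entire_hinner_power hinner_power_exp_bound[of 1]] by simp

lemma hpart_lo:
  assumes p: "1 < p" and g: "g \<in> fock_space (\<beta> * p) p"
  shows "hpart (lo N g) k z = (if k < N then hpart g k z else 0)"
    and "hpart (hi N g) k z = (if k < N then 0 else hpart g k z)"
proof -
  have "lo N g \<in> fock_space (\<beta> * p) p" by (rule lo_bound[OF p, of \<beta> N]) (use g in blast)
  then have ent: "entire g" "entire (lo N g)" using g by (simp_all add: fock_space_iff)
  show lo: "hpart (lo N g) k z = (if k < N then hpart g k z else 0)"
  proof (rule hpart_unique[OF ent(2)])
    fix t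
    have "(\<lambda>k. if k \<in> {..<N} then hpart g k z * t ^ k else 0) sums (\<Sum>k<N. hpart g k z * t ^ k)"
      by (rule sums_If_finite_set) simp
    moreover have "(\<lambda>k. if k \<in> {..<N} then hpart g k z * t ^ k else 0) = (\<lambda>k. (if k < N then hpart g k z else 0) * t ^ k)"
      by auto
    ultimately show "(\<lambda>k. (if k < N then hpart g k z else 0) * t ^ k) sums lo N g (t *s z)"
      by (simp add: lo_def hpart_smult[OF ent(1)] mult.commute)
  qed
  have "hpart (\<lambda>z. lo N g z + hi N g z) k z = hpart (lo N g) k z + hpart (hi N g) k z"
    using ent by (intro hpart_add) (auto simp: hi_def[abs_def])
  then show "hpart (hi N g) k z = (if k < N then 0 else hpart g k z)"
    by (simp add: lo hi_def split: if_splits)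
qed

text \<open>A power is homogeneous, so either its low or its high part is zero, and orthogonality
  reduces g to its part of degree k. The pairing thus evaluates this part at z up to an explicit
  nonzero factor: representing a functional amounts to prescribing the homogeneous parts of
  g.\<close>

lemma split_pairing_hinner_power:
  fixes g :: "complex ^ 'n::finite \<Rightarrow> complex"
  assumes p: "1 < p" "1 / p + 1 / q = 1" and N: "(\<alpha> + \<beta>) / 2 < real (CARD('n) + N)"
    and g: "g \<in> fock_space (\<beta> * q) q"
  shows "split_pairing N (\<alpha> + \<beta>) (\<lambda>w. hinner w z ^ k) g
    = fact k / of_real (kernel_coeff N CARD('n) ((\<alpha> + \<beta>) / 2) k) * cnj (hpart g k z)"
proof -
  define \<sigma> where "\<sigma> = \<alpha> + \<beta>"
  define P where "P = (\<lambda>w. hinner w z ^ k)"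
  have q: "1 < q" using conjugate_exponents[OF p] by blast
  have P: "entire P" "P \<in> fock_space (\<alpha> * p) p" "\<And>c w. P (c *s w) = c ^ k * P w"
    unfolding P_def using p by (auto intro: entire_hinner_power hinner_power_in_fock_space hinner_power_homogeneous)
  have hP: "hpart P j w = (if j = k then P w else 0)" for j w
    by (rule hpart_homogeneous) (use P in auto)
  have loP: "lo N P = (if k < N then P else (\<lambda>_. 0))"
    by (rule ext) (simp add: lo_def hP)
  then have hiP: "hi N P = (if k < N then (\<lambda>_. 0) else P)"
    by (intro ext) (simp add: hi_def)
  have gg: "lo N g \<in> fock_space (\<beta> * q) q" "hi N g \<in> fock_space (\<beta> * q) q"
    by (rule lo_bound[OF q, of \<beta> N], use g in blast) (rule hi_bound[OF q, of \<beta> N], use g in blast)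
  note growth = fock_gaussian_growth[OF q gg(1)] fock_gaussian_growth[OF q gg(2)]
  show ?thesis
  proof (cases "k < N")
    case True
    have "split_pairing N \<sigma> P g = cnj (weighted_inner 0 (lo N g) P)"
      using True by (simp add: split_pairing_def loP hiP weighted_inner_commute[of 0 P]) (simp add: weighted_inner_def weighted_integrand_def)
    also have "\<dots> = fact k * cnj (hpart g k z)"
      unfolding P_def weighted_inner_hinner_power[OF growth(1)] using True by (simp add: hpart_lo(1)[OF q g])
    finally show ?thesis using True by (simp add: \<sigma>_def P_def kernel_coeff_def)
  next
    case False
    have "\<sigma> / 2 < real (CARD('n) + k)" using N False by (simp add: \<sigma>_def)
    note int = weighted_inner_hpart_hinner_power[OF growth(2) this, of z, folded P_def]
    obtain C where "C \<ge> 0" "\<And>f g :: complex ^ 'n \<Rightarrow> complex. f \<in> fock_space (\<alpha> * p) p \<Longrightarrow> g \<in> fock_space (\<beta> * q) q \<Longrightarrow>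
      integrable dV (weighted_integrand 0 (lo N f) (lo N g)) \<and>
      integrable dV (weighted_integrand (\<alpha> + \<beta>) (hi N f) (hi N g)) \<and>
      cmod (split_pairing N (\<alpha> + \<beta>) f g) \<le> C * fock_norm (\<alpha> * p) p f * fock_norm (\<beta> * q) q g"
      using split_pairing_bound[OF p N] by blast
    then have "integrable dV (weighted_integrand \<sigma> (hi N P) (hi N g))" using P(2) g by (simp add: \<sigma>_def)
    then have intP: "integrable dV (weighted_integrand \<sigma> (hi N g) P)"
      using False by (simp add: hiP integrable_weighted_integrand_commute)
    have "split_pairing N \<sigma> P g = cnj (weighted_inner \<sigma> (hi N g) P)"
      using False by (simp add: split_pairing_def loP hiP weighted_inner_commute[of \<sigma> P]) (simp add: weighted_inner_def weighted_integrand_def)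
    also have "weighted_inner \<sigma> (hi N g) P = weighted_inner \<sigma> (hpart (hi N g) k) P"
      by (rule weighted_inner_hpart[OF _ P(1) P(3) intP int(1)]) (use gg in \<open>simp add: fock_space_iff\<close>)
    finally show ?thesis
      using False unfolding int(2)
      by (simp add: \<sigma>_def P_def kernel_coeff_def hpart_lo(2)[OF q g])
  qed
qed

section \<open>Integral operators with the reproducing kernel\<close>

text \<open>A Peetre type inequality: 1 + |z| \<le> (1 + |z - w|)(1 + |w|), and with z and w
  exchanged for negative exponents.\<close>

lemma one_plus_norm_powr_le:
  fixes z w :: "'a::real_normed_vector"
  shows "(1 + norm z) powr a \<le> (1 + norm (z - w)) powr \<bar>a\<bar> * (1 + norm w) powr a"
proof -
  define d where "d = norm (z - w)"
  have tri: "norm z \<le> norm w + d" "norm w \<le> norm z + d" "d \<ge> 0"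
    using norm_triangle_sub[of z w] norm_triangle_sub[of w z] by (auto simp: d_def norm_minus_commute)
  have le: "1 + norm z \<le> (1 + d) * (1 + norm w)" "1 + norm w \<le> (1 + d) * (1 + norm z)"
  proof -
    have e: "(1 + d) * (1 + x) = 1 + x + d + d * x" for x by (simp add: algebra_simps)
    have "0 \<le> d * norm w" "0 \<le> d * norm z" using tri(3) by simp_all
    then show "1 + norm z \<le> (1 + d) * (1 + norm w)" "1 + norm w \<le> (1 + d) * (1 + norm z)"
      unfolding e using tri by linarith+
  qed
  show ?thesis
  proof (cases "a \<ge> 0")
    case True
    have "(1 + norm z) powr a \<le> ((1 + d) * (1 + norm w)) powr a"
      using le True by (intro powr_mono2) auto
    then show ?thesis using True by (simp add: powr_mult d_def)
  next
    case False
    have d: "1 + d > 0" using tri by simp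
    have "(1 + norm z) powr a \<le> ((1 + norm w) / (1 + d)) powr a"
    proof (rule powr_mono2')
      show "0 < (1 + norm w) / (1 + d)" using d by (simp add: add_pos_nonneg)
      show "(1 + norm w) / (1 + d) \<le> 1 + norm z" using le(2) d by (simp add: field_simps)
    qed (use False in simp)
    also have "\<dots> = (1 + d) powr \<bar>a\<bar> * (1 + norm w) powr a"
      using False d powr_minus_divide[of "1 + d" a] by (simp add: powr_divide)
    finally show ?thesis by (simp add: d_def)
  qed
qed

lemma powr_exp_eighth_le:
  fixes x a :: real
  assumes "x \<ge> 0"
  shows "(1 + x) powr \<bar>a\<bar> * exp (- x\<^sup>2 / 8) \<le> exp (4 * a\<^sup>2) * exp (- x\<^sup>2 / 16)"
proof -
  have "(1 + x) powr \<bar>a\<bar> * exp (- x\<^sup>2 / 8) \<le> exp (\<bar>a\<bar> * x) * exp (- x\<^sup>2 / 8)"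
    using powr_le_exp[OF assms, of "\<bar>a\<bar>"] by (intro mult_right_mono) auto
  also have "\<dots> = exp (\<bar>a\<bar> * x - 1 / 8 * x\<^sup>2)" by (simp flip: exp_add)
  also have "\<dots> \<le> exp (\<bar>a\<bar>\<^sup>2 / (2 * (1 / 8)) - 1 / 8 / 2 * x\<^sup>2)"
    using linear_minus_square_le[of "1/8" "\<bar>a\<bar>" x] by simp
  also have "\<dots> = exp (4 * a\<^sup>2) * exp (- x\<^sup>2 / 16)" by (simp flip: exp_add)
  finally show ?thesis .
qed

text \<open>An unnormalised Gaussian. The rate 1/16 is what remains of the rate 1/8 in the kernel
  estimate after a power of 1 + |z - w| has been absorbed.\<close>

definition heat :: "complex ^ 'n::finite \<Rightarrow> real" where
  "heat u = exp (- (norm u)\<^sup>2 / 16)"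

lemma heat_pos: "heat u > 0" and heat_le_1: "heat u \<le> 1"
  by (simp_all add: heat_def)

lemma heat_measurable [measurable]: "heat \<in> borel_measurable borel"
  unfolding heat_def[abs_def] by measurable

lemma heat_minus_commute: "heat (z - w) = heat (w - z)"
  by (simp add: heat_def norm_minus_commute)

lemma integrable_heat: "integrable dV (heat :: complex ^ 'n::finite \<Rightarrow> real)"
  using integrable_gaussian[of "1/16"] by (simp add: heat_def[abs_def])

lemma nn_integral_heat_translate:
  "(\<integral>\<^sup>+z. ennreal (heat (z - w)) \<partial>(dV :: (complex ^ 'n::finite) measure)) = ennreal (LINT z|(dV :: (complex ^ 'n) measure). heat z)"
proof -
  have "(\<integral>\<^sup>+z. ennreal (heat (z - w)) \<partial>(dV :: (complex ^ 'n) measure)) = (\<integral>\<^sup>+z. ennreal (heat z) \<partial>(dV :: (complex ^ 'n) measure))"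
    using nn_integral_dV_translation[of "\<lambda>z. ennreal (heat z)" "- w"] by simp
  also have "\<dots> = ennreal (LINT z|(dV :: (complex ^ 'n) measure). heat z)"
    by (rule nn_integral_eq_integral[OF integrable_heat]) (simp add: heat_pos less_imp_le)
  finally show ?thesis .
qed

lemma has_bochner_integral_heat:
  "has_bochner_integral (dV :: (complex ^ 'n::finite) measure) (\<lambda>w. heat (z - w)) (LINT z|(dV :: (complex ^ 'n) measure). heat z)"
  unfolding heat_minus_commute[of z]
  by (rule has_bochner_integral_nn_integral)
    (auto simp: nn_integral_heat_translate heat_pos less_imp_le intro!: integral_nonneg_AE)

text \<open>Young's inequality for the convolution of L^p with an integrable function. Writing heat
  as heat^(1/p) heat^(1/q), Holder's inequality bounds the p-th power of the convolution by a
  multiple of the convolution of \<Phi>^p, whose integral is computed by Fubini.\<close>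

lemma heat_convolution:
  fixes \<Phi> :: "complex ^ 'n::finite \<Rightarrow> real"
  assumes p: "1 < p" "1 / p + 1 / q = 1" and [measurable]: "\<Phi> \<in> borel_measurable borel"
    and \<Phi>: "\<And>w. \<Phi> w \<ge> 0" "integrable dV (\<lambda>w. \<Phi> w powr p)"
  defines "h \<equiv> LINT z|(dV :: (complex ^ 'n) measure). heat z"
  shows "integrable dV (\<lambda>w. \<Phi> w * heat (z - w))"
    and "integrable dV (\<lambda>z. (LINT w|dV. \<Phi> w * heat (z - w)) powr p)"
    and "(LINT z|dV. (LINT w|dV. \<Phi> w * heat (z - w)) powr p) \<le> h powr (p / q) * h * (LINT w|dV. \<Phi> w powr p)"
proof -
  have q: "1 < q" using conjugate_exponents[OF p] by blast
  have h0: "h \<ge> 0" unfolding h_def by (intro integral_nonneg_AE) (simp add: heat_pos less_imp_le)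
  define J where "J z = (LINT w|dV. \<Phi> w powr p * heat (z - w))" for z
  define M where "M z = (LINT w|dV. \<Phi> w * heat (z - w))" for z
  have Jint: "integrable dV (\<lambda>w. \<Phi> w powr p * heat (z - w))" for z
    by (rule Bochner_Integration.integrable_bound[OF \<Phi>(2)])
      (auto simp: abs_mult heat_pos less_imp_le heat_le_1 mult_left_le)
  have main: "integrable dV (\<lambda>w. \<Phi> w * heat (z - w)) \<and> M z \<le> J z powr (1 / p) * h powr (1 / q)" for z
  proof -
    define F G where "F w = \<Phi> w * heat (z - w) powr (1 / p)" "G w = heat (z - w) powr (1 / q)" for w
    have [measurable]: "F \<in> borel_measurable dV" "G \<in> borel_measurable dV" unfolding F_G_def by measurable
    have F: "F w powr p = \<Phi> w powr p * heat (z - w)" for w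
      using p \<Phi>(1)[of w] heat_pos[of "z - w"] by (simp add: F_G_def powr_mult powr_powr)
    have G: "G w powr q = heat (z - w)" for w
      using q heat_pos[of "z - w"] by (simp add: F_G_def powr_powr)
    have FG: "F w * G w = \<Phi> w * heat (z - w)" for w
    proof -
      have "heat (z - w) powr (1 / p) * heat (z - w) powr (1 / q) = heat (z - w)"
        by (simp only: powr_add[symmetric] p(2)) (simp add: heat_pos less_imp_le)
      then show ?thesis by (simp add: F_G_def mult.assoc)
    qed
    have FG0: "F w \<ge> 0" "G w \<ge> 0" for w using \<Phi>(1) by (simp_all add: F_G_def)
    have int: "integrable dV (\<lambda>w. F w powr p)" "integrable dV (\<lambda>w. G w powr q)"
      unfolding F G using Jint has_bochner_integral_heat[of z] by (auto simp: has_bochner_integral_iff)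
    have "F \<in> borel_measurable dV" "G \<in> borel_measurable dV" by measurable
    note H = Holder_inequality_integral[OF p this FG0(1) int(1) FG0(2) int(2)]
    show ?thesis
      using H has_bochner_integral_heat[of z] unfolding F G FG
      by (simp add: J_def M_def h_def has_bochner_integral_iff)
  qed
  show "integrable dV (\<lambda>w. \<Phi> w * heat (z - w))" using main by blast
  have M0: "M z \<ge> 0" for z unfolding M_def using \<Phi>(1) by (intro integral_nonneg_AE) (simp add: heat_pos less_imp_le)
  have J0: "J z \<ge> 0" for z unfolding J_def by (intro integral_nonneg_AE) (simp add: heat_pos less_imp_le)
  have [measurable]: "M \<in> borel_measurable borel" "J \<in> borel_measurable borel"
    unfolding M_def J_def by measurable
  have Mp: "M z powr p \<le> h powr (p / q) * J z" for z
  proof -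
    have "M z powr p \<le> (J z powr (1 / p) * h powr (1 / q)) powr p"
      using main M0 p by (intro powr_mono2) auto
    then show ?thesis using p J0 h0 by (simp add: powr_mult powr_powr mult.commute)
  qed
  have "(\<integral>\<^sup>+z. ennreal (J z) \<partial>dV) = (\<integral>\<^sup>+z. (\<integral>\<^sup>+w. ennreal (\<Phi> w powr p) * ennreal (heat (z - w)) \<partial>dV) \<partial>dV)"
    unfolding J_def using Jint
    by (intro nn_integral_cong, subst nn_integral_eq_integral[symmetric])
      (auto simp: ennreal_mult heat_pos less_imp_le)
  also have "\<dots> = (\<integral>\<^sup>+w. (\<integral>\<^sup>+z. ennreal (\<Phi> w powr p) * ennreal (heat (z - w)) \<partial>dV) \<partial>dV)"
    by (rule dV_pair.Fubini') measurable
  also have "\<dots> = (\<integral>\<^sup>+w. ennreal (\<Phi> w powr p) * ennreal h \<partial>dV)"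
    by (intro nn_integral_cong, subst nn_integral_cmult) (auto simp: nn_integral_heat_translate h_def)
  also have "\<dots> = ennreal (LINT w|dV. \<Phi> w powr p) * ennreal h"
    using \<Phi>(2) by (subst nn_integral_multc) (auto simp: nn_integral_eq_integral)
  also have "\<dots> = ennreal (h * (LINT w|dV. \<Phi> w powr p))"
    using h0 by (simp add: ennreal_mult' mult.commute)
  finally have J: "has_bochner_integral dV J (h * (LINT w|dV. \<Phi> w powr p))"
    using J0 h0 by (intro has_bochner_integral_nn_integral) (auto intro!: mult_nonneg_nonneg integral_nonneg_AE)
  have intM: "integrable dV (\<lambda>z. M z powr p)"
    by (rule Bochner_Integration.integrable_bound[of _ "\<lambda>z. h powr (p / q) * J z"])
      (use J Mp order_trans[OF Mp abs_ge_self] in \<open>auto simp: has_bochner_integral_iff\<close>)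
  then show "integrable dV (\<lambda>z. (LINT w|dV. \<Phi> w * heat (z - w)) powr p)" by (simp add: M_def)
  have "(LINT z|dV. M z powr p) \<le> (LINT z|dV. h powr (p / q) * J z)"
    using intM J Mp by (intro integral_mono) (auto simp: has_bochner_integral_iff)
  then show "(LINT z|dV. (LINT w|dV. \<Phi> w * heat (z - w)) powr p) \<le> h powr (p / q) * h * (LINT w|dV. \<Phi> w powr p)"
    using J by (simp add: M_def has_bochner_integral_iff mult.assoc)
qed

lemma kernel_measurable [measurable]: "kernel N n s \<in> borel_measurable borel"
  unfolding kernel_def[abs_def] by measurable

text \<open>There is no Gaussian in the integrand; it is part of \<psi>, as are the cutoffs to
  balls.\<close>

definition kernel_op :: "nat \<Rightarrow> real \<Rightarrow> (complex ^ 'n::finite \<Rightarrow> complex) \<Rightarrow> complex ^ 'n \<Rightarrow> complex" where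
  "kernel_op N s \<psi> z = (LINT w|dV. \<psi> w * kernel N CARD('n) s (hinner z w))"

text \<open>After multiplication by the weight in z, the kernel estimate contains (1 + |w|)^s (1 +
  |z|)^(s - \<alpha>). The Peetre inequality turns z into w in the second factor, and s + (s -
  \<alpha>) = \<beta>; what remains is a convolution with \<open>heat\<close>. That the image is
  entire is a hypothesis, established separately for each \<psi> to which the bound is
  applied.\<close>

lemma kernel_op_bound:
  assumes p: "1 < p" "1 / p + 1 / q = 1" and N: "(\<alpha> + \<beta>) / 2 < real (CARD('n::finite) + N)"
  obtains C where "C \<ge> 0" "\<And>(\<psi> :: complex ^ 'n \<Rightarrow> complex) z. \<psi> \<in> borel_measurable borel \<Longrightarrow>
      integrable dV (\<lambda>w. (cmod (\<psi> w) * (1 + norm w) powr \<beta> * exp ((norm w)\<^sup>2 / 2)) powr p) \<Longrightarrow>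
      integrable dV (\<lambda>w. \<psi> w * kernel N CARD('n) ((\<alpha> + \<beta>) / 2) (hinner z w))"
    "\<And>\<psi> :: complex ^ 'n \<Rightarrow> complex. \<psi> \<in> borel_measurable borel \<Longrightarrow>
      integrable dV (\<lambda>w. (cmod (\<psi> w) * (1 + norm w) powr \<beta> * exp ((norm w)\<^sup>2 / 2)) powr p) \<Longrightarrow>
      entire (kernel_op N ((\<alpha> + \<beta>) / 2) \<psi>) \<Longrightarrow>
      kernel_op N ((\<alpha> + \<beta>) / 2) \<psi> \<in> fock_space (\<alpha> * p) p \<and>
      fock_norm (\<alpha> * p) p (kernel_op N ((\<alpha> + \<beta>) / 2) \<psi>)
        \<le> C * (LINT w|dV. (cmod (\<psi> w) * (1 + norm w) powr \<beta> * exp ((norm w)\<^sup>2 / 2)) powr p) powr (1 / p)"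
proof -
  define s where "s = (\<alpha> + \<beta>) / 2"
  define K where "K z w = kernel N CARD('n) s (hinner z w)" for z w :: "complex ^ 'n"
  obtain C0 where C0: "C0 \<ge> 0" "\<And>z w :: complex ^ 'n. cmod (K z w)
    \<le> C0 * ((1 + norm z) powr s * (1 + norm w) powr s) * exp ((norm z)\<^sup>2 / 2 + (norm w)\<^sup>2 / 2 - (norm (z - w))\<^sup>2 / 8)"
    using kernel_bound[of s N, where 'n='n] N unfolding K_def s_def by blast
  define C1 where "C1 = C0 * exp (4 * (s - \<alpha>)\<^sup>2)"
  have C1: "C1 \<ge> 0" using C0(1) by (simp add: C1_def)
  define u where "u z = exp (- (norm z)\<^sup>2 / 2) * (1 + norm z) powr (- \<alpha>)" for z :: "complex ^ 'n"
  define v where "v w = (1 + norm w) powr \<beta> * exp ((norm w)\<^sup>2 / 2)" for w :: "complex ^ 'n"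
  have u0: "u z > 0" for z unfolding u_def by (intro mult_pos_pos) (auto simp: add_nonneg_eq_0_iff)
  have pt: "cmod (K z w) * u z \<le> C1 * (v w * heat (z - w))" for z w
  proof -
    have "cmod (K z w) * u z \<le> (C0 * ((1 + norm z) powr s * (1 + norm w) powr s) * exp ((norm z)\<^sup>2 / 2 + (norm w)\<^sup>2 / 2 - (norm (z - w))\<^sup>2 / 8)) * u z"
      using C0(2) u0[of z] by (intro mult_right_mono) (auto intro: less_imp_le)
    also have "\<dots> = C0 * (1 + norm w) powr s * ((1 + norm z) powr s * (1 + norm z) powr (- \<alpha>)) *
        (exp ((norm z)\<^sup>2 / 2 + (norm w)\<^sup>2 / 2 - (norm (z - w))\<^sup>2 / 8) * exp (- (norm z)\<^sup>2 / 2))"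
      by (simp only: u_def mult_ac)
    also have "exp ((norm z)\<^sup>2 / 2 + (norm w)\<^sup>2 / 2 - (norm (z - w))\<^sup>2 / 8) * exp (- (norm z)\<^sup>2 / 2) = exp ((norm w)\<^sup>2 / 2) * exp (- (norm (z - w))\<^sup>2 / 8)"
      by (simp flip: exp_add)
    also have "(1 + norm z) powr s * (1 + norm z) powr (- \<alpha>) = (1 + norm z) powr (s - \<alpha>)"
      by (simp flip: powr_add)
    also have "C0 * (1 + norm w) powr s * (1 + norm z) powr (s - \<alpha>) * (exp ((norm w)\<^sup>2 / 2) * exp (- (norm (z - w))\<^sup>2 / 8))
        \<le> C0 * (1 + norm w) powr s * ((1 + norm (z - w)) powr \<bar>s - \<alpha>\<bar> * (1 + norm w) powr (s - \<alpha>)) * (exp ((norm w)\<^sup>2 / 2) * exp (- (norm (z - w))\<^sup>2 / 8))"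
      using C0(1) by (intro mult_right_mono mult_left_mono one_plus_norm_powr_le) auto
    also have "\<dots> = C0 * ((1 + norm w) powr s * (1 + norm w) powr (s - \<alpha>)) * exp ((norm w)\<^sup>2 / 2) * ((1 + norm (z - w)) powr \<bar>s - \<alpha>\<bar> * exp (- (norm (z - w))\<^sup>2 / 8))"
      by (simp only: mult_ac)
    also have "(1 + norm w) powr s * (1 + norm w) powr (s - \<alpha>) = (1 + norm w) powr \<beta>"
    proof -
      have "s + (s - \<alpha>) = \<beta>" by (simp add: s_def field_simps)
      then show ?thesis by (simp flip: powr_add)
    qed
    also have "C0 * (1 + norm w) powr \<beta> * exp ((norm w)\<^sup>2 / 2) * ((1 + norm (z - w)) powr \<bar>s - \<alpha>\<bar> * exp (- (norm (z - w))\<^sup>2 / 8))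
        \<le> C0 * (1 + norm w) powr \<beta> * exp ((norm w)\<^sup>2 / 2) * (exp (4 * (s - \<alpha>)\<^sup>2) * exp (- (norm (z - w))\<^sup>2 / 16))"
      using C0(1) by (intro mult_left_mono powr_exp_eighth_le) auto
    also have "\<dots> = C1 * (v w * heat (z - w))" by (simp only: C1_def v_def heat_def mult_ac)
    finally show ?thesis .
  qed
  define h where "h = (LINT z|(dV :: (complex ^ 'n) measure). heat z)"
  have h0: "h \<ge> 0" unfolding h_def by (intro integral_nonneg_AE) (simp add: heat_pos less_imp_le)
  define C where "C = C1 * (h powr (p / q) * h) powr (1 / p)"
  have C: "C \<ge> 0" using C1 by (simp add: C_def)
  have vt: "cmod (\<psi> w) * (1 + norm w) powr \<beta> * exp ((norm w)\<^sup>2 / 2) = cmod (\<psi> w) * v w" for \<psi> :: "complex ^ 'n \<Rightarrow> complex" and w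
    by (simp add: v_def)
  have int: "integrable dV (\<lambda>w. \<psi> w * K z w)" and bound: "cmod (LINT w|dV. \<psi> w * K z w) * u z \<le> C1 * (LINT w|dV. (cmod (\<psi> w) * v w) * heat (z - w))"
    if [measurable]: "\<psi> \<in> borel_measurable borel" and \<Phi>: "integrable dV (\<lambda>w. (cmod (\<psi> w) * v w) powr p)" for \<psi> z
  proof -
    have [measurable]: "v \<in> borel_measurable borel" "(\<lambda>w. K z w) \<in> borel_measurable borel"
      unfolding v_def K_def by measurable
    have conv: "integrable dV (\<lambda>w. (cmod (\<psi> w) * v w) * heat (z - w))"
      by (rule heat_convolution(1)[OF p _ _ \<Phi>]) (auto simp: v_def)
    have le: "cmod (\<psi> w * K z w) * u z \<le> C1 * ((cmod (\<psi> w) * v w) * heat (z - w))" for w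
      using mult_left_mono[OF pt[of z w], of "cmod (\<psi> w)"] by (simp add: norm_mult mult_ac)
    have le': "cmod (\<psi> w * K z w) \<le> C1 / u z * ((cmod (\<psi> w) * v w) * heat (z - w))" for w
      using le[of w] u0[of z] by (simp add: field_simps)
    show int: "integrable dV (\<lambda>w. \<psi> w * K z w)"
    proof (rule Bochner_Integration.integrable_bound)
      show "integrable dV (\<lambda>w. C1 / u z * ((cmod (\<psi> w) * v w) * heat (z - w)))" using conv by (rule integrable_mult_right)
      show "AE w in dV. cmod (\<psi> w * K z w) \<le> norm (C1 / u z * ((cmod (\<psi> w) * v w) * heat (z - w)))"
        using order_trans[OF le' abs_ge_self] by simp
    qed measurable
    have "cmod (LINT w|dV. \<psi> w * K z w) \<le> (LINT w|dV. C1 / u z * ((cmod (\<psi> w) * v w) * heat (z - w)))"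
      using int conv le' by (intro order_trans[OF integral_norm_bound] integral_mono integrable_mult_right integrable_norm) auto
    then show "cmod (LINT w|dV. \<psi> w * K z w) * u z \<le> C1 * (LINT w|dV. (cmod (\<psi> w) * v w) * heat (z - w))"
      using u0[of z] by (simp add: field_simps)
  qed
  show ?thesis
  proof (rule that[OF C], unfold vt)
    fix \<psi> :: "complex ^ 'n \<Rightarrow> complex" and z assume "\<psi> \<in> borel_measurable borel" "integrable dV (\<lambda>w. (cmod (\<psi> w) * v w) powr p)"
    from int[OF this, of z] show "integrable dV (\<lambda>w. \<psi> w * kernel N CARD('n) ((\<alpha> + \<beta>) / 2) (hinner z w))"
      by (simp add: K_def s_def)
  next
    fix \<psi> :: "complex ^ 'n \<Rightarrow> complex" assume \<psi>[measurable]: "\<psi> \<in> borel_measurable borel"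
      and \<Phi>: "integrable dV (\<lambda>w. (cmod (\<psi> w) * v w) powr p)" and ent: "entire (kernel_op N ((\<alpha> + \<beta>) / 2) \<psi>)"
    have [measurable]: "v \<in> borel_measurable borel" unfolding v_def by measurable
    define M where "M z = (LINT w|dV. (cmod (\<psi> w) * v w) * heat (z - w))" for z
    have meas: "(\<lambda>w. cmod (\<psi> w) * v w) \<in> borel_measurable borel" by measurable
    have nn: "cmod (\<psi> w) * v w \<ge> 0" for w by (simp add: v_def)
    note conv = heat_convolution(2,3)[OF p meas nn \<Phi>, folded M_def h_def]
    have M0: "M z \<ge> 0" for z unfolding M_def using nn by (intro integral_nonneg_AE) (simp add: heat_pos less_imp_le)
    have dom: "wmod \<alpha> (kernel_op N ((\<alpha> + \<beta>) / 2) \<psi>) z \<le> C1 * M z" for z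
      using bound[OF \<psi> \<Phi>, of z] by (simp add: wmod_def kernel_op_def K_def s_def M_def u_def mult.assoc)
    have eq: "(C1 * M z) powr p = C1 powr p * M z powr p" for z using C1 M0 by (simp add: powr_mult)
    have intM: "integrable dV (\<lambda>z. (C1 * M z) powr p)" unfolding eq using conv(1) by simp
    have p0: "p > 0" using p by simp
    note D = fock_space_dominated[OF p0 ent intM dom]
    have I0: "(LINT w|dV. (cmod (\<psi> w) * v w) powr p) \<ge> 0" "(LINT z|dV. M z powr p) \<ge> 0" by (auto intro!: integral_nonneg_AE)
    have "(LINT z|dV. (C1 * M z) powr p) powr (1 / p) = C1 * (LINT z|dV. M z powr p) powr (1 / p)"
      using C1 I0 p0 by (simp add: eq powr_mult powr_powr)
    also have "\<dots> \<le> C1 * (h powr (p / q) * h * (LINT w|dV. (cmod (\<psi> w) * v w) powr p)) powr (1 / p)"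
      using C1 conv(2) I0 p0 by (intro mult_left_mono powr_mono2) auto
    also have "\<dots> = C * (LINT w|dV. (cmod (\<psi> w) * v w) powr p) powr (1 / p)"
      using h0 I0 by (simp add: C_def powr_mult)
    finally show "kernel_op N ((\<alpha> + \<beta>) / 2) \<psi> \<in> fock_space (\<alpha> * p) p \<and>
      fock_norm (\<alpha> * p) p (kernel_op N ((\<alpha> + \<beta>) / 2) \<psi>) \<le> C * (LINT w|dV. (cmod (\<psi> w) * v w) powr p) powr (1 / p)"
      using D by (auto intro: order_trans)
  qed
qed

section \<open>Bounded functionals\<close>

lemma bounded_functionalE:
  assumes "bounded_functional a p \<Lambda>"
  obtains B where "B \<ge> 0" "\<And>f. f \<in> fock_space a p \<Longrightarrow> cmod (\<Lambda> f) \<le> B * fock_norm a p f"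
proof -
  obtain B where B: "\<And>f. f \<in> fock_space a p \<Longrightarrow> cmod (\<Lambda> f) \<le> B * fock_norm a p f"
    using assms unfolding bounded_functional_def by blast
  show ?thesis
  proof (rule that[of "max B 0"])
    fix f :: "complex ^ 'a \<Rightarrow> complex" assume "f \<in> fock_space a p"
    then have "cmod (\<Lambda> f) \<le> B * fock_norm a p f" by (rule B)
    also have "\<dots> \<le> max B 0 * fock_norm a p f" by (intro mult_right_mono fock_norm_nonneg) simp
    finally show "cmod (\<Lambda> f) \<le> max B 0 * fock_norm a p f" .
  qed simp
qed

lemma bounded_functional_add: "bounded_functional a p \<Lambda> \<Longrightarrow> f \<in> fock_space a p \<Longrightarrow> h \<in> fock_space a p \<Longrightarrow>
    \<Lambda> (\<lambda>z. f z + h z) = \<Lambda> f + \<Lambda> h"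
  and bounded_functional_cmult: "bounded_functional a p \<Lambda> \<Longrightarrow> f \<in> fock_space a p \<Longrightarrow> \<Lambda> (\<lambda>z. c * f z) = c * \<Lambda> f"
  unfolding bounded_functional_def by blast+

lemma bounded_functional_diff:
  assumes p: "p > 1" and L: "bounded_functional (\<alpha> * p) p \<Lambda>" and f: "f \<in> fock_space (\<alpha> * p) p" and h: "h \<in> fock_space (\<alpha> * p) p"
  shows "\<Lambda> (\<lambda>z. f z - h z) = \<Lambda> f - \<Lambda> h"
  using bounded_functional_add[OF L f fock_space_cmult(1)[OF _ h, of "-1"]] bounded_functional_cmult[OF L h, of "-1"] p by simp

lemma bounded_functional_sum:
  assumes p: "p > 1" and L: "bounded_functional (\<alpha> * p) p \<Lambda>" and f: "\<And>i. i \<in> A \<Longrightarrow> f i \<in> fock_space (\<alpha> * p) p"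
    and fin: "finite A"
  shows "\<Lambda> (\<lambda>z. \<Sum>i\<in>A. c i * f i z) = (\<Sum>i\<in>A. c i * \<Lambda> (f i))"
  using fin f
proof (induction A)
  case empty
  have z: "(\<lambda>z. 0) \<in> fock_space (\<alpha> * p) p" using p by (simp add: fock_space_zero)
  show ?case using bounded_functional_cmult[OF L z, of 0] by simp
next
  case (insert i A)
  have m: "(\<lambda>z. c i * f i z) \<in> fock_space (\<alpha> * p) p" "(\<lambda>z. \<Sum>i\<in>A. c i * f i z) \<in> fock_space (\<alpha> * p) p"
    using insert p by (auto intro!: fock_space_sum fock_space_cmult)
  show ?case
    using insert bounded_functional_add[OF L m] bounded_functional_cmult[OF L, of "f i" "c i"] by simp
qed

text \<open>A uniform exponential bound on the partial sums makes the series converge in norm.\<close>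

lemma bounded_functional_sums:
  fixes f :: "nat \<Rightarrow> complex ^ 'n::finite \<Rightarrow> complex"
  assumes p: "p > 1" and L: "bounded_functional (\<alpha> * p) p \<Lambda>"
    and ent: "\<And>k. entire (f k)" "entire F" and sums: "\<And>z. (\<lambda>k. f k z) sums F z"
    and bound: "\<And>k z. cmod (f k z) \<le> b k z" "\<And>z. (\<lambda>k. b k z) sums (A * exp (D * norm z))"
  shows "F \<in> fock_space (\<alpha> * p) p" and "(\<lambda>k. \<Lambda> (f k)) sums \<Lambda> F"
proof -
  have p0: "p > 0" using p by simp
  have b0: "b k z \<ge> 0" for k z using bound(1)[of k z] norm_ge_zero order_trans by blast
  have part: "(\<Sum>k<M. b k z) \<le> A * exp (D * norm z)" for M z
    using sum_le_suminf[of "\<lambda>k. b k z" "{..<M}"] bound(2)[of z] b0 by (simp add: sums_iff)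
  have fS: "cmod (\<Sum>k<M. f k z) \<le> A * exp (D * norm z)" for M z
    using order_trans[OF order_trans[OF norm_sum sum_mono[OF bound(1)]] part] .
  have fk: "cmod (f k z) \<le> A * exp (D * norm z)" for k z
    using bound(1)[of k z] part[where M = "Suc k" and z = z] sum_nonneg[of "{..<k}" "\<lambda>k. b k z"] b0 by fastforce
  have fF: "cmod (F z) \<le> A * exp (D * norm z)" for z
    using sums[of z] fS[where z = z] unfolding sums_def
    by (intro tendsto_upperbound[OF tendsto_norm]) (auto simp: eventually_sequentially)
  show F: "F \<in> fock_space (\<alpha> * p) p" by (rule fock_space_exp_type(1)[OF p0 ent(2) fF])
  have k: "f k \<in> fock_space (\<alpha> * p) p" for k by (rule fock_space_exp_type(1)[OF p0 ent(1) fk])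
  have S: "(\<lambda>z. \<Sum>k<M. f k z) \<in> fock_space (\<alpha> * p) p" for M by (intro fock_space_sum p k)
  obtain B where B: "B \<ge> 0" "\<And>f. f \<in> fock_space (\<alpha> * p) p \<Longrightarrow> cmod (\<Lambda> f) \<le> B * fock_norm (\<alpha> * p) p f"
    using bounded_functionalE[OF L] by blast
  define R where "R M z = F z - (\<Sum>k<M. f k z)" for M z
  have R: "R M \<in> fock_space (\<alpha> * p) p" for M unfolding R_def[abs_def] by (intro fock_space_diff p F S)
  define u where "u z = exp (D * norm z) * exp (- (norm z)\<^sup>2 / 2) * (1 + norm z) powr (- \<alpha>)" for z :: "complex ^ 'n"
  have Ru: "wmod \<alpha> (R M) z \<le> 2 * \<bar>A\<bar> * u z" for M z
  proof -
    have "cmod (R M z) \<le> A * exp (D * norm z) + A * exp (D * norm z)"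
      unfolding R_def by (rule order_trans[OF norm_triangle_ineq4]) (intro add_mono fF fS)
    also have "\<dots> \<le> 2 * \<bar>A\<bar> * exp (D * norm z)" by (simp add: mult_right_mono)
    finally show ?thesis unfolding wmod_def u_def mult.assoc[symmetric] by (intro mult_right_mono) auto
  qed
  have "(\<lambda>M. LINT z|dV. wmod \<alpha> (R M) z powr p) \<longlonglongrightarrow> (LINT z|(dV :: (complex ^ 'n) measure). 0)"
  proof (rule integral_dominated_convergence[where w="\<lambda>z. (2 * \<bar>A\<bar> * u z) powr p"])
    show "(\<lambda>z. wmod \<alpha> (R M) z powr p) \<in> borel_measurable dV" for M
      using R[of M] by (auto simp: fock_space_iff)
    have eq: "(2 * \<bar>A\<bar> * u z) powr p = (2 * \<bar>A\<bar>) powr p * u z powr p" for z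
      by (simp add: powr_mult u_def)
    show "integrable dV (\<lambda>z. (2 * \<bar>A\<bar> * u z) powr p)"
      unfolding eq unfolding u_def by (intro integrable_mult_right integrable_exp_weight p0)
    show "AE z in dV. norm (wmod \<alpha> (R M) z powr p) \<le> (2 * \<bar>A\<bar> * u z) powr p" for M
      using Ru p0 by (auto intro!: powr_mono2 wmod_nonneg)
    have "(\<lambda>M. wmod \<alpha> (R M) z powr p) \<longlonglongrightarrow> 0" for z
    proof (rule tendsto_zero_powrI[OF _ tendsto_const])
      have "(\<lambda>M. R M z) \<longlonglongrightarrow> F z - F z"
        unfolding R_def using sums[of z] by (intro tendsto_diff tendsto_const) (simp add: sums_def)
      then have "(\<lambda>M. cmod (R M z) * exp (- (norm z)\<^sup>2 / 2) * (1 + norm z) powr (- \<alpha>)) \<longlonglongrightarrow> cmod (F z - F z) * exp (- (norm z)\<^sup>2 / 2) * (1 + norm z) powr (- \<alpha>)"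
        by (intro tendsto_mult tendsto_const tendsto_norm)
      then show "(\<lambda>M. wmod \<alpha> (R M) z) \<longlonglongrightarrow> 0" by (simp add: wmod_def)
    qed (simp_all add: wmod_nonneg p0)
    then show "AE z in dV. (\<lambda>M. wmod \<alpha> (R M) z powr p) \<longlonglongrightarrow> 0" by simp
  qed simp
  then have "(\<lambda>M. fock_norm (\<alpha> * p) p (R M)) \<longlonglongrightarrow> 0"
    unfolding fock_norm_eq using p0 by (intro tendsto_zero_powrI[OF _ tendsto_const]) (auto intro!: integral_nonneg_AE)
  then have lim: "(\<lambda>M. B * fock_norm (\<alpha> * p) p (R M)) \<longlonglongrightarrow> 0"
    using tendsto_mult_right_zero by blast
  have "(\<lambda>M. \<Lambda> (R M)) \<longlonglongrightarrow> 0"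
    by (rule Lim_null_comparison[OF always_eventually lim]) (use B(2)[OF R] in blast)
  moreover have "\<Lambda> (R M) = \<Lambda> F - (\<Sum>k<M. \<Lambda> (f k))" for M
    using bounded_functional_diff[OF p L F S[of M]] bounded_functional_sum[OF p L, of "{..<M}" f "\<lambda>_. 1"] k
    by (simp add: R_def[abs_def])
  ultimately have "(\<lambda>M. \<Lambda> F - (\<Lambda> F - (\<Sum>k<M. \<Lambda> (f k)))) \<longlonglongrightarrow> \<Lambda> F - 0"
    by (intro tendsto_diff tendsto_const) simp
  then show "(\<lambda>k. \<Lambda> (f k)) sums \<Lambda> F" by (simp add: sums_def)
qed

lemma monomial_in_fock_space:
  assumes "p > 0"
  shows "monomial m \<in> fock_space (\<alpha> * p) p"
proof (rule fock_space_exp_type(1)[OF assms entire_monomial])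
  show "cmod (monomial m z) \<le> fact (\<Sum>i\<in>UNIV. m i) * exp (1 * norm z)" for z
    using norm_monomial_le[of m z] power_le_fact_exp[OF norm_ge_zero, of z "\<Sum>i\<in>UNIV. m i"] by simp
qed

text \<open>This moves \<Lambda> under the integral over w. In each degree the power separates into
  finitely many monomials, so linearity suffices; the sum over the degrees is then a single limit,
  justified by \<open>bounded_functional_sums\<close>. Integrals with values in the Fock space are
  thereby avoided.\<close>

lemma functional_kernel_op:
  fixes \<psi> :: "complex ^ 'n::finite \<Rightarrow> complex"
  assumes p: "p > 1" and s: "s < real (CARD('n) + N)" and L: "bounded_functional (\<alpha> * p) p \<Lambda>"
    and \<psi>[measurable]: "\<psi> \<in> borel_measurable borel"
    and bdd: "\<And>w. norm w \<le> R \<Longrightarrow> cmod (\<psi> w) \<le> B" "\<And>w. norm w > R \<Longrightarrow> \<psi> w = 0" and R: "R > 0"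
  shows "entire (kernel_op N s \<psi>)" and "kernel_op N s \<psi> \<in> fock_space (\<alpha> * p) p"
    and "(\<lambda>k. of_real (kernel_coeff N CARD('n) s k) / fact k * (LINT w|dV. \<psi> w * \<Lambda> (\<lambda>z. hinner z w ^ k))) sums \<Lambda> (kernel_op N s \<psi>)"
proof -
  have p0: "p > 0" using p by simp
  define a where "a k = kernel_coeff N CARD('n) s k" for k
  have a0: "a k > 0" for k unfolding a_def by (rule kernel_coeff_pos[OF _ s]) simp
  obtain C where C: "C \<ge> 0" "\<And>k. a k \<le> C * exp 1 ^ k"
    unfolding a_def by (rule kernel_coeff_bound[OF _ s]) auto
  have int\<psi>: "integrable dV \<psi>" by (rule integrable_dV_bounded_support[OF \<psi> bdd])
  define K0 where "K0 = (LINT w|dV. cmod (\<psi> w))"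
  have K0: "K0 \<ge> 0" by (simp add: K0_def)
  have hb: "cmod (\<psi> w * hinner z w ^ k) \<le> (norm z * R) ^ k * cmod (\<psi> w)" for z w k
  proof (cases "norm w \<le> R")
    case True
    have "cmod (hinner z w) \<le> norm z * R"
      using norm_hinner_le[of z w] mult_left_mono[OF True norm_ge_zero[of z]] by linarith
    then have "cmod (hinner z w ^ k) \<le> (norm z * R) ^ k" unfolding norm_power by (intro power_mono) auto
    then show ?thesis by (simp add: norm_mult mult.commute mult_left_mono)
  qed (simp add: bdd)
  have inth: "integrable dV (\<lambda>w. \<psi> w * hinner z w ^ k)" for z k
    by (rule Bochner_Integration.integrable_bound[of _ "\<lambda>w. (norm z * R) ^ k * cmod (\<psi> w)"])
      (use int\<psi> hb R in \<open>auto simp: abs_mult\<close>)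
  define f where "f k z = of_real (a k) / fact k * (LINT w|dV. \<psi> w * hinner z w ^ k)" for k z
  \<comment> \<open>The exponential type: |<z,w>| \<le> R |z| on the support of \<psi>, and the
    coefficients contribute e^k.\<close>
  define D where "D = exp 1 * R"
  have normI: "(LINT w|dV. cmod (\<psi> w * hinner z w ^ k)) \<le> (norm z * R) ^ k * K0" for z k
  proof -
    have "(LINT w|dV. cmod (\<psi> w * hinner z w ^ k)) \<le> (LINT w|dV. (norm z * R) ^ k * cmod (\<psi> w))"
      using inth int\<psi> hb by (intro integral_mono) auto
    then show ?thesis by (simp add: K0_def)
  qed
  define b where "b k z = K0 * C * ((D * norm z) ^ k / fact k)" for k and z :: "complex ^ 'n"
  have ab: "a k / fact k * ((norm z * R) ^ k * K0) \<le> b k z" for k z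
  proof -
    have "a k / fact k * ((norm z * R) ^ k * K0) \<le> (C * exp 1 ^ k) / fact k * ((norm z * R) ^ k * K0)"
      using C(2) K0 R by (intro mult_right_mono divide_right_mono) auto
    then show ?thesis by (simp add: b_def D_def power_mult_distrib mult_ac)
  qed
  have fb: "cmod (f k z) \<le> b k z" for k z
  proof -
    have "cmod (f k z) \<le> a k / fact k * ((norm z * R) ^ k * K0)"
    proof -
      have n: "cmod (of_real (a k) / fact k) = a k / fact k" using a0[of k] by (simp add: norm_divide)
      show ?thesis
        unfolding f_def norm_mult n using a0[of k]
        by (intro mult_left_mono order_trans[OF integral_norm_bound normI]) simp
    qed
    then show ?thesis using ab[of k z] by linarith
  qed
  have bsums: "(\<lambda>k. b k z) sums (K0 * C * exp (D * norm z))" for z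
    unfolding b_def using exp_converges[of "D * norm z"]
    by (intro sums_mult) (simp add: divide_inverse mult.commute)
  obtain c where c: "\<And>k z w. hinner z w ^ k = (\<Sum>m | (\<Sum>i\<in>UNIV. m i) = k. c k m * monomial m z * cnj (monomial m (w :: complex ^ 'n)))"
  proof -
    have "\<exists>C. \<forall>z w :: complex ^ 'n. hinner z w ^ k = (\<Sum>m | (\<Sum>i\<in>UNIV. m i) = k. C m * monomial m z * cnj (monomial m w))" for k
    proof -
      obtain C where "\<And>z w :: complex ^ 'n. hinner z w ^ k = (\<Sum>m | (\<Sum>i\<in>UNIV. m i) = k. C m * monomial m z * cnj (monomial m w))"
        using hinner_power_eq_monomials by blast
      then show ?thesis by (intro exI[of _ C] allI)
    qed
    then have "\<exists>c. \<forall>k. \<forall>z w :: complex ^ 'n. hinner z w ^ k = (\<Sum>m | (\<Sum>i\<in>UNIV. m i) = k. c k m * monomial m z * cnj (monomial m w))"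
      by (intro choice allI)
    then show ?thesis using that by (elim exE) simp
  qed
  define I where "I m = (LINT w|dV. \<psi> w * cnj (monomial m w))" for m
  have intm: "integrable dV (\<lambda>w. \<psi> w * cnj (monomial m w))" for m
  proof -
    note [measurable] = entire_measurable[OF entire_monomial]
    obtain M where M: "M \<ge> 0" "\<And>w. norm w \<le> R \<Longrightarrow> cmod (monomial m w) \<le> M"
      using entire_bounded_on_ball[OF entire_monomial] by blast
    have B: "B \<ge> 0" using bdd(1)[of 0] R norm_ge_zero[of "\<psi> 0"] by (auto simp del: norm_ge_zero)
    show ?thesis
      by (rule integrable_dV_bounded_support[of _ R "B * M"])
        (use bdd M B in \<open>auto simp: norm_mult intro!: mult_mono\<close>)
  qed
  have If: "(LINT w|dV. \<psi> w * hinner z w ^ k) = (\<Sum>m | (\<Sum>i\<in>UNIV. m i) = k. (c k m * I m) * monomial m z)" for k z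
  proof -
    have "(LINT w|dV. \<psi> w * hinner z w ^ k) = (LINT w|dV. (\<Sum>m | (\<Sum>i\<in>UNIV. m i) = k. (c k m * monomial m z) * (\<psi> w * cnj (monomial m w))))"
      by (intro Bochner_Integration.integral_cong refl) (simp add: c sum_distrib_left mult_ac)
    also have "\<dots> = (\<Sum>m | (\<Sum>i\<in>UNIV. m i) = k. (c k m * monomial m z) * I m)"
      unfolding I_def using intm by (subst Bochner_Integration.integral_sum) auto
    finally show ?thesis by (simp add: mult_ac)
  qed
  have mF: "monomial m \<in> fock_space (\<alpha> * p) p" for m using p0 by (rule monomial_in_fock_space)
  have \<Lambda>f: "\<Lambda> (f k) = of_real (a k) / fact k * (LINT w|dV. \<psi> w * \<Lambda> (\<lambda>z. hinner z w ^ k))" for k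
  proof -
    have fin: "finite {m :: 'n \<Rightarrow> nat. (\<Sum>i\<in>UNIV. m i) = k}" by (rule finite_multi_indices)
    have "f k = (\<lambda>z. \<Sum>m | (\<Sum>i\<in>UNIV. m i) = k. (of_real (a k) / fact k * (c k m * I m)) * monomial m z)"
      by (intro ext) (simp add: f_def If sum_distrib_left mult_ac)
    then have "\<Lambda> (f k) = (\<Sum>m | (\<Sum>i\<in>UNIV. m i) = k. (of_real (a k) / fact k * (c k m * I m)) * \<Lambda> (monomial m))"
      by (simp only: bounded_functional_sum[OF p L mF fin])
    also have "\<dots> = of_real (a k) / fact k * (\<Sum>m | (\<Sum>i\<in>UNIV. m i) = k. (c k m * \<Lambda> (monomial m)) * I m)"
      by (simp add: sum_distrib_left mult_ac)
    also have "(\<Sum>m | (\<Sum>i\<in>UNIV. m i) = k. (c k m * \<Lambda> (monomial m)) * I m)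
        = (LINT w|dV. (\<Sum>m | (\<Sum>i\<in>UNIV. m i) = k. (c k m * \<Lambda> (monomial m)) * (\<psi> w * cnj (monomial m w))))"
      unfolding I_def using intm by (subst Bochner_Integration.integral_sum) auto
    also have "\<dots> = (LINT w|dV. \<psi> w * \<Lambda> (\<lambda>z. hinner z w ^ k))"
    proof (intro Bochner_Integration.integral_cong refl)
      fix w :: "complex ^ 'n"
      have "(\<lambda>z. hinner z w ^ k) = (\<lambda>z. \<Sum>m | (\<Sum>i\<in>UNIV. m i) = k. (c k m * cnj (monomial m w)) * monomial m z)"
        by (intro ext) (simp add: c mult_ac)
      then have "\<Lambda> (\<lambda>z. hinner z w ^ k) = (\<Sum>m | (\<Sum>i\<in>UNIV. m i) = k. (c k m * cnj (monomial m w)) * \<Lambda> (monomial m))"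
        by (simp only: bounded_functional_sum[OF p L mF fin])
      then show "(\<Sum>m | (\<Sum>i\<in>UNIV. m i) = k. (c k m * \<Lambda> (monomial m)) * (\<psi> w * cnj (monomial m w))) = \<psi> w * \<Lambda> (\<lambda>z. hinner z w ^ k)"
        by (simp add: sum_distrib_left mult_ac)
    qed
    finally show ?thesis .
  qed
  have entf: "entire (f k)" for k
    unfolding f_def[abs_def] If by (intro entire_cmult entire_sum entire_monomial)
  have sums: "(\<lambda>k. f k z) sums kernel_op N s \<psi> z" for z
  proof -
    define F where "F k w = of_real (a k) / fact k * (\<psi> w * hinner z w ^ k)" for k w
    have intF: "integrable dV (F k)" for k unfolding F_def using inth by simp
    have Fb: "cmod (F k w) \<le> a k / fact k * ((norm z * R) ^ k * cmod (\<psi> w))" for k w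
    proof -
      have n: "cmod (of_real (a k) / fact k) = a k / fact k" using a0[of k] by (simp add: norm_divide)
      show ?thesis
        unfolding F_def norm_mult[of "_ / _"] n using a0[of k] by (intro mult_left_mono hb) simp
    qed
    have asum: "summable (\<lambda>k. a k / fact k * (norm z * R) ^ k * x)" if "x \<ge> 0" for x
    proof (rule summable_comparison_test'[of "\<lambda>k. C * ((D * norm z) ^ k / fact k) * x" 0])
      have "summable (\<lambda>k. (D * norm z) ^ k / fact k)"
        using summable_exp[of "D * norm z"] by (simp add: divide_inverse mult.commute)
      then show "summable (\<lambda>k. C * ((D * norm z) ^ k / fact k) * x)" by (intro summable_mult2 summable_mult)
      fix k
      have "a k / fact k * (norm z * R) ^ k * x \<le> (C * exp 1 ^ k) / fact k * (norm z * R) ^ k * x"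
        using C(2) R that by (intro mult_right_mono divide_right_mono) auto
      then show "norm (a k / fact k * (norm z * R) ^ k * x) \<le> C * ((D * norm z) ^ k / fact k) * x"
        using a0[of k] R that by (simp add: D_def power_mult_distrib mult_ac abs_mult)
    qed
    have "(\<lambda>k. LINT w|dV. F k w) sums (LINT w|dV. (\<Sum>k. F k w))"
    proof (rule sums_integral[OF intF])
      show "AE w in dV. summable (\<lambda>k. cmod (F k w))"
      proof (rule AE_I2)
        fix w
        show "summable (\<lambda>k. cmod (F k w))"
          by (rule summable_comparison_test'[OF asum[OF norm_ge_zero[of "\<psi> w"]], of 0])
            (use Fb in \<open>simp add: mult.assoc\<close>)
      qed
      have "norm (LINT w|dV. cmod (F k w)) \<le> a k / fact k * (norm z * R) ^ k * K0" for k
      proof -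
        have "(LINT w|dV. cmod (F k w)) \<le> (LINT w|dV. a k / fact k * ((norm z * R) ^ k * cmod (\<psi> w)))"
          using intF int\<psi> Fb by (intro integral_mono) auto
        then show ?thesis by (simp add: K0_def mult.assoc)
      qed
      then show "summable (\<lambda>k. LINT w|dV. cmod (F k w))"
        by (intro summable_comparison_test'[OF asum[OF K0], of 0])
    qed
    moreover have "(\<Sum>k. F k w) = \<psi> w * kernel N CARD('n) s (hinner z w)" for w
    proof -
      have t1: "cmod (of_real (a k) * hinner z w ^ k / fact k) \<le> C * ((D * norm z * norm w / R) ^ k / fact k)" for k
      proof -
        have "a k * cmod (hinner z w) ^ k / fact k \<le> (C * exp 1 ^ k) * (norm z * norm w) ^ k / fact k"
          using C a0[of k] norm_hinner_le[of z w] by (intro divide_right_mono mult_mono power_mono) auto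
        also have "\<dots> = C * ((D * norm z * norm w / R) ^ k / fact k)"
          using R by (simp add: D_def power_mult_distrib power_divide mult_ac)
        finally show ?thesis using a0[of k] by (simp add: norm_mult norm_divide norm_power)
      qed
      have t2: "summable (\<lambda>k. C * ((D * norm z * norm w / R) ^ k / fact k))"
        using summable_exp[of "D * norm z * norm w / R"] by (intro summable_mult) (simp add: divide_inverse mult.commute)
      have "summable (\<lambda>k. of_real (a k) * hinner z w ^ k / fact k)"
        by (rule summable_comparison_test'[OF t2, of 0]) (rule t1)
      then have "(\<lambda>k. \<psi> w * (of_real (a k) * hinner z w ^ k / fact k)) sums (\<psi> w * kernel N CARD('n) s (hinner z w))"
        unfolding kernel_def a_def by (intro sums_mult summable_sums)
      moreover have "(\<lambda>k. \<psi> w * (of_real (a k) * hinner z w ^ k / fact k)) = (\<lambda>k. F k w)"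
        by (intro ext) (simp add: F_def)
      ultimately show ?thesis by (simp add: sums_iff)
    qed
    moreover have "(LINT w|dV. F k w) = f k z" for k by (simp add: F_def f_def)
    ultimately show ?thesis by (simp add: kernel_op_def)
  qed
  have "entire (\<lambda>z. \<Sum>k. f k z)"
  proof (rule entire_suminf[OF entf])
    fix r :: real
    have "b k z \<le> K0 * C * ((D * \<bar>r\<bar>) ^ k / fact k)" if "norm z \<le> r" for k and z :: "complex ^ 'n"
      unfolding b_def using that K0 C(1) R
      by (intro mult_left_mono divide_right_mono power_mono) (auto simp: D_def)
    moreover have "summable (\<lambda>k. K0 * C * ((D * \<bar>r\<bar>) ^ k / fact k))"
      using summable_exp[of "D * \<bar>r\<bar>"] by (intro summable_mult) (simp add: divide_inverse mult.commute)
    ultimately show "\<exists>B. summable B \<and> (\<forall>k z. norm z \<le> r \<longrightarrow> cmod (f k z) \<le> B k)"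
      using fb by (intro exI[of _ "\<lambda>k. K0 * C * ((D * \<bar>r\<bar>) ^ k / fact k)"]) (meson order_trans)
  qed
  then show ent: "entire (kernel_op N s \<psi>)"
    using sums by (simp add: sums_iff)
  note S = bounded_functional_sums[OF p L entf ent sums fb bsums]
  show "kernel_op N s \<psi> \<in> fock_space (\<alpha> * p) p" by (rule S(1))
  show "(\<lambda>k. of_real (kernel_coeff N CARD('n) s k) / fact k * (LINT w|dV. \<psi> w * \<Lambda> (\<lambda>z. hinner z w ^ k))) sums \<Lambda> (kernel_op N s \<psi>)"
    using S(2) unfolding \<Lambda>f a_def .
qed

section \<open>Duality\<close>

text \<open>For s = 0 all coefficients are 1, so the kernel operator becomes the plain integral of
  the reproducing formula.\<close>

lemma kernel_unweighted:
  assumes "n > 0"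
  shows "kernel 0 n 0 x = exp x"
proof -
  have "Gamma (real (n + k)) > 0" for k using assms by (intro Gamma_real_pos) simp
  then have "Gamma (real (n + k)) \<noteq> 0" for k using less_imp_neq by metis
  then have "kernel_coeff 0 n 0 k = 1" for k by (simp only: kernel_coeff_def) simp
  moreover have "(\<lambda>k. x ^ k / fact k) sums exp x"
    using exp_converges[of x] by (simp add: scaleR_conv_of_real divide_inverse mult.commute)
  ultimately show ?thesis by (simp add: kernel_def sums_iff)
qed

text \<open>The reproducing formula, truncated to balls, approximates every element of the space by
  functions on which the two functionals agree.\<close>

lemma bounded_functional_eqI:
  fixes f :: "complex ^ 'n::finite \<Rightarrow> complex"
  assumes p: "p > 1" and L1: "bounded_functional (\<alpha> * p) p \<Lambda>1" and L2: "bounded_functional (\<alpha> * p) p \<Lambda>2"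
    and eq: "\<And>k w. \<Lambda>1 (\<lambda>z. hinner z w ^ k) = \<Lambda>2 (\<lambda>z :: complex ^ 'n. hinner z w ^ k)"
    and f: "f \<in> fock_space (\<alpha> * p) p"
  shows "\<Lambda>1 f = \<Lambda>2 f"
proof -
  define q where "q = p / (p - 1)"
  have pq: "1 / p + 1 / q = 1" using p by (simp add: q_def field_simps)
  have p0: "p > 0" using p by simp
  have ent: "entire f" and intf: "integrable dV (\<lambda>z. wmod \<alpha> f z powr p)" using f by (auto simp: fock_space_iff)
  note [measurable] = entire_measurable[OF ent]
  \<comment> \<open>Pairing the weight \<alpha> with -\<alpha> gives s = 0: the bound for the
    reproducing integral on weighted L^p is a special case of
    \<open>kernel_op_bound\<close>.\<close>
  have s: "(\<alpha> + (- \<alpha>)) / 2 < real (CARD('n) + 0)" and s0: "(\<alpha> + (- \<alpha>)) / 2 = 0" by simp_all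
  obtain C where C: "C \<ge> 0" "\<And>(\<psi> :: complex ^ 'n \<Rightarrow> complex) z. \<psi> \<in> borel_measurable borel \<Longrightarrow>
      integrable dV (\<lambda>w. (cmod (\<psi> w) * (1 + norm w) powr (- \<alpha>) * exp ((norm w)\<^sup>2 / 2)) powr p) \<Longrightarrow>
      integrable dV (\<lambda>w. \<psi> w * kernel 0 CARD('n) 0 (hinner z w))"
    "\<And>\<psi> :: complex ^ 'n \<Rightarrow> complex. \<psi> \<in> borel_measurable borel \<Longrightarrow>
      integrable dV (\<lambda>w. (cmod (\<psi> w) * (1 + norm w) powr (- \<alpha>) * exp ((norm w)\<^sup>2 / 2)) powr p) \<Longrightarrow>
      entire (kernel_op 0 0 \<psi>) \<Longrightarrow>
      kernel_op 0 0 \<psi> \<in> fock_space (\<alpha> * p) p \<and>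
      fock_norm (\<alpha> * p) p (kernel_op 0 0 \<psi>)
        \<le> C * (LINT w|dV. (cmod (\<psi> w) * (1 + norm w) powr (- \<alpha>) * exp ((norm w)\<^sup>2 / 2)) powr p) powr (1 / p)"
    using kernel_op_bound[OF p pq s] unfolding s0 by blast
  define \<psi> where "\<psi> w = f w * of_real (exp (- (norm w)\<^sup>2))" for w
  define A where "A i = cball (0 :: complex ^ 'n) (real (Suc i))" for i
  define \<psi>i where "\<psi>i i w = \<psi> w * indicator (A i) w" for i w
  \<comment> \<open>The tail outside the ball. Its image under the operator is the approximation
    error, and by the operator bound its norm is controlled by the integral of |f|^p over the
    complement.\<close>
  define \<eta> where "\<eta> i w = \<psi> w * indicator (- A i) w" for i w
  have [measurable]: "A i \<in> sets borel" "- A i \<in> sets borel" for i by (auto simp: A_def)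
  have [measurable]: "\<psi> \<in> borel_measurable borel" unfolding \<psi>_def by measurable
  have meas[measurable]: "\<psi>i i \<in> borel_measurable borel" "\<eta> i \<in> borel_measurable borel" for i
    unfolding \<psi>i_def \<eta>_def by measurable
  have w\<psi>: "cmod (\<psi> w) * (1 + norm w) powr (- \<alpha>) * exp ((norm w)\<^sup>2 / 2) = wmod \<alpha> f w" for w
  proof -
    have "exp (- (norm w)\<^sup>2) * exp ((norm w)\<^sup>2 / 2) = exp (- (norm w)\<^sup>2 / 2)" by (simp flip: exp_add)
    then have "cmod (f w) * (1 + norm w) powr (- \<alpha>) * (exp (- (norm w)\<^sup>2) * exp ((norm w)\<^sup>2 / 2)) = wmod \<alpha> f w"
      by (simp only: wmod_def mult_ac)
    moreover have "cmod (\<psi> w) = cmod (f w) * exp (- (norm w)\<^sup>2)" unfolding \<psi>_def norm_mult norm_of_real abs_exp_cancel ..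
    ultimately show ?thesis by (simp only: mult_ac)
  qed
  have w\<psi>i: "cmod (\<psi>i i w) * (1 + norm w) powr (- \<alpha>) * exp ((norm w)\<^sup>2 / 2) = wmod \<alpha> f w * indicator (A i) w" for i w
    by (simp add: \<psi>i_def norm_mult indicator_def w\<psi>)
  have w\<eta>: "cmod (\<eta> i w) * (1 + norm w) powr (- \<alpha>) * exp ((norm w)\<^sup>2 / 2) = wmod \<alpha> f w * indicator (- A i) w" for i w
    by (simp add: \<eta>_def norm_mult indicator_def w\<psi>)
  have intAi: "integrable dV (\<lambda>w. (wmod \<alpha> f w * indicator S w) powr p)" if "S \<in> sets borel" for S
  proof (rule Bochner_Integration.integrable_bound[OF intf])
    show "AE w in dV. norm ((wmod \<alpha> f w * indicator S w) powr p) \<le> norm (wmod \<alpha> f w powr p)"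
      using p0 by (intro AE_I2) (auto simp: indicator_def)
  qed (use that in measurable)
  have int1: "integrable dV (\<lambda>w. (cmod (\<psi>i i w) * (1 + norm w) powr (- \<alpha>) * exp ((norm w)\<^sup>2 / 2)) powr p)"
    and int2: "integrable dV (\<lambda>w. (cmod (\<eta> i w) * (1 + norm w) powr (- \<alpha>) * exp ((norm w)\<^sup>2 / 2)) powr p)" for i
    unfolding w\<psi>i w\<eta> by (intro intAi; simp)+
  have rep: "kernel_op 0 0 \<psi> = f"
    using gaussian_growth_reproducing(2)[OF fock_gaussian_growth[OF p f]]
    by (intro ext) (simp add: kernel_op_def kernel_unweighted \<psi>_def mult_ac)
  have split: "kernel_op 0 0 (\<eta> i) = (\<lambda>z. f z - kernel_op 0 0 (\<psi>i i) z)" for i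
  proof
    fix z
    have "kernel_op 0 0 \<psi> z = (LINT w|dV. \<eta> i w * kernel 0 CARD('n) 0 (hinner z w) + \<psi>i i w * kernel 0 CARD('n) 0 (hinner z w))"
      unfolding kernel_op_def
      by (intro Bochner_Integration.integral_cong refl) (simp add: \<eta>_def \<psi>i_def indicator_def)
    also have "\<dots> = kernel_op 0 0 (\<eta> i) z + kernel_op 0 0 (\<psi>i i) z"
      unfolding kernel_op_def by (intro Bochner_Integration.integral_add C(2) meas int1 int2)
    finally show "kernel_op 0 0 (\<eta> i) z = f z - kernel_op 0 0 (\<psi>i i) z" using rep by simp
  qed
  define F where "F i = kernel_op 0 0 (\<psi>i i)" for i
  have F: "entire (F i)" "F i \<in> fock_space (\<alpha> * p) p" "\<Lambda>1 (F i) = \<Lambda>2 (F i)" for i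
  proof -
    obtain M where M: "M \<ge> 0" "\<And>w. norm w \<le> real (Suc i) \<Longrightarrow> cmod (f w) \<le> M"
      using entire_bounded_on_ball[OF ent] by blast
    have b1: "cmod (\<psi>i i w) \<le> M" if "norm w \<le> real (Suc i)" for w
    proof -
      have "cmod (f w) * exp (- (norm w)\<^sup>2) \<le> M * 1" using M that by (intro mult_mono) auto
      then show ?thesis using M by (simp add: \<psi>i_def \<psi>_def norm_mult indicator_def)
    qed
    have b2: "\<psi>i i w = 0" if "norm w > real (Suc i)" for w
      using that by (simp add: \<psi>i_def A_def)
    have s': "(0::real) < real (CARD('n) + 0)" and R: "real (Suc i) > 0" by simp_all
    note K1 = functional_kernel_op[OF p s' L1 meas(1) b1 b2 R]
    note K2 = functional_kernel_op[OF p s' L2 meas(1) b1 b2 R]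
    show "entire (F i)" "F i \<in> fock_space (\<alpha> * p) p" using K1(1,2) by (simp_all add: F_def)
    \<comment> \<open>Both values are sums of the same series, whose terms involve the functionals
      only through powers of the inner product.\<close>
    show "\<Lambda>1 (F i) = \<Lambda>2 (F i)" using K1(3) K2(3) unfolding eq F_def by (rule sums_unique2)
  qed
  define e where "e i = C * (LINT w|dV. (wmod \<alpha> f w * indicator (- A i) w) powr p) powr (1 / p)" for i
  have norm_e: "fock_norm (\<alpha> * p) p (\<lambda>z. f z - F i z) \<le> e i" for i
  proof -
    have "entire (kernel_op 0 0 (\<eta> i))" unfolding split F_def[symmetric] by (intro entire_diff ent F)
    then show ?thesis using C(3)[OF meas(2) int2] by (simp add: e_def split F_def w\<eta>)
  qed
  have "e \<longlonglongrightarrow> C * 0"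
    unfolding e_def
  proof (intro tendsto_mult tendsto_const tendsto_zero_powrI[OF _ tendsto_const])
    have "(\<lambda>i. LINT w|dV. (wmod \<alpha> f w * indicator (- A i) w) powr p) \<longlonglongrightarrow> (LINT w|(dV :: (complex ^ 'n) measure). 0)"
    proof (rule integral_dominated_convergence[OF _ _ intf])
      show "AE w in dV. norm ((wmod \<alpha> f w * indicator (- A i) w) powr p) \<le> wmod \<alpha> f w powr p" for i
        using p0 by (intro AE_I2) (auto simp: indicator_def)
      have "(\<lambda>i. (wmod \<alpha> f w * indicator (- A i) w) powr p) \<longlonglongrightarrow> 0" for w
      proof (rule tendsto_eventually)
        obtain j where j: "norm w \<le> real j" using real_arch_simple by blast
        show "\<forall>\<^sub>F i in sequentially. (wmod \<alpha> f w * indicator (- A i) w) powr p = 0"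
          using eventually_ge_at_top[of j]
        proof eventually_elim
          case (elim i)
          then have "w \<in> A i" using j by (simp add: A_def)
          then show ?case by simp
        qed
      qed
      then show "AE w in dV. (\<lambda>i. (wmod \<alpha> f w * indicator (- A i) w) powr p) \<longlonglongrightarrow> 0" by simp
    qed measurable
    then show "(\<lambda>i. LINT w|dV. (wmod \<alpha> f w * indicator (- A i) w) powr p) \<longlonglongrightarrow> 0" by simp
  qed (use p0 in \<open>auto intro!: integral_nonneg_AE always_eventually\<close>)
  then have e0: "e \<longlonglongrightarrow> 0" by simp
  have lim: "(\<lambda>i. \<Lambda> f - \<Lambda> (F i)) \<longlonglongrightarrow> 0" if L: "bounded_functional (\<alpha> * p) p \<Lambda>" for \<Lambda> :: "(complex ^ 'n \<Rightarrow> complex) \<Rightarrow> complex"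
  proof -
    obtain B where B: "B \<ge> 0" "\<And>f. f \<in> fock_space (\<alpha> * p) p \<Longrightarrow> cmod (\<Lambda> f) \<le> B * fock_norm (\<alpha> * p) p f"
      using bounded_functionalE[OF L] by blast
    have t1: "(\<lambda>i. B * e i) \<longlonglongrightarrow> 0" by (rule tendsto_mult_right_zero[OF e0])
    have t2: "cmod (\<Lambda> f - \<Lambda> (F i)) \<le> B * e i" for i
    proof -
      have "cmod (\<Lambda> f - \<Lambda> (F i)) \<le> B * fock_norm (\<alpha> * p) p (\<lambda>z. f z - F i z)"
        unfolding bounded_functional_diff[OF p L f F(2), symmetric] by (intro B(2) fock_space_diff p f F(2))
      also have "\<dots> \<le> B * e i" by (intro mult_left_mono norm_e B(1))
      finally show ?thesis .
    qed
    show ?thesis by (rule Lim_null_comparison[OF always_eventually t1]) (intro allI t2)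
  qed
  have "(\<lambda>i. (\<Lambda>1 f - \<Lambda>1 (F i)) - (\<Lambda>2 f - \<Lambda>2 (F i))) \<longlonglongrightarrow> 0 - 0"
    by (intro tendsto_diff lim L1 L2)
  then have "(\<lambda>i :: nat. \<Lambda>1 f - \<Lambda>2 f) \<longlonglongrightarrow> 0" by (simp add: F(3))
  then have "\<Lambda>1 f - \<Lambda>2 f = 0" by (simp add: LIMSEQ_const_iff)
  then show ?thesis by simp
qed

text \<open>The representing function is \<open>g w = cnj (\<Lambda> K\<^sub>w)\<close>. Its norm over a ball is estimated by
  applying the functional to the image under the kernel operator of the extremal function in
  the duality of Lebesgue spaces.\<close>

lemma representing_function:
  assumes p: "1 < p" "1 / p + 1 / q = 1" and N: "(\<alpha> + \<beta>) / 2 < real (CARD('n::finite) + N)"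
  obtains C where "C > 0" "\<And>(\<Lambda> :: (complex ^ 'n \<Rightarrow> complex) \<Rightarrow> complex) B. bounded_functional (\<alpha> * p) p \<Lambda> \<Longrightarrow> B \<ge> 0 \<Longrightarrow>
    (\<And>f. f \<in> fock_space (\<alpha> * p) p \<Longrightarrow> cmod (\<Lambda> f) \<le> B * fock_norm (\<alpha> * p) p f) \<Longrightarrow>
    \<exists>g \<in> fock_space (\<beta> * q) q. fock_norm (\<beta> * q) q g \<le> C * B \<and>
      (\<forall>k w. hpart g k w = of_real (kernel_coeff N CARD('n) ((\<alpha> + \<beta>) / 2) k) / fact k * cnj (\<Lambda> (\<lambda>z. hinner z w ^ k)))"
proof -
  define s where "s = (\<alpha> + \<beta>) / 2"
  have s: "s < real (CARD('n) + N)" using N by (simp add: s_def)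
  have q: "1 < q" "(q - 1) * p = q" using conjugate_exponents[OF p] by blast+
  have p0: "p > 0" and q0: "q > 0" using p q by simp_all
  obtain T where T: "T \<ge> 0" "\<And>(\<psi> :: complex ^ 'n \<Rightarrow> complex) z. \<psi> \<in> borel_measurable borel \<Longrightarrow>
      integrable dV (\<lambda>w. (cmod (\<psi> w) * (1 + norm w) powr \<beta> * exp ((norm w)\<^sup>2 / 2)) powr p) \<Longrightarrow>
      integrable dV (\<lambda>w. \<psi> w * kernel N CARD('n) s (hinner z w))"
    "\<And>\<psi> :: complex ^ 'n \<Rightarrow> complex. \<psi> \<in> borel_measurable borel \<Longrightarrow>
      integrable dV (\<lambda>w. (cmod (\<psi> w) * (1 + norm w) powr \<beta> * exp ((norm w)\<^sup>2 / 2)) powr p) \<Longrightarrow>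
      entire (kernel_op N s \<psi>) \<Longrightarrow>
      kernel_op N s \<psi> \<in> fock_space (\<alpha> * p) p \<and>
      fock_norm (\<alpha> * p) p (kernel_op N s \<psi>)
        \<le> T * (LINT w|dV. (cmod (\<psi> w) * (1 + norm w) powr \<beta> * exp ((norm w)\<^sup>2 / 2)) powr p) powr (1 / p)"
    using kernel_op_bound[OF p N] unfolding s_def by blast
  define a where "a k = kernel_coeff N CARD('n) s k" for k
  have a0: "a k > 0" for k unfolding a_def by (rule kernel_coeff_pos[OF _ s]) simp
  obtain D where D: "D \<ge> 0" "\<And>k. a k \<le> D * exp 1 ^ k"
    unfolding a_def by (rule kernel_coeff_bound[OF _ s]) auto
  have "\<exists>g \<in> fock_space (\<beta> * q) q. fock_norm (\<beta> * q) q g \<le> (T + 1) * B \<and>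
      (\<forall>k w. hpart g k w = of_real (a k) / fact k * cnj (\<Lambda> (\<lambda>z. hinner z w ^ k)))"
    if L: "bounded_functional (\<alpha> * p) p \<Lambda>" and B: "B \<ge> 0" "\<And>f. f \<in> fock_space (\<alpha> * p) p \<Longrightarrow> cmod (\<Lambda> f) \<le> B * fock_norm (\<alpha> * p) p f"
    for \<Lambda> :: "(complex ^ 'n \<Rightarrow> complex) \<Rightarrow> complex" and B
  proof -
    \<comment> \<open>The homogeneous terms of cnj (\<Lambda> K_w). Working with the terms gives the
      parts of g directly, and the coefficients are those forced by
      \<open>split_pairing_hinner_power\<close>.\<close>
    define G where "G k w = of_real (a k) / fact k * cnj (\<Lambda> (\<lambda>z. hinner z w ^ k))" for k w
    have mF: "monomial m \<in> fock_space (\<alpha> * p) p" for m :: "'n \<Rightarrow> nat" using p0 by (rule monomial_in_fock_space)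
    have G: "entire (G k) \<and> (\<forall>c w. G k (c *s w) = c ^ k * G k w)" for k
    proof -
      obtain C where C: "\<And>z w :: complex ^ 'n. hinner z w ^ k = (\<Sum>m | (\<Sum>i\<in>UNIV. m i) = k. C m * monomial m z * cnj (monomial m w))"
        using hinner_power_eq_monomials by blast
      have eq: "G k = (\<lambda>w. of_real (a k) / fact k * (\<Sum>m | (\<Sum>i\<in>UNIV. m i) = k. (cnj (C m) * cnj (\<Lambda> (monomial m))) * monomial m w))"
      proof
        fix w :: "complex ^ 'n"
        have "(\<lambda>z. hinner z w ^ k) = (\<lambda>z. \<Sum>m | (\<Sum>i\<in>UNIV. m i) = k. (C m * cnj (monomial m w)) * monomial m z)"
          by (intro ext) (simp add: C mult_ac)
        then have "\<Lambda> (\<lambda>z. hinner z w ^ k) = (\<Sum>m | (\<Sum>i\<in>UNIV. m i) = k. (C m * cnj (monomial m w)) * \<Lambda> (monomial m))"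
          by (simp only: bounded_functional_sum[OF p(1) L mF finite_multi_indices])
        then show "G k w = of_real (a k) / fact k * (\<Sum>m | (\<Sum>i\<in>UNIV. m i) = k. (cnj (C m) * cnj (\<Lambda> (monomial m))) * monomial m w)"
          by (simp add: G_def mult_ac)
      qed
      have "entire (G k)" unfolding eq by (intro entire_cmult entire_sum entire_monomial)
      moreover have "G k (c *s w) = c ^ k * G k w" for c w
        unfolding eq sum_distrib_left by (intro sum.cong refl) (auto simp: monomial_smult mult_ac)
      ultimately show ?thesis by blast
    qed
    have bound: "\<exists>K\<ge>0. \<forall>k w. norm w \<le> R \<longrightarrow> cmod (G k w) \<le> K * (1 / 2) ^ k" if R: "R \<ge> 0" for R
    proof -
      \<comment> \<open>For |w| \<le> R the norm of the power is at most a constant times k!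
        (R/t)^k, while the coefficients grow at most like e^k. This t makes e R / t \<le> 1/2; the
        summand 1 keeps it positive when R = 0.\<close>
      define t where "t = 2 * exp 1 * R + 1"
      have t: "t > 0" using R by (simp add: t_def add_nonneg_pos)
      define E where "E = (LINT z|(dV :: (complex ^ 'n) measure). (exp (t * norm z) * exp (- (norm z)\<^sup>2 / 2) * (1 + norm z) powr (- \<alpha>)) powr p) powr (1 / p)"
      have E: "E \<ge> 0" by (simp add: E_def)
      have "cmod (G k w) \<le> (D * B * E) * (1 / 2) ^ k" if w: "norm w \<le> R" for k w
      proof -
        let ?P = "\<lambda>z. hinner z w ^ k"
        have "cmod (\<Lambda> ?P) \<le> B * fock_norm (\<alpha> * p) p ?P" by (intro B(2) hinner_power_in_fock_space p0)
        also have "\<dots> \<le> B * (norm w ^ k * fact k / t ^ k * E)"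
          unfolding E_def by (intro mult_left_mono fock_space_exp_type(2)[OF p0 entire_hinner_power hinner_power_exp_bound[OF t]] B(1))
        also have "\<dots> \<le> B * (R ^ k * fact k / t ^ k * E)"
          using w t E B(1) by (intro mult_left_mono mult_right_mono divide_right_mono power_mono) auto
        finally have 1: "cmod (\<Lambda> ?P) \<le> B * (R ^ k * fact k / t ^ k * E)" .
        have "cmod (G k w) = a k / fact k * cmod (\<Lambda> ?P)"
          using a0[of k] by (simp add: G_def norm_mult norm_divide)
        also have "\<dots> \<le> (D * exp 1 ^ k) / fact k * (B * (R ^ k * fact k / t ^ k * E))"
          using 1 D a0[of k] by (intro mult_mono divide_right_mono) (auto intro: less_imp_le)
        also have "\<dots> = (D * B * E) * (exp 1 * R / t) ^ k"
          by (simp add: power_mult_distrib power_divide)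
        also have "\<dots> \<le> (D * B * E) * (1 / 2) ^ k"
          using D(1) B(1) E R t by (intro mult_left_mono power_mono) (auto simp: t_def field_simps)
        finally show ?thesis .
      qed
      moreover have "D * B * E \<ge> 0" using D(1) B(1) E by simp
      ultimately show ?thesis by blast
    qed
    have geo: "summable (\<lambda>k. K * (1 / 2) ^ k)" for K :: real
      by (rule summable_mult[OF summable_geometric]) simp
    have summ: "summable (\<lambda>k. G k w)" for w
    proof -
      obtain K where "\<And>k. cmod (G k w) \<le> K * (1 / 2) ^ k" using bound[OF norm_ge_zero[of w]] by blast
      then show ?thesis by (intro summable_comparison_test'[OF geo[of K], of 0])
    qed
    define g where "g w = (\<Sum>k. G k w)" for w
    have gsums: "(\<lambda>k. G k w) sums g w" for w unfolding g_def by (rule summable_sums[OF summ])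
    have entg: "entire g"
      unfolding g_def[abs_def]
    proof (rule entire_suminf)
      fix R :: real
      obtain K where K: "\<And>k w. norm w \<le> \<bar>R\<bar> \<Longrightarrow> cmod (G k w) \<le> K * (1 / 2) ^ k" using bound[OF abs_ge_zero[of R]] by blast
      show "\<exists>B. summable B \<and> (\<forall>k z. norm z \<le> R \<longrightarrow> cmod (G k z) \<le> B k)"
        using geo[of K] K by (intro exI[of _ "\<lambda>k. K * (1 / 2) ^ k"]) auto
    qed (use G in blast)
    note [measurable] = entire_measurable[OF entg]
    have hg: "hpart g k w = G k w" for k w
    proof (rule hpart_unique[OF entg])
      fix t
      have "G k (t *s w) = G k w * t ^ k" for k using G by (simp add: mult.commute)
      then show "(\<lambda>k. G k w * t ^ k) sums g (t *s w)" using gsums[of "t *s w"] by simp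
    qed
    define u where "u = wmod \<beta> g"
    have [measurable]: "u \<in> borel_measurable borel" unfolding u_def by measurable
    have u0: "u w \<ge> 0" for w by (simp add: u_def wmod_nonneg)
    have ball: "integrable dV (\<lambda>w. indicator (cball 0 R) w * u w powr q) \<and>
        (LINT w|dV. indicator (cball 0 R) w * u w powr q) \<le> (T * B) powr q" if R: "R > 0" for R
    proof -
      obtain M where M: "M \<ge> 0" "\<And>w. norm w \<le> R \<Longrightarrow> cmod (g w) \<le> M"
        using entire_bounded_on_ball[OF entg] by blast
      define v where "v w = exp (- (norm w)\<^sup>2 / 2) * (1 + norm w) powr (- \<beta>)" for w :: "complex ^ 'n"
      have v0: "v w > 0" for w unfolding v_def by (intro mult_pos_pos) (auto simp: add_nonneg_eq_0_iff)
      have [measurable]: "v \<in> borel_measurable borel" unfolding v_def by measurable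
      have uv: "u w = cmod (g w) * v w" for w by (simp add: u_def wmod_def v_def)
      \<comment> \<open>The extremal function for the weighted L^q norm on the ball: the factor sgn
        g makes \<psi> cnj(g) equal to u^q there, and since (q - 1) p = q the p-th power of its
        weighted modulus is u^q as well.\<close>
      define \<psi> where "\<psi> w = of_real (indicator (cball 0 R) w * u w powr (q - 1) * v w) * sgn (g w)" for w
      have [measurable]: "cball (0 :: complex ^ 'n) R \<in> sets borel" by simp
      have [measurable]: "\<psi> \<in> borel_measurable borel"
        unfolding \<psi>_def sgn_div_norm by measurable
      define V where "V = exp (\<bar>\<beta>\<bar> * R)"
      have vV: "v w \<le> V" if "norm w \<le> R" for w
      proof -
        have "v w \<le> 1 * exp (\<bar>- \<beta>\<bar> * norm w)"
          unfolding v_def by (intro mult_mono powr_le_exp) auto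
        also have "\<dots> \<le> V" using that by (simp add: V_def mult_left_mono)
        finally show ?thesis .
      qed
      have uM: "u w \<le> M * V" if "norm w \<le> R" for w
        unfolding uv using M vV[OF that] that v0[of w] by (intro mult_mono) auto
      have \<psi>b: "cmod (\<psi> w) \<le> (M * V) powr (q - 1) * V" if "norm w \<le> R" for w
      proof -
        have "cmod (\<psi> w) \<le> u w powr (q - 1) * v w"
          using that v0[of w] by (simp add: \<psi>_def norm_mult norm_sgn abs_mult)
        also have "\<dots> \<le> (M * V) powr (q - 1) * V"
          using uM[OF that] vV[OF that] u0[of w] v0[of w] q by (intro mult_mono powr_mono2) auto
        finally show ?thesis .
      qed
      have \<psi>0: "\<psi> w = 0" if "norm w > R" for w using that by (simp add: \<psi>_def)
      have \<psi>g: "\<psi> w * cnj (g w) = of_real (indicator (cball 0 R) w * u w powr q)" for w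
      proof -
        have A: "sgn (g w) * cnj (g w) = of_real (cmod (g w))"
        proof (cases "g w = 0")
          case False
          have "g w * cnj (g w) = of_real (cmod (g w)) * of_real (cmod (g w))"
            using complex_norm_square[of "g w"] by (simp add: power2_eq_square)
          then show ?thesis using False by (simp add: sgn_div_norm scaleR_conv_of_real field_simps)
        qed simp
        have E: "u w powr (q - 1) * v w * cmod (g w) = u w powr q"
        proof -
          have "u w powr (q - 1) * u w = u w powr q"
            using u0[of w] q by (cases "u w = 0") (simp_all add: powr_diff)
          then show ?thesis by (simp add: uv mult_ac)
        qed
        have "\<psi> w * cnj (g w) = of_real (indicator (cball 0 R) w * u w powr (q - 1) * v w) * of_real (cmod (g w))"
          unfolding \<psi>_def mult.assoc A ..
        also have "\<dots> = of_real (indicator (cball 0 R) w * (u w powr (q - 1) * v w * cmod (g w)))"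
          by (simp only: of_real_mult mult.assoc)
        finally show ?thesis unfolding E .
      qed
      have \<Phi>: "(cmod (\<psi> w) * (1 + norm w) powr \<beta> * exp ((norm w)\<^sup>2 / 2)) powr p = indicator (cball 0 R) w * u w powr q" for w
      proof -
        have v1: "v w * ((1 + norm w) powr \<beta> * exp ((norm w)\<^sup>2 / 2)) = 1"
        proof -
          have "(1 + norm w) powr (- \<beta>) * (1 + norm w) powr \<beta> = 1"
            by (subst powr_add[symmetric]) (simp add: add_nonneg_eq_0_iff)
          moreover have "exp (- (norm w)\<^sup>2 / 2) * exp ((norm w)\<^sup>2 / 2) = 1" by (simp flip: exp_add)
          moreover have "v w * ((1 + norm w) powr \<beta> * exp ((norm w)\<^sup>2 / 2)) = (exp (- (norm w)\<^sup>2 / 2) * exp ((norm w)\<^sup>2 / 2)) * ((1 + norm w) powr (- \<beta>) * (1 + norm w) powr \<beta>)"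
            unfolding v_def by (simp only: mult_ac)
          ultimately show ?thesis by simp
        qed
        have "cmod (\<psi> w) = indicator (cball 0 R) w * u w powr (q - 1) * v w"
        proof (cases "g w = 0")
          case True
          then show ?thesis using q by (simp add: \<psi>_def uv)
        next
          case False
          then show ?thesis using v0[of w] by (simp add: \<psi>_def norm_mult norm_sgn abs_mult)
        qed
        then have "cmod (\<psi> w) * (1 + norm w) powr \<beta> * exp ((norm w)\<^sup>2 / 2) = indicator (cball 0 R) w * u w powr (q - 1) * (v w * ((1 + norm w) powr \<beta> * exp ((norm w)\<^sup>2 / 2)))"
          by (simp only: mult_ac)
        also have "\<dots> = indicator (cball 0 R) w * u w powr (q - 1)" unfolding v1 by simp
        finally show ?thesis using p0 q(2) by (simp add: powr_mult powr_powr indicator_def)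
      qed
      have intI: "integrable dV (\<lambda>w. indicator (cball 0 R) w * u w powr q)"
        by (rule integrable_dV_bounded_support[of _ R "(M * V) powr q"])
          (use uM u0 q0 in \<open>auto simp: indicator_def intro!: powr_mono2\<close>)
      define I where "I = (LINT w|dV. indicator (cball 0 R) w * u w powr q)"
      have I0: "I \<ge> 0" unfolding I_def by (intro integral_nonneg_AE) auto
      have \<psi>meas: "\<psi> \<in> borel_measurable borel" by measurable
      have K: "entire (kernel_op N s \<psi>)" "kernel_op N s \<psi> \<in> fock_space (\<alpha> * p) p"
        "(\<lambda>k. of_real (a k) / fact k * (LINT w|dV. \<psi> w * \<Lambda> (\<lambda>z. hinner z w ^ k))) sums \<Lambda> (kernel_op N s \<psi>)"
        unfolding a_def by (rule functional_kernel_op[OF p(1) s L \<psi>meas \<psi>b \<psi>0 R]; assumption)+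
      have "fock_norm (\<alpha> * p) p (kernel_op N s \<psi>) \<le> T * I powr (1 / p)"
        using T(3)[OF \<psi>meas _ K(1)] intI unfolding \<Phi> I_def by blast
      then have up: "cmod (\<Lambda> (kernel_op N s \<psi>)) \<le> B * (T * I powr (1 / p))"
        using B K(2) by (meson mult_left_mono order_trans)
      have S: "(\<lambda>k. LINT w|dV. \<psi> w * cnj (G k w)) sums (LINT w|dV. (\<Sum>k. \<psi> w * cnj (G k w)))"
      proof -
        obtain K where K: "K \<ge> 0" "\<And>k w. norm w \<le> R \<Longrightarrow> cmod (G k w) \<le> K * (1 / 2) ^ k" using bound[of R] R by auto
        have Gm[measurable]: "G k \<in> borel_measurable borel" for k using G entire_measurable by blast
        define P where "P = (M * V) powr (q - 1) * V"
        have P: "P \<ge> 0" by (simp add: P_def V_def)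
        have le: "cmod (\<psi> w * cnj (G k w)) \<le> (P * K) * (1 / 2) ^ k * indicator (cball 0 R) w" for k w
        proof (cases "norm w \<le> R")
          case True
          then have "cmod (\<psi> w) * cmod (G k w) \<le> P * (K * (1 / 2) ^ k)"
            using \<psi>b K P by (intro mult_mono) (auto simp: P_def)
          then show ?thesis using True by (simp add: norm_mult)
        qed (simp add: \<psi>0)
        have ballint: "integrable dV (\<lambda>w :: complex ^ 'n. c * indicator (cball 0 R) w :: real)" for c
          using finite_dV_bounded[of "cball (0 :: complex ^ 'n) R"]
          by (intro integrable_mult_right integrable_real_indicator) auto
        have int: "integrable dV (\<lambda>w. \<psi> w * cnj (G k w))" for k
          by (rule Bochner_Integration.integrable_bound[OF ballint[of "(P * K) * (1 / 2) ^ k"]])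
            (use order_trans[OF le abs_ge_self] in auto)
        show ?thesis
        proof (rule sums_integral[OF int])
          show "AE w in dV. summable (\<lambda>k. cmod (\<psi> w * cnj (G k w)))"
          proof (rule AE_I2)
            fix w
            have "cmod (\<psi> w * cnj (G k w)) \<le> (P * K) * (1 / 2) ^ k" for k
            proof -
              have "(P * K) * (1 / 2) ^ k * indicator (cball 0 R) w \<le> (P * K) * (1 / 2) ^ k * 1"
                using P K(1) by (intro mult_left_mono) (auto simp: indicator_def)
              then show ?thesis using le[of w k] by simp
            qed
            then show "summable (\<lambda>k. cmod (\<psi> w * cnj (G k w)))"
              by (intro summable_comparison_test'[OF geo[of "P * K"], of 0]) simp
          qed
          define m where "m = measure (dV :: (complex ^ 'n) measure) (cball 0 R)"
          have "norm (LINT w|dV. cmod (\<psi> w * cnj (G k w))) \<le> (P * K * m) * (1 / 2) ^ k" for k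
          proof -
            have "(LINT w|dV. cmod (\<psi> w * cnj (G k w))) \<le> (LINT w|dV. (P * K) * (1 / 2) ^ k * indicator (cball 0 R) (w :: complex ^ 'n))"
              by (rule integral_mono[OF integrable_norm[OF int] ballint le])
            then show ?thesis by (simp add: m_def mult_ac)
          qed
          then show "summable (\<lambda>k. LINT w|dV. cmod (\<psi> w * cnj (G k w)))"
            by (intro summable_comparison_test'[OF geo[of "P * K * m"], of 0])
        qed
      qed
      have S1: "(\<Sum>k. \<psi> w * cnj (G k w)) = of_real (indicator (cball 0 R) w * u w powr q)" for w
      proof -
        have "(\<lambda>k. cnj (G k w)) sums cnj (g w)" using gsums[of w] by (simp only: sums_cnj)
        from sums_mult[OF this, of "\<psi> w"] show ?thesis by (simp only: \<psi>g sums_iff)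
      qed
      have S2: "(LINT w|dV. \<psi> w * cnj (G k w)) = of_real (a k) / fact k * (LINT w|dV. \<psi> w * \<Lambda> (\<lambda>z. hinner z w ^ k))" for k
      proof -
        have "(LINT w|dV. \<psi> w * cnj (G k w)) = (LINT w|dV. of_real (a k) / fact k * (\<psi> w * \<Lambda> (\<lambda>z. hinner z w ^ k)))"
          by (intro Bochner_Integration.integral_cong refl) (simp add: G_def)
        then show ?thesis by simp
      qed
      \<comment> \<open>One series, two sums: \<Lambda> applied to the image of \<psi> on one side,
        the integral of \<psi> cnj(g) on the other.\<close>
      have "\<Lambda> (kernel_op N s \<psi>) = (LINT w|dV. complex_of_real (indicator (cball 0 R) w * u w powr q))"
        using K(3) S[unfolded S1 S2] by (rule sums_unique2)
      also have "\<dots> = of_real I" unfolding I_def by (rule integral_complex_of_real)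
      finally have "I \<le> (T * B) * I powr (1 / p)"
        using up I0 by (simp add: mult_ac)
      \<comment> \<open>I is finite because the integral runs over a ball, so I^(1/p) may be divided
        out; the exponent left is 1 - 1/p = 1/q.\<close>
      then have "I \<le> (T * B) powr q"
      proof (cases "I = 0")
        case False
        then have I: "I > 0" using I0 by simp
        have "1 / q = 1 - 1 / p" using p by simp
        then have "I powr (1 / q) = I / I powr (1 / p)" using I by (simp add: powr_diff)
        also have "\<dots> \<le> T * B" using \<open>I \<le> (T * B) * I powr (1 / p)\<close> I by (simp add: field_simps)
        finally have "(I powr (1 / q)) powr q \<le> (T * B) powr q" using q0 by (intro powr_mono2) auto
        then show ?thesis using I q0 by (simp add: powr_powr)
      qed simp
      then show ?thesis using intI by (simp add: I_def)
    qed
    \<comment> \<open>The bound over balls does not depend on R, so monotone convergence extends it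
      to the whole space.\<close>
    have lim: "integrable dV (\<lambda>w. u w powr q) \<and> (LINT w|dV. u w powr q) \<le> (T * B) powr q"
    proof -
      define f where "f i w = indicator (cball (0 :: complex ^ 'n) (real (Suc i))) w * u w powr q" for i w
      have fi: "integrable dV (f i)" "(LINT w|dV. f i w) \<le> (T * B) powr q" for i
      proof -
        have "real (Suc i) > 0" by simp
        from ball[OF this] show "integrable dV (f i)" "(LINT w|dV. f i w) \<le> (T * B) powr q"
          unfolding f_def[abs_def] by blast+
      qed
      have mono: "incseq (\<lambda>i. f i w)" for w
        unfolding f_def incseq_def by (auto simp: indicator_def)
      have conv: "(\<lambda>i. f i w) \<longlonglongrightarrow> u w powr q" for w
      proof (rule tendsto_eventually)
        obtain j where j: "norm w \<le> real j" using real_arch_simple by blast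
        show "\<forall>\<^sub>F i in sequentially. f i w = u w powr q"
          using eventually_ge_at_top[of j] by eventually_elim (use j in \<open>auto simp: f_def indicator_def\<close>)
      qed
      have inc: "incseq (\<lambda>i. LINT w|dV. f i w)"
        using fi(1) mono by (auto simp: incseq_def intro!: integral_mono)
      have "bdd_above (range (\<lambda>i. LINT w|dV. f i w))" using fi(2) by (intro bdd_aboveI2)
      then have L: "(\<lambda>i. LINT w|dV. f i w) \<longlonglongrightarrow> (SUP i. LINT w|dV. f i w)"
        by (rule LIMSEQ_incseq_SUP[OF _ inc])
      have hb: "has_bochner_integral dV (\<lambda>w. u w powr q) (SUP i. LINT w|dV. f i w)"
        by (rule has_bochner_integral_monotone_convergence[OF fi(1) _ _ L]) (use mono conv in \<open>auto simp: mono_def incseq_def\<close>)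
      moreover have "(SUP i. LINT w|dV. f i w) \<le> (T * B) powr q" using fi(2) by (intro cSUP_least) auto
      ultimately show ?thesis by (simp add: has_bochner_integral_iff)
    qed
    have gF: "g \<in> fock_space (\<beta> * q) q" using lim entg by (simp add: fock_space_iff u_def)
    have "fock_norm (\<beta> * q) q g \<le> ((T * B) powr q) powr (1 / q)"
      unfolding fock_norm_eq using lim q0 by (intro powr_mono2 integral_nonneg_AE) (auto simp: u_def)
    also have "\<dots> = T * B" using T(1) B(1) q0 by (simp add: powr_powr)
    also have "\<dots> \<le> (T + 1) * B" using B(1) by (intro mult_right_mono) auto
    finally show ?thesis using gF hg by (intro bexI[of _ g]) (auto simp: G_def)
  qed
  \<comment> \<open>T may be 0. Adding 1 gives a positive constant, whose inverse becomes the lower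
    constant in the norm equivalence.\<close>
  then show ?thesis using T(1) by (intro that[of "T + 1"]) (auto simp: a_def s_def)
qed

theorem theorem5p5:
  fixes p q \<alpha> \<beta> :: real
  assumes "1 < p" and "1 / p + 1 / q = 1"
  shows
    "(\<forall>g \<in> (fock_space (\<beta> * q) q :: (complex ^ 'n::finite \<Rightarrow> complex) set).
        (\<forall>f \<in> fock_space (\<alpha> * p) p. pairing_well_defined (\<alpha> + \<beta>) f g) \<and>
        bounded_functional (\<alpha> * p) p (\<lambda>f. pairing (\<alpha> + \<beta>) f g)) \<and>
     (\<forall>\<Lambda> :: (complex ^ 'n \<Rightarrow> complex) \<Rightarrow> complex. bounded_functional (\<alpha> * p) p \<Lambda> \<longrightarrow>
        (\<exists>!g. g \<in> fock_space (\<beta> * q) q \<and>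
              (\<forall>f \<in> fock_space (\<alpha> * p) p. \<Lambda> f = pairing (\<alpha> + \<beta>) f g))) \<and>
     (\<exists>c > 0. \<exists>C > 0. \<forall>g \<in> (fock_space (\<beta> * q) q :: (complex ^ 'n \<Rightarrow> complex) set).
        c * fock_norm (\<beta> * q) q g \<le> functional_norm (\<alpha> * p) p (\<lambda>f. pairing (\<alpha> + \<beta>) f g) \<and>
        functional_norm (\<alpha> * p) p (\<lambda>f. pairing (\<alpha> + \<beta>) f g) \<le> C * fock_norm (\<beta> * q) q g)"
proof -
  note p = assms
  have q: "1 < q" using conjugate_exponents[OF p] by blast
  have p0: "p > 0" using p by simp
  let ?\<sigma> = "\<alpha> + \<beta>"
  define N where "N = cutoff CARD('n) ?\<sigma>"
  have N: "?\<sigma> / 2 < real (CARD('n) + N)" unfolding N_def by (rule less_cutoff)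
  define X where "X = (fock_space (\<alpha> * p) p :: (complex ^ 'n \<Rightarrow> complex) set)"
  define Y where "Y = (fock_space (\<beta> * q) q :: (complex ^ 'n \<Rightarrow> complex) set)"
  define S where "S f g = split_pairing N ?\<sigma> f g" for f g :: "complex ^ 'n \<Rightarrow> complex"
  have growth: "f \<in> X \<Longrightarrow> gaussian_growth f" "g \<in> Y \<Longrightarrow> gaussian_growth g" for f g
    unfolding X_def Y_def using fock_gaussian_growth p(1) q by blast+
  have pair: "pairing ?\<sigma> f g = S f g" if "f \<in> X" "g \<in> Y" for f g
    unfolding S_def N_def by (intro pairing_eq_split_pairing growth that)
  obtain C where C: "C \<ge> 0" "\<And>f g. f \<in> X \<Longrightarrow> g \<in> Y \<Longrightarrow>
    integrable dV (weighted_integrand 0 (lo N f) (lo N g)) \<and>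
    integrable dV (weighted_integrand ?\<sigma> (hi N f) (hi N g)) \<and>
    cmod (S f g) \<le> C * fock_norm (\<alpha> * p) p f * fock_norm (\<beta> * q) q g"
    using split_pairing_bound[OF p N] unfolding X_def Y_def S_def by blast
  obtain T where T: "T > 0" "\<And>(\<Lambda> :: (complex ^ 'n \<Rightarrow> complex) \<Rightarrow> complex) B. bounded_functional (\<alpha> * p) p \<Lambda> \<Longrightarrow> B \<ge> 0 \<Longrightarrow>
    (\<And>f. f \<in> X \<Longrightarrow> cmod (\<Lambda> f) \<le> B * fock_norm (\<alpha> * p) p f) \<Longrightarrow>
    \<exists>g \<in> Y. fock_norm (\<beta> * q) q g \<le> T * B \<and>
      (\<forall>k w. hpart g k w = of_real (kernel_coeff N CARD('n) (?\<sigma> / 2) k) / fact k * cnj (\<Lambda> (\<lambda>z. hinner z w ^ k)))"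
    using representing_function[OF p N] unfolding X_def Y_def by blast
  have bfS: "bounded_functional (\<alpha> * p) p (\<lambda>f. S f g)" if "g \<in> Y" for g
    unfolding S_def using bounded_functional_split_pairing[OF p N] that unfolding Y_def by blast
  have bfP: "bounded_functional (\<alpha> * p) p (\<lambda>f. pairing ?\<sigma> f g)" if g: "g \<in> Y" for g
  proof -
    \<comment> \<open>\<open>bounded_functional\<close> also evaluates at sums and multiples, where
      \<open>pair\<close> applies only once these are known to lie in X.\<close>
    have X: "(\<lambda>z. f z + h z) \<in> X" "(\<lambda>z. c * f z) \<in> X" if "f \<in> X" "h \<in> X" for f h c
      using that unfolding X_def by (auto intro: fock_space_add fock_space_cmult p p0)
    show ?thesis
      using bfS[OF g] pair[OF _ g] X unfolding bounded_functional_def X_def[symmetric] by simp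
  qed
  define a where "a k = kernel_coeff N CARD('n) (?\<sigma> / 2) k" for k
  have a0: "a k > 0" for k unfolding a_def by (rule kernel_coeff_pos[OF _ N]) simp
  have hP: "(\<lambda>z. hinner z w ^ k) \<in> X" for w :: "complex ^ 'n" and k
    unfolding X_def by (rule hinner_power_in_fock_space[OF p0])
  have SP: "S (\<lambda>z. hinner z w ^ k) g = fact k / of_real (a k) * cnj (hpart g k w)" if "g \<in> Y" for g k w
    unfolding S_def a_def using split_pairing_hinner_power[OF p N] that unfolding Y_def by blast
  \<comment> \<open>Testing with the powers of the inner product recovers all homogeneous parts of
    g, since the factors in \<open>SP\<close> are nonzero.\<close>
  have uniq: "g = h" if g: "g \<in> Y" and h: "h \<in> Y" and eq: "\<And>f. f \<in> X \<Longrightarrow> S f g = S f h" for g h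
  proof
    fix w
    have ent: "entire g" "entire h" using g h by (auto simp: Y_def fock_space_iff)
    have "hpart g k w = hpart h k w" for k
      using eq[OF hP[of w k]] a0[of k] by (simp add: SP[OF g] SP[OF h])
    then show "g w = h w" using hpart_sums[OF ent(1), of w] hpart_sums[OF ent(2), of w] sums_unique2 by simp
  qed
  have rep: "\<exists>g\<in>Y. fock_norm (\<beta> * q) q g \<le> T * B \<and> (\<forall>f\<in>X. \<Lambda> f = S f g)"
    if L: "bounded_functional (\<alpha> * p) p \<Lambda>" and B: "B \<ge> 0" "\<And>f. f \<in> X \<Longrightarrow> cmod (\<Lambda> f) \<le> B * fock_norm (\<alpha> * p) p f"
    for \<Lambda> :: "(complex ^ 'n \<Rightarrow> complex) \<Rightarrow> complex" and B
  proof -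
    obtain g where g: "g \<in> Y" "fock_norm (\<beta> * q) q g \<le> T * B"
      "\<And>k w. hpart g k w = of_real (a k) / fact k * cnj (\<Lambda> (\<lambda>z. hinner z w ^ k))"
      using T(2)[OF L B] unfolding a_def by blast
    have "\<Lambda> (\<lambda>z. hinner z w ^ k) = S (\<lambda>z. hinner z w ^ k) g" for k and w :: "complex ^ 'n"
      using a0[of k] by (simp add: SP[OF g(1)] g(3))
    then have "\<Lambda> f = S f g" if "f \<in> X" for f
      using bounded_functional_eqI[OF p(1) L bfS[OF g(1)]] that unfolding X_def by blast
    then show ?thesis using g by blast
  qed
  have part1: "pairing_well_defined ?\<sigma> f g" if f: "f \<in> X" and g: "g \<in> Y" for f g
    using C(2)[OF f g] by (intro pairing_well_definedI[OF growth(1)[OF f] growth(2)[OF g] N_def]) auto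
  have part2: "\<exists>!g. g \<in> Y \<and> (\<forall>f\<in>X. \<Lambda> f = pairing ?\<sigma> f g)" if L: "bounded_functional (\<alpha> * p) p \<Lambda>" for \<Lambda> :: "(complex ^ 'n \<Rightarrow> complex) \<Rightarrow> complex"
  proof -
    obtain B where B: "B \<ge> 0" "\<And>f. f \<in> X \<Longrightarrow> cmod (\<Lambda> f) \<le> B * fock_norm (\<alpha> * p) p f"
      using bounded_functionalE[OF L] unfolding X_def by blast
    obtain g where g: "g \<in> Y" "\<forall>f\<in>X. \<Lambda> f = S f g" using rep[OF L B] by blast
    show ?thesis
    proof (rule ex1I[of _ g])
      show "g \<in> Y \<and> (\<forall>f\<in>X. \<Lambda> f = pairing ?\<sigma> f g)" using g pair by simp
      show "h = g" if h: "h \<in> Y \<and> (\<forall>f\<in>X. \<Lambda> f = pairing ?\<sigma> f h)" for h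
        by (rule uniq) (use h g pair in auto)
    qed
  qed
  have part3: "1 / T * fock_norm (\<beta> * q) q g \<le> functional_norm (\<alpha> * p) p (\<lambda>f. pairing ?\<sigma> f g) \<and>
      functional_norm (\<alpha> * p) p (\<lambda>f. pairing ?\<sigma> f g) \<le> (C + 1) * fock_norm (\<beta> * q) q g" if g: "g \<in> Y" for g
  proof -
    define F where "F = functional_norm (\<alpha> * p) p (\<lambda>f. pairing ?\<sigma> f g)"
    define ng where "ng = fock_norm (\<beta> * q) q g"
    have ng: "ng \<ge> 0" by (simp add: ng_def fock_norm_nonneg)
    define U where "U = {f \<in> X. fock_norm (\<alpha> * p) p f \<le> 1}"
    have F: "F = (SUP f\<in>U. cmod (S f g))"
      unfolding F_def functional_norm_def U_def X_def[symmetric]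
      by (intro SUP_cong refl) (simp add: pair g)
    have up: "cmod (S f g) \<le> C * ng" if "f \<in> U" for f
    proof -
      have "cmod (S f g) \<le> C * fock_norm (\<alpha> * p) p f * ng"
        using C(2)[of f g] that g by (simp add: U_def ng_def)
      also have "\<dots> \<le> C * 1 * ng"
        using that C(1) ng by (intro mult_right_mono mult_left_mono) (auto simp: U_def)
      finally show ?thesis by simp
    qed
    \<comment> \<open>The zero function makes the supremum one over a nonempty set and shows that it
      is nonnegative.\<close>
    have z: "(\<lambda>z. 0) \<in> X" unfolding X_def by (rule fock_space_zero[OF p0])
    have "fock_norm (\<alpha> * p) p (\<lambda>z :: complex ^ 'n. 0) = 0"
      using fock_space_cmult(2)[OF p0 z[unfolded X_def], of 0] by simp
    then have zU: "(\<lambda>z. 0) \<in> U" using z by (simp add: U_def)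
    have bdd: "bdd_above ((\<lambda>f. cmod (S f g)) ` U)" using up by (intro bdd_aboveI2)
    have "F \<le> C * ng" unfolding F using zU up by (intro cSUP_least) auto
    \<comment> \<open>C may be 0, whereas the upper constant has to be positive.\<close>
    also have "\<dots> \<le> (C + 1) * ng" using ng by (intro mult_right_mono) auto
    finally have 1: "F \<le> (C + 1) * ng" .
    have F0: "F \<ge> 0"
      unfolding F by (rule cSUP_upper2[OF bdd zU]) simp
    have low: "cmod (S f g) \<le> F * fock_norm (\<alpha> * p) p f" if f: "f \<in> X" for f
    \<comment> \<open>Scaling to norm 1 needs a nonzero norm; for norm 0 the upper bound already
      forces the value 0.\<close>
    proof (cases "fock_norm (\<alpha> * p) p f = 0")
      case True
      then show ?thesis using C(2)[OF f g] by simp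
    next
      case False
      define r where "r = fock_norm (\<alpha> * p) p f"
      have r: "r > 0" using False fock_norm_nonneg[of "\<alpha> * p" p f] by (simp add: r_def)
      have m: "(\<lambda>z. of_real (1 / r) * f z) \<in> X" "fock_norm (\<alpha> * p) p (\<lambda>z. of_real (1 / r) * f z) = cmod (of_real (1 / r)) * r"
        using fock_space_cmult[OF p0 f[unfolded X_def], of "of_real (1 / r)"] unfolding X_def r_def by blast+
      then have "(\<lambda>z. of_real (1 / r) * f z) \<in> U" using r by (simp add: U_def norm_divide)
      then have "cmod (S (\<lambda>z. of_real (1 / r) * f z) g) \<le> F"
        unfolding F by (intro cSUP_upper bdd)
      moreover have "S (\<lambda>z. of_real (1 / r) * f z) g = of_real (1 / r) * S f g"
        by (rule bounded_functional_cmult[OF bfS[OF g] f[unfolded X_def]])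
      ultimately have "cmod (S f g) / r \<le> F" using r by (simp add: norm_divide)
      then show ?thesis using r by (simp add: r_def field_simps)
    qed
    \<comment> \<open>The lower estimate: the functional induced by g is represented again, now with
      its own norm F as the bound. The representing function satisfies the norm estimate, and by
      uniqueness it is g itself.\<close>
    obtain h where h: "h \<in> Y" "fock_norm (\<beta> * q) q h \<le> T * F" "\<forall>f\<in>X. S f g = S f h"
      using rep[OF bfS[OF g] F0 low] by blast
    have "g = h" by (rule uniq[OF g h(1)]) (use h(3) in blast)
    then have "ng \<le> T * F" using h(2) by (simp add: ng_def)
    then have "1 / T * ng \<le> F" using T(1) by (simp add: field_simps)
    then show ?thesis using 1 by (simp add: F_def ng_def)
  qed
  show ?thesis
    unfolding X_def[symmetric] Y_def[symmetric]
  proof (intro conjI ballI allI impI)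
    show "\<exists>c>0. \<exists>C>0. \<forall>g\<in>Y. c * fock_norm (\<beta> * q) q g \<le> functional_norm (\<alpha> * p) p (\<lambda>f. pairing ?\<sigma> f g) \<and>
        functional_norm (\<alpha> * p) p (\<lambda>f. pairing ?\<sigma> f g) \<le> C * fock_norm (\<beta> * q) q g"
      using T(1) C(1) part3 by (intro exI[of _ "1 / T"] exI[of _ "C + 1"] conjI ballI) auto
  qed (use part1 part2 bfP in blast)+
qed

end
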